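(* Let $\alpha$ be irrational, let $\mathbb M_1,\mathbb M_2$ be $\omega_1$-saturated models of $\mathbb T_\alpha$ and $\varphi(\bar x)$ an $\mathcal L_p$-formula. Then there exists a natural number $n=n_\varphi$ such that for all tuples $\bar a_1\in\mathbb M_1^{|\bar x|}$ and $\bar a_2\in\mathbb M_2^{|\bar x|}$: if $\operatorname{cl}^n_{\mathbb M_1}(\bar a_1)$ is weakly isomorphic to $\operatorname{cl}^n_{\mathbb M_2}(\bar a_2)$ via a map sending $\bar a_1$ to $\bar a_2$, then $\mathbb M_1\models\varphi(\bar a_1)$ if and only if $\mathbb M_2\models\varphi(\bar a_2)$.
   Context: Let $T$ be a complete theory in a countable first-order language $\mathcal{L}$, with no finite models, admitting quantifier elimination, and geometric: $T$ eliminates $\exists^{\infty}$ and in every model of $T$ the algebraic closure $\operatorname{acl}$ satisfies exchange. $\dim$ is the associated dimension. Sets $Y,Z$ are free over $X$ if $\dim(\bar a/X)=\dim(\bar a/XZ)$ for all finite tuples $\bar a$ from $Y$ and $Y\cap Z=X$. $T$ is indecomposable (no finite-dimensional algebraically closed set $X$ is a finite union of sets of dimension $<\dim(X)$) and has the free-amalgamation property (for $M_0,M_1,M_2\models T^{\forall}$ and embeddings $f_i:M_0\to M_i$ with $\operatorname{acl}(f_i(M_0))=f_i(M_0)$, there are $M\models T$ and embeddings $g_i:M_i\to M$ with $g_1f_1=g_2f_2$ and $g_1(M_1),g_2(M_2)$ free over $g_1f_1(M_0)$). $\mathcal{L}_p=\mathcal{L}\cup\{p\}$, $p$ a new unary predicate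 ("colored" elements); $\mathcal K$ is the class of $\mathcal L_p$-structures whose $\mathcal L$-reduct models $T^\forall$. Fix real $0<\alpha\le1$. $\delta(A)=\dim(A)-\alpha|p(A)|$, $\delta(A/X)=\dim(A/X)-\alpha|p(A/X)|$ ($p(A/X)$ the colored elements of $A\setminus X$). $\mathcal K_\alpha^+$: those $M\in\mathcal K$ with $\delta(A)\ge0$ for all finite $A$. $X\le Y$ means $X\subseteq Y$ and $\delta(A/X)\ge0$ for all finite $A\subseteq Y$. For finite $A\subseteq B$, $A\le_i B$ ($B$ intrinsic over $A$) means $\delta(B)<\delta(A')$ for all $A\subseteq A'\subsetneq B$. For a tuple or set $A\subseteq M$ and $n\in\mathbb N$, $\operatorname{cl}^n_M(A)$ is the union of all $B\subseteq M$ with $A\le_i B$ and $|B\setminus A|<n$. For sets $X,Y$ in $\mathcal L_p$-structures, $X$ is weakly isomorphic to $Y$ if there is an $\mathcal L$-isomorphism $f:\langle X\rangle\to\langle Y\rangle$ between the $\mathcal L$-structures they generate, mapping $X$ onto $Y$, with $p(x)\leftrightarrow p(f(x))$ for all $x\in X$. For finite tuples $\bar a,\bar d$ in a structure of $\mathcal K_\alpha^+$ with $\bar a\le\bar a\bar d$, $\bar d$ is transcendental over $\bar a$ if $\dim(d/\bar a)=1$ for each entry $d$ of $\bar d$ not in $\bar a$. An $\mathcal L$-formula $\varphi(\bar x,\bar y)$ is strong w.r.t. tuples $\bar d,\bar a$ (with pairwise distinct entries) if $\varphi(\bar x,\bar a)$ is in the quantifier-free $\mathcal L$-type of $\bar d$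 over $\bar a$ and in a sufficiently saturated model of $T$: (i) any $\bar d'\bar a'$ satisfying $\varphi$ has pairwise distinct entries; (ii) if $\varphi(\bar d',\bar a')$ and $\dim(\bar d'/\bar a')=\dim(\bar d/\bar a)$ then for every partition $(\bar x_1,\bar x_2)$ of $\bar x$ with corresponding splittings, $\dim(\bar d_2'/\bar d_1'\bar a')\le\dim(\bar d_2/\bar d_1\bar a)$. $d_{\varphi,k}(\bar y)$ is an $\mathcal L$-formula defining the set of $\bar b$ with $\max\{\dim(\bar e/\bar b):\varphi(\bar e,\bar b)\}=k$, and $D_{\varphi,k}(\bar y)$ one defining the set of $\bar b$ such that some $\bar e$ with $\varphi(\bar e,\bar b)$ has $\dim(\bar e/\bar b)\ge k$ and no entry in $\operatorname{acl}(\bar b)$. $\mathbb T_\alpha$ is the $\mathcal L_p$-theory whose models $\mathbb M$ satisfy: $\mathbb M\models T$; $\mathbb M\in\mathcal K_\alpha^+$; and for all $\bar a,\bar d=(d_1,\dots,d_n)$ in a structure of $\mathcal K_\alpha^+$ with $\bar a\le\bar a\bar d$, $\bar d$ transcendental over $\bar a$, $\dim(\bar d/\bar a)=k$, and every $\varphi$ strong w.r.t. $\bar d,\bar a$: $\mathbb M\models\forall\bar y[D_{\varphi,k}(\bar y)\wedge d_{\varphi,k}(\bar y)\to\exists\bar z(\varphi(\bar z,\bar y)\wedge\bigwedge_{p(d_i)}p(z_i)\wedge\bigwedge_{\neg p(d_i)}\neg p(z_i))]$. *)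

theory Defs
  imports Complex_Main "HOL-Library.Countable_Set"
begin

section \<open>First-order languages, formulas and structures\<close>

record ('f, 'r) language =
  Funs :: "'f set"
  Rels :: "'r set"
  farity :: "'f \<Rightarrow> nat"
  rarity :: "'r \<Rightarrow> nat"

definition countable_language :: "('f, 'r) language \<Rightarrow> bool" where
  "countable_language L \<longleftrightarrow> countable (Funs L) \<and> countable (Rels L)"

datatype 'f tm = Var nat | App 'f "'f tm list"

datatype ('f, 'r) fm =
    Fls
  | Eq "'f tm" "'f tm"
  | Rel 'r "'f tm list"
  | Imp "('f, 'r) fm" "('f, 'r) fm"
  | All nat "('f, 'r) fm"

abbreviation Neg :: "('f, 'r) fm \<Rightarrow> ('f, 'r) fm" where
  "Neg \<phi> \<equiv> Imp \<phi> Fls"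

fun tvars :: "'f tm \<Rightarrow> nat set" where
  "tvars (Var x) = {x}"
| "tvars (App f ts) = (\<Union>t\<in>set ts. tvars t)"

fun FV :: "('f, 'r) fm \<Rightarrow> nat set" where
  "FV Fls = {}"
| "FV (Eq s t) = tvars s \<union> tvars t"
| "FV (Rel r ts) = (\<Union>t\<in>set ts. tvars t)"
| "FV (Imp \<phi> \<psi>) = FV \<phi> \<union> FV \<psi>"
| "FV (All x \<phi>) = FV \<phi> - {x}"

fun wf_tm :: "('f, 'r) language \<Rightarrow> 'f tm \<Rightarrow> bool" where
  "wf_tm L (Var x) \<longleftrightarrow> True"
| "wf_tm L (App f ts) \<longleftrightarrow>
     f \<in> Funs L \<and> length ts = farity L f \<and> (\<forall>t\<in>set ts. wf_tm L t)"

fun wf_fm :: "('f, 'r) language \<Rightarrow> ('f, 'r) fm \<Rightarrow> bool" where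
  "wf_fm L Fls \<longleftrightarrow> True"
| "wf_fm L (Eq s t) \<longleftrightarrow> wf_tm L s \<and> wf_tm L t"
| "wf_fm L (Rel r ts) \<longleftrightarrow>
     r \<in> Rels L \<and> length ts = rarity L r \<and> (\<forall>t\<in>set ts. wf_tm L t)"
| "wf_fm L (Imp \<phi> \<psi>) \<longleftrightarrow> wf_fm L \<phi> \<and> wf_fm L \<psi>"
| "wf_fm L (All x \<phi>) \<longleftrightarrow> wf_fm L \<phi>"

definition sentence :: "('f, 'r) language \<Rightarrow> ('f, 'r) fm \<Rightarrow> bool" where
  "sentence L \<phi> \<longleftrightarrow> wf_fm L \<phi> \<and> FV \<phi> = {}"

fun qfree :: "('f, 'r) fm \<Rightarrow> bool" where
  "qfree (Imp \<phi> \<psi>) \<longleftrightarrow> qfree \<phi> \<and> qfree \<psi>"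
| "qfree (All x \<phi>) \<longleftrightarrow> False"
| "qfree \<phi> \<longleftrightarrow> True"

fun universal :: "('f, 'r) fm \<Rightarrow> bool" where
  "universal (All x \<phi>) \<longleftrightarrow> universal \<phi>"
| "universal \<phi> \<longleftrightarrow> qfree \<phi>"

text \<open>
  The universe of a structure is a subset of a type \<open>'u\<close>.  Everything below that ranges over
  ``all structures'' ranges over the structures whose universe is a subset of one fixed \<open>'u\<close>,
  recorded by an argument of type \<open>'u itself\<close> where it cannot be inferred.  The type \<open>'u\<close>
  is arbitrary; two structures on different types can be put on a common one.  Once \<open>'u\<close> is
  infinite, the Loewenheim-Skolem theorem for countable languages shows that the notion of
  consequence does not depend on \<open>'u\<close>.
\<close>

record ('f, 'r, 'u) fo_struct =
  carrier :: "'u set"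
  fint :: "'f \<Rightarrow> 'u list \<Rightarrow> 'u"
  rint :: "'r \<Rightarrow> 'u list \<Rightarrow> bool"

definition is_struct :: "('f, 'r) language \<Rightarrow> ('f, 'r, 'u) fo_struct \<Rightarrow> bool" where
  "is_struct L M \<longleftrightarrow> carrier M \<noteq> {} \<and>
     (\<forall>f\<in>Funs L. \<forall>xs. set xs \<subseteq> carrier M \<and> length xs = farity L f
        \<longrightarrow> fint M f xs \<in> carrier M)"

fun eval :: "('f, 'r, 'u) fo_struct \<Rightarrow> (nat \<Rightarrow> 'u) \<Rightarrow> 'f tm \<Rightarrow> 'u" where
  "eval M e (Var x) = e x"
| "eval M e (App f ts) = fint M f (map (eval M e) ts)"

fun sat :: "('f, 'r, 'u) fo_struct \<Rightarrow> (nat \<Rightarrow> 'u) \<Rightarrow> ('f, 'r) fm \<Rightarrow> bool" where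
  "sat M e Fls \<longleftrightarrow> False"
| "sat M e (Eq s t) \<longleftrightarrow> eval M e s = eval M e t"
| "sat M e (Rel r ts) \<longleftrightarrow> rint M r (map (eval M e) ts)"
| "sat M e (Imp \<phi> \<psi>) \<longleftrightarrow> (sat M e \<phi> \<longrightarrow> sat M e \<psi>)"
| "sat M e (All x \<phi>) \<longleftrightarrow> (\<forall>a\<in>carrier M. sat M (e(x := a)) \<phi>)"

text \<open>
  The tuple \<open>xs\<close> is substituted for the variables \<open>0, \<dots>, length xs - 1\<close>; this is meant for
  formulas with \<open>FV \<phi> \<subseteq> {..<length xs}\<close>, where the values of \<open>(!) xs\<close> beyond the length are
  irrelevant.  A formula in the variable tuples \<open>x, y\<close> is evaluated at \<open>d @ a\<close>.
\<close>

definition holds :: "('f, 'r, 'u) fo_struct \<Rightarrow> ('f, 'r) fm \<Rightarrow> 'u list \<Rightarrow> bool" where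
  "holds M \<phi> xs \<longleftrightarrow> sat M (\<lambda>i. xs ! i) \<phi>"

definition tuples :: "('f, 'r, 'u) fo_struct \<Rightarrow> nat \<Rightarrow> 'u list set" where
  "tuples M n = {xs. length xs = n \<and> set xs \<subseteq> carrier M}"

definition valid_in :: "('f, 'r, 'u) fo_struct \<Rightarrow> ('f, 'r) fm \<Rightarrow> bool" where
  "valid_in M \<phi> \<longleftrightarrow> (\<forall>e. range e \<subseteq> carrier M \<longrightarrow> sat M e \<phi>)"

definition models :: "('f, 'r) language \<Rightarrow> ('f, 'r) fm set \<Rightarrow> ('f, 'r, 'u) fo_struct \<Rightarrow> bool" where
  "models L T M \<longleftrightarrow> is_struct L M \<and> (\<forall>\<phi>\<in>T. valid_in M \<phi>)"

definition entails ::
    "'u itself \<Rightarrow> ('f, 'r) language \<Rightarrow> ('f, 'r) fm set \<Rightarrow> ('f, 'r) fm \<Rightarrow> bool" where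
  "entails U L T \<phi> \<longleftrightarrow> (\<forall>M :: ('f, 'r, 'u) fo_struct. models L T M \<longrightarrow> valid_in M \<phi>)"

definition univ_part ::
    "'u itself \<Rightarrow> ('f, 'r) language \<Rightarrow> ('f, 'r) fm set \<Rightarrow> ('f, 'r) fm set" where
  "univ_part U L T = {\<phi>. sentence L \<phi> \<and> universal \<phi> \<and> entails U L T \<phi>}"

definition models_univ ::
    "('f, 'r) language \<Rightarrow> ('f, 'r) fm set \<Rightarrow> ('f, 'r, 'u) fo_struct \<Rightarrow> bool" where
  "models_univ L T M \<longleftrightarrow> models L (univ_part TYPE('u) L T) M"

definition embedding ::
    "('f, 'r) language \<Rightarrow> ('f, 'r, 'u) fo_struct \<Rightarrow> ('f, 'r, 'u) fo_struct \<Rightarrow> ('u \<Rightarrow> 'u) \<Rightarrow> bool" where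
  "embedding L M N g \<longleftrightarrow>
     g ` carrier M \<subseteq> carrier N \<and> inj_on g (carrier M) \<and>
     (\<forall>f\<in>Funs L. \<forall>xs\<in>tuples M (farity L f). g (fint M f xs) = fint N f (map g xs)) \<and>
     (\<forall>r\<in>Rels L. \<forall>xs\<in>tuples M (rarity L r). rint M r xs \<longleftrightarrow> rint N r (map g xs))"

definition isomorphism ::
    "('f, 'r) language \<Rightarrow> ('f, 'r, 'u) fo_struct \<Rightarrow> ('f, 'r, 'u) fo_struct \<Rightarrow> ('u \<Rightarrow> 'u) \<Rightarrow> bool" where
  "isomorphism L M N g \<longleftrightarrow> embedding L M N g \<and> g ` carrier M = carrier N"

inductive_set gen_set ::
    "('f, 'r) language \<Rightarrow> ('f, 'r, 'u) fo_struct \<Rightarrow> 'u set \<Rightarrow> 'u set"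
  for L :: "('f, 'r) language" and M :: "('f, 'r, 'u) fo_struct" and X :: "'u set" where
  base: "x \<in> X \<Longrightarrow> x \<in> gen_set L M X"
| step: "f \<in> Funs L \<Longrightarrow> length xs = farity L f \<Longrightarrow> \<forall>x\<in>set xs. x \<in> gen_set L M X
           \<Longrightarrow> fint M f xs \<in> gen_set L M X"

definition generated ::
    "('f, 'r) language \<Rightarrow> ('f, 'r, 'u) fo_struct \<Rightarrow> 'u set \<Rightarrow> ('f, 'r, 'u) fo_struct" where
  "generated L M X = M\<lparr>carrier := gen_set L M X\<rparr>"

text \<open>
  \<open>\<omega>\<^sub>1\<close>-saturation: finitely satisfiable 1-types over countable sets \<open>C\<close> are realized.  A formula
  in the variable \<open>0\<close> with parameters from \<open>C\<close> is a pair \<open>(\<phi>, e)\<close> where the assignment \<open>e\<close>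
  sends the other free variables of \<open>\<phi>\<close> into \<open>C\<close>.
\<close>

definition aleph1_saturated :: "('f, 'r) language \<Rightarrow> ('f, 'r, 'u) fo_struct \<Rightarrow> bool" where
  "aleph1_saturated L M \<longleftrightarrow>
     (\<forall>C P. countable C \<and> C \<subseteq> carrier M \<and>
        (\<forall>(\<phi>, e)\<in>P. wf_fm L \<phi> \<and> e ` (FV \<phi> - {0}) \<subseteq> C) \<and>
        (\<forall>Q. finite Q \<and> Q \<subseteq> P \<longrightarrow> (\<exists>c\<in>carrier M. \<forall>(\<phi>, e)\<in>Q. sat M (e(0 := c)) \<phi>))
      \<longrightarrow> (\<exists>c\<in>carrier M. \<forall>(\<phi>, e)\<in>P. sat M (e(0 := c)) \<phi>))"


section \<open>Algebraic closure and dimension\<close>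

definition acl :: "('f, 'r) language \<Rightarrow> ('f, 'r, 'u) fo_struct \<Rightarrow> 'u set \<Rightarrow> 'u set" where
  "acl L M X = {a \<in> carrier M. \<exists>\<phi> e. wf_fm L \<phi> \<and> e ` (FV \<phi> - {0}) \<subseteq> X \<and>
      sat M (e(0 := a)) \<phi> \<and> finite {c \<in> carrier M. sat M (e(0 := c)) \<phi>}}"

text \<open>
  In a structure \<open>M\<close> satisfying only the universal part of \<open>T\<close>, algebraic closure is the trace
  on \<open>M\<close> of the algebraic closure in a model of \<open>T\<close> extending \<open>M\<close>.  If \<open>T\<close> has quantifier
  elimination, the choice of the extension is immaterial.
\<close>

definition acl_univ ::
    "('f, 'r) language \<Rightarrow> ('f, 'r) fm set \<Rightarrow> ('f, 'r, 'u) fo_struct \<Rightarrow> 'u set \<Rightarrow> 'u set" where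
  "acl_univ L T M X = {a \<in> carrier M. \<exists>N g. models L T N \<and> embedding L M N g \<and>
      g a \<in> acl L N (g ` X)}"

definition is_basis :: "('u set \<Rightarrow> 'u set) \<Rightarrow> 'u set \<Rightarrow> 'u set \<Rightarrow> 'u set \<Rightarrow> bool" where
  "is_basis cl B A X \<longleftrightarrow> finite B \<and> B \<subseteq> A \<and> A \<subseteq> cl (X \<union> B) \<and>
      (\<forall>b\<in>B. b \<notin> cl (X \<union> (B - {b})))"

definition finite_dimensional :: "('u set \<Rightarrow> 'u set) \<Rightarrow> 'u set \<Rightarrow> bool" where
  "finite_dimensional cl A \<longleftrightarrow> (\<exists>B. is_basis cl B A {})"

text \<open>
  \<open>pdim cl A X\<close> is the dimension of \<open>A\<close> over \<open>X\<close>, for \<open>A\<close> with a finite basis over \<open>X\<close>.  By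
  exchange, all bases have the same size.
\<close>

definition pdim :: "('u set \<Rightarrow> 'u set) \<Rightarrow> 'u set \<Rightarrow> 'u set \<Rightarrow> nat" where
  "pdim cl A X = (LEAST n. \<exists>B. is_basis cl B A X \<and> card B = n)"

definition free_over :: "('u set \<Rightarrow> 'u set) \<Rightarrow> 'u set \<Rightarrow> 'u set \<Rightarrow> 'u set \<Rightarrow> bool" where
  "free_over cl Y Z X \<longleftrightarrow>
     (\<forall>as. set as \<subseteq> Y \<longrightarrow> pdim cl (set as) X = pdim cl (set as) (X \<union> Z)) \<and> Y \<inter> Z = X"


section \<open>Hypotheses on the base theory\<close>

definition complete_theory ::
    "'u itself \<Rightarrow> ('f, 'r) language \<Rightarrow> ('f, 'r) fm set \<Rightarrow> bool" where
  "complete_theory U L T \<longleftrightarrow> (\<forall>\<phi>\<in>T. sentence L \<phi>) \<and>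
     (\<exists>M :: ('f, 'r, 'u) fo_struct. models L T M) \<and>
     (\<forall>\<phi>. sentence L \<phi> \<longrightarrow> entails U L T \<phi> \<or> entails U L T (Neg \<phi>))"

definition no_finite_models ::
    "'u itself \<Rightarrow> ('f, 'r) language \<Rightarrow> ('f, 'r) fm set \<Rightarrow> bool" where
  "no_finite_models U L T \<longleftrightarrow>
     (\<forall>M :: ('f, 'r, 'u) fo_struct. models L T M \<longrightarrow> infinite (carrier M))"

definition quantifier_elimination ::
    "'u itself \<Rightarrow> ('f, 'r) language \<Rightarrow> ('f, 'r) fm set \<Rightarrow> bool" where
  "quantifier_elimination U L T \<longleftrightarrow>
     (\<forall>\<phi>. wf_fm L \<phi> \<longrightarrow> (\<exists>\<psi>. wf_fm L \<psi> \<and> qfree \<psi> \<and> FV \<psi> \<subseteq> FV \<phi> \<and>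
        entails U L T (Imp \<phi> \<psi>) \<and> entails U L T (Imp \<psi> \<phi>)))"

definition eliminates_exists_infty ::
    "'u itself \<Rightarrow> ('f, 'r) language \<Rightarrow> ('f, 'r) fm set \<Rightarrow> bool" where
  "eliminates_exists_infty U L T \<longleftrightarrow>
     (\<forall>\<phi> x. wf_fm L \<phi> \<longrightarrow> (\<exists>\<psi>. wf_fm L \<psi> \<and> FV \<psi> \<subseteq> FV \<phi> - {x} \<and>
        (\<forall>(M :: ('f, 'r, 'u) fo_struct) e. models L T M \<and> range e \<subseteq> carrier M \<longrightarrow>
           (sat M e \<psi> \<longleftrightarrow> infinite {a \<in> carrier M. sat M (e(x := a)) \<phi>}))))"

definition acl_exchange ::
    "'u itself \<Rightarrow> ('f, 'r) language \<Rightarrow> ('f, 'r) fm set \<Rightarrow> bool" where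
  "acl_exchange U L T \<longleftrightarrow>
     (\<forall>(M :: ('f, 'r, 'u) fo_struct) X a b.
        models L T M \<and> X \<subseteq> carrier M \<and> a \<in> carrier M \<and> b \<in> carrier M \<and>
        a \<in> acl L M (insert b X) \<and> a \<notin> acl L M X \<longrightarrow> b \<in> acl L M (insert a X))"

definition geometric_theory ::
    "'u itself \<Rightarrow> ('f, 'r) language \<Rightarrow> ('f, 'r) fm set \<Rightarrow> bool" where
  "geometric_theory U L T \<longleftrightarrow> eliminates_exists_infty U L T \<and> acl_exchange U L T"

text \<open>
  The union is over a nonempty family: otherwise the empty set, which is algebraically closed
  whenever the closure of the empty set is empty, would be a counterexample as an empty union.
\<close>

definition indecomposable ::
    "'u itself \<Rightarrow> ('f, 'r) language \<Rightarrow> ('f, 'r) fm set \<Rightarrow> bool" where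
  "indecomposable U L T \<longleftrightarrow>
     (\<forall>(M :: ('f, 'r, 'u) fo_struct) X.
        models L T M \<and> X \<subseteq> carrier M \<and> acl L M X = X \<and> finite_dimensional (acl L M) X \<longrightarrow>
        \<not> (\<exists>F. finite F \<and> F \<noteq> {} \<and> X = \<Union>F \<and>
              (\<forall>Y\<in>F. pdim (acl L M) Y {} < pdim (acl L M) X {})))"

definition free_amalgamation ::
    "'u itself \<Rightarrow> ('f, 'r) language \<Rightarrow> ('f, 'r) fm set \<Rightarrow> bool" where
  "free_amalgamation U L T \<longleftrightarrow>
     (\<forall>(M0 :: ('f, 'r, 'u) fo_struct) (M1 :: ('f, 'r, 'u) fo_struct) (M2 :: ('f, 'r, 'u) fo_struct) f1 f2.
        models_univ L T M0 \<and> models_univ L T M1 \<and> models_univ L T M2 \<and>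
        embedding L M0 M1 f1 \<and> embedding L M0 M2 f2 \<and>
        acl_univ L T M1 (f1 ` carrier M0) = f1 ` carrier M0 \<and>
        acl_univ L T M2 (f2 ` carrier M0) = f2 ` carrier M0 \<longrightarrow>
        (\<exists>(M :: ('f, 'r, 'u) fo_struct) g1 g2.
           models L T M \<and> embedding L M1 M g1 \<and> embedding L M2 M g2 \<and>
           (\<forall>x\<in>carrier M0. g1 (f1 x) = g2 (f2 x)) \<and>
           free_over (acl L M) (g1 ` carrier M1) (g2 ` carrier M2) (g1 ` f1 ` carrier M0)))"


section \<open>Colored structures and predimension\<close>

text \<open>The relation symbol \<open>None\<close> is the color predicate \<open>p\<close>.\<close>

definition colored_language :: "('f, 'r) language \<Rightarrow> ('f, 'r option) language" where
  "colored_language L = \<lparr>Funs = Funs L, Rels = insert None (Some ` Rels L), farity = farity L,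
      rarity = (\<lambda>r. case r of None \<Rightarrow> 1 | Some s \<Rightarrow> rarity L s)\<rparr>"

definition reduct :: "('f, 'r option, 'u) fo_struct \<Rightarrow> ('f, 'r, 'u) fo_struct" where
  "reduct M = \<lparr>carrier = carrier M, fint = fint M, rint = (\<lambda>r. rint M (Some r))\<rparr>"

definition colored :: "('f, 'r option, 'u) fo_struct \<Rightarrow> 'u \<Rightarrow> bool" where
  "colored M x \<longleftrightarrow> rint M None [x]"

definition class_K ::
    "('f, 'r) language \<Rightarrow> ('f, 'r) fm set \<Rightarrow> ('f, 'r option, 'u) fo_struct \<Rightarrow> bool" where
  "class_K L T M \<longleftrightarrow> is_struct (colored_language L) M \<and> models_univ L T (reduct M)"

definition dimK ::
    "('f, 'r) language \<Rightarrow> ('f, 'r) fm set \<Rightarrow> ('f, 'r option, 'u) fo_struct \<Rightarrow>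
     'u set \<Rightarrow> 'u set \<Rightarrow> nat" where
  "dimK L T M A X = pdim (acl_univ L T (reduct M)) A X"

text \<open>\<open>predim_rel L T \<alpha> M A X\<close> is \<open>\<delta>(A/X)\<close>.\<close>

definition predim_rel ::
    "('f, 'r) language \<Rightarrow> ('f, 'r) fm set \<Rightarrow> real \<Rightarrow> ('f, 'r option, 'u) fo_struct \<Rightarrow>
     'u set \<Rightarrow> 'u set \<Rightarrow> real" where
  "predim_rel L T \<alpha> M A X =
     real (dimK L T M A X) - \<alpha> * real (card {x \<in> A - X. colored M x})"

definition predim ::
    "('f, 'r) language \<Rightarrow> ('f, 'r) fm set \<Rightarrow> real \<Rightarrow> ('f, 'r option, 'u) fo_struct \<Rightarrow>
     'u set \<Rightarrow> real" where
  "predim L T \<alpha> M A = predim_rel L T \<alpha> M A {}"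

definition class_K_plus ::
    "('f, 'r) language \<Rightarrow> ('f, 'r) fm set \<Rightarrow> real \<Rightarrow> ('f, 'r option, 'u) fo_struct \<Rightarrow> bool" where
  "class_K_plus L T \<alpha> M \<longleftrightarrow> class_K L T M \<and>
     (\<forall>A. finite A \<and> A \<subseteq> carrier M \<longrightarrow> predim L T \<alpha> M A \<ge> 0)"

definition closed_in ::
    "('f, 'r) language \<Rightarrow> ('f, 'r) fm set \<Rightarrow> real \<Rightarrow> ('f, 'r option, 'u) fo_struct \<Rightarrow>
     'u set \<Rightarrow> 'u set \<Rightarrow> bool" where
  "closed_in L T \<alpha> M X Y \<longleftrightarrow> X \<subseteq> Y \<and>
     (\<forall>A. finite A \<and> A \<subseteq> Y \<longrightarrow> predim_rel L T \<alpha> M A X \<ge> 0)"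

definition intrinsic ::
    "('f, 'r) language \<Rightarrow> ('f, 'r) fm set \<Rightarrow> real \<Rightarrow> ('f, 'r option, 'u) fo_struct \<Rightarrow>
     'u set \<Rightarrow> 'u set \<Rightarrow> bool" where
  "intrinsic L T \<alpha> M A B \<longleftrightarrow> finite B \<and> A \<subseteq> B \<and>
     (\<forall>A'. A \<subseteq> A' \<and> A' \<subset> B \<longrightarrow> predim L T \<alpha> M B < predim L T \<alpha> M A')"

definition n_closure ::
    "('f, 'r) language \<Rightarrow> ('f, 'r) fm set \<Rightarrow> real \<Rightarrow> ('f, 'r option, 'u) fo_struct \<Rightarrow>
     nat \<Rightarrow> 'u set \<Rightarrow> 'u set" where
  "n_closure L T \<alpha> M n A =
     \<Union>{B. B \<subseteq> carrier M \<and> intrinsic L T \<alpha> M A B \<and> card (B - A) < n}"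

definition weak_isomorphism ::
    "('f, 'r) language \<Rightarrow> ('f, 'r option, 'u) fo_struct \<Rightarrow> ('f, 'r option, 'u) fo_struct \<Rightarrow>
     'u set \<Rightarrow> 'u set \<Rightarrow> ('u \<Rightarrow> 'u) \<Rightarrow> bool" where
  "weak_isomorphism L M N X Y f \<longleftrightarrow>
     isomorphism L (generated L (reduct M) X) (generated L (reduct N) Y) f \<and>
     f ` X = Y \<and> (\<forall>x\<in>X. colored M x \<longleftrightarrow> colored N (f x))"


section \<open>The theory of rich colored structures\<close>

definition transcendental ::
    "('f, 'r) language \<Rightarrow> ('f, 'r) fm set \<Rightarrow> real \<Rightarrow> ('f, 'r option, 'u) fo_struct \<Rightarrow>
     'u list \<Rightarrow> 'u list \<Rightarrow> bool" where
  "transcendental L T \<alpha> M d a \<longleftrightarrow>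
     closed_in L T \<alpha> M (set a) (set a \<union> set d) \<and>
     (\<forall>x\<in>set d - set a. dimK L T M {x} (set a) = 1)"

text \<open>
  ``Sufficiently saturated'' is read as \<open>\<omega>\<^sub>1\<close>-saturated, and, \<open>T\<close> being complete, as ``in every
  such model''.  All conditions tested there concern realizations of types over finite sets in
  a countable language, so more saturation changes nothing.
\<close>

definition saturated_model ::
    "('f, 'r) language \<Rightarrow> ('f, 'r) fm set \<Rightarrow> ('f, 'r, 'u) fo_struct \<Rightarrow> bool" where
  "saturated_model L T N \<longleftrightarrow> models L T N \<and> aleph1_saturated L N"

text \<open>
  In \<open>strong_formula L T M d a \<phi>\<close>, a partition of the variable tuple \<open>x\<close> is given by the set
  \<open>I\<close> of the positions of its first part.
\<close>

definition strong_formula ::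
    "('f, 'r) language \<Rightarrow> ('f, 'r) fm set \<Rightarrow> ('f, 'r option, 'u) fo_struct \<Rightarrow>
     'u list \<Rightarrow> 'u list \<Rightarrow> ('f, 'r) fm \<Rightarrow> bool" where
  "strong_formula L T M d a \<phi> \<longleftrightarrow>
     distinct (d @ a) \<and>
     wf_fm L \<phi> \<and> qfree \<phi> \<and> FV \<phi> \<subseteq> {..<length d + length a} \<and> holds (reduct M) \<phi> (d @ a) \<and>
     (\<forall>(N :: ('f, 'r, 'u) fo_struct) d' a'.
        saturated_model L T N \<and> d' \<in> tuples N (length d) \<and> a' \<in> tuples N (length a) \<and>
        holds N \<phi> (d' @ a') \<longrightarrow>
          distinct (d' @ a') \<and>
          (pdim (acl L N) (set d') (set a') = dimK L T M (set d) (set a) \<longrightarrow>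
             (\<forall>I \<subseteq> {..<length d}.
                pdim (acl L N) ((!) d' ` ({..<length d} - I)) ((!) d' ` I \<union> set a')
                \<le> dimK L T M ((!) d ` ({..<length d} - I)) ((!) d ` I \<union> set a))))"

text \<open>
  \<open>defines_d TYPE('u) L T \<phi> n m k \<chi>\<close> and \<open>defines_D TYPE('u) L T \<phi> n m k \<chi>\<close> state that \<open>\<chi>\<close> can
  serve as \<open>d\<^bsub>\<phi>,k\<^esub>\<close> and \<open>D\<^bsub>\<phi>,k\<^esub>\<close>, where \<open>\<phi>\<close> is read as a formula in tuples of \<open>n\<close> and \<open>m\<close>
  variables.  The defining properties are those of saturated models; as \<open>T\<close> is complete they
  determine \<open>\<chi>\<close> up to equivalence modulo \<open>T\<close>, and \<open>\<chi>\<close> is then also used in other models.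
\<close>

definition defines_d ::
    "'u itself \<Rightarrow> ('f, 'r) language \<Rightarrow> ('f, 'r) fm set \<Rightarrow> ('f, 'r) fm \<Rightarrow>
     nat \<Rightarrow> nat \<Rightarrow> nat \<Rightarrow> ('f, 'r) fm \<Rightarrow> bool" where
  "defines_d U L T \<phi> n m k \<chi> \<longleftrightarrow> wf_fm L \<chi> \<and> FV \<chi> \<subseteq> {..<m} \<and>
     (\<forall>(N :: ('f, 'r, 'u) fo_struct). \<forall>b\<in>tuples N m. saturated_model L T N \<longrightarrow>
        (holds N \<chi> b \<longleftrightarrow>
          (\<exists>e\<in>tuples N n. holds N \<phi> (e @ b) \<and> pdim (acl L N) (set e) (set b) = k) \<and>
          (\<forall>e\<in>tuples N n. holds N \<phi> (e @ b) \<longrightarrow> pdim (acl L N) (set e) (set b) \<le> k)))"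

definition defines_D ::
    "'u itself \<Rightarrow> ('f, 'r) language \<Rightarrow> ('f, 'r) fm set \<Rightarrow> ('f, 'r) fm \<Rightarrow>
     nat \<Rightarrow> nat \<Rightarrow> nat \<Rightarrow> ('f, 'r) fm \<Rightarrow> bool" where
  "defines_D U L T \<phi> n m k \<chi> \<longleftrightarrow> wf_fm L \<chi> \<and> FV \<chi> \<subseteq> {..<m} \<and>
     (\<forall>(N :: ('f, 'r, 'u) fo_struct). \<forall>b\<in>tuples N m. saturated_model L T N \<longrightarrow>
        (holds N \<chi> b \<longleftrightarrow>
          (\<exists>e\<in>tuples N n. holds N \<phi> (e @ b) \<and> pdim (acl L N) (set e) (set b) \<ge> k \<and>
             (\<forall>x\<in>set e. x \<notin> acl L N (set b)))))"

definition models_T_alpha ::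
    "('f, 'r) language \<Rightarrow> ('f, 'r) fm set \<Rightarrow> real \<Rightarrow> ('f, 'r option, 'u) fo_struct \<Rightarrow> bool" where
  "models_T_alpha L T \<alpha> M \<longleftrightarrow>
     models L T (reduct M) \<and> class_K_plus L T \<alpha> M \<and>
     (\<forall>(M' :: ('f, 'r option, 'u) fo_struct) a d \<phi> k \<chi>D \<chi>d.
        class_K_plus L T \<alpha> M' \<and> set a \<subseteq> carrier M' \<and> set d \<subseteq> carrier M' \<and>
        closed_in L T \<alpha> M' (set a) (set a \<union> set d) \<and> transcendental L T \<alpha> M' d a \<and>
        dimK L T M' (set d) (set a) = k \<and> strong_formula L T M' d a \<phi> \<and>
        defines_D TYPE('u) L T \<phi> (length d) (length a) k \<chi>D \<and>
        defines_d TYPE('u) L T \<phi> (length d) (length a) k \<chi>d \<longrightarrow>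
        (\<forall>b\<in>tuples M (length a).
           holds (reduct M) \<chi>D b \<and> holds (reduct M) \<chi>d b \<longrightarrow>
           (\<exists>z\<in>tuples M (length d). holds (reduct M) \<phi> (z @ b) \<and>
              (\<forall>i<length d. colored M (z ! i) \<longleftrightarrow> colored M' (d ! i)))))"

end

theory Submission
  imports Defs
begin

text \<open>
  The proof is a finitary back-and-forth between \<open>n\<close>-closures, by induction on \<open>\<phi>\<close>; the case of
  atomic \<open>\<phi>\<close> is quantifier elimination for \<open>T\<close>.  For a quantifier, let \<open>f\<close> be a colored elementary
  map on the \<open>k\<close>-closure of \<open>A\<close>, with \<open>k\<close> large, and let \<open>c\<close> be a new element.  Boundedly many steps
  lead from \<open>A\<close> to a finite \<open>X\<close> in the \<open>k\<close>-closure over which no set of fewer than \<open>r\<close> elements has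
  negative predimension, and from \<open>A, c\<close> to a finite \<open>W\<close> with the same property for \<open>n\<close>.  Let \<open>P\<close> be
  \<open>X\<close> together with the elements of \<open>W\<close> outside the closure of \<open>X\<close>.  By indecomposability there is a
  finite set \<open>E\<close> in general position over \<open>P\<close>.  Coloring all of \<open>E\<close> gives, as \<open>\<alpha>\<close> is irrational, a
  structure in which \<open>X\<close> is closed in \<open>P \<union> E\<close> but \<open>\<delta>(PE/X)\<close> is smaller than any negative value of
  \<open>\<delta>\<close> on fewer than \<open>n\<close> elements is in absolute value.  The axioms of \<open>T\<^sub>\<alpha>\<close> and saturation give a copy
  of \<open>P \<union> E\<close> over \<open>f X\<close> in the other model; a set of fewer than \<open>n\<close> elements with negative
  predimension over the copy of \<open>X \<union> W\<close> would, together with the copy of \<open>E\<close>, have negative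
  predimension over \<open>f X\<close>.
\<close>


section \<open>Formulas\<close>

text \<open>An axiom of \<open>models_T_alpha\<close> supplies a tuple with a prescribed formula and
  prescribed colors, but says nothing about what lies around that tuple; the copy of
  \<open>X \<union> W\<close> might acquire small extensions of negative predimension that the
  original does not have. The set \<open>E\<close> excludes them by using up the slack: once it is
  added, the predimension over \<open>X\<close> is so close to 0 that no further loss by a fixed
  amount is possible. For this, \<open>E\<close> must be large while its rank stays bounded, and
  still any few of its points must be independent over the rest, so that an overlap with a bad set
  does not help that set. Elements algebraic over \<open>X\<close> are outside the scope of the
  axioms, which concern transcendental tuples; over a sufficiently closed \<open>X\<close> they are
  forced to be uncolored and are carried along by elementarity. All sizes have to be fixed before
  the models and the map are known. This is possible because changes of the predimension caused by
  boundedly many points take finitely many values, so that the losses are bounded away from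
  0.\<close>

lemma eval_cong: "(\<And>v. v \<in> tvars t \<Longrightarrow> e v = e' v) \<Longrightarrow> eval M e t = eval M e' t"
proof (induction t)
  case (App f ts)
  have "eval M e t = eval M e' t" if "t \<in> set ts" for t
  proof (rule App.IH[OF that])
    show "e v = e' v" if "v \<in> tvars t" for v
      by (rule App.prems) (use that \<open>t \<in> set ts\<close> in auto)
  qed
  then have "map (eval M e) ts = map (eval M e') ts" by (rule map_cong[OF refl])
  then show ?case by (simp only: eval.simps)
qed simp

lemma sat_cong: "(\<And>v. v \<in> FV \<phi> \<Longrightarrow> e v = e' v) \<Longrightarrow> sat M e \<phi> \<longleftrightarrow> sat M e' \<phi>"
proof (induction \<phi> arbitrary: e e')
  case (Eq s t)
  have "eval M e s = eval M e' s" "eval M e t = eval M e' t"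
    by (rule eval_cong, rule Eq.prems, simp)+
  then show ?case by (simp only: sat.simps)
next
  case (Rel r ts)
  have "eval M e t = eval M e' t" if "t \<in> set ts" for t
    by (rule eval_cong, rule Rel.prems) (use that in auto)
  then have "map (eval M e) ts = map (eval M e') ts" by (rule map_cong[OF refl])
  then show ?case by (simp only: sat.simps)
next
  case (Imp \<phi> \<psi>)
  have "sat M e \<phi> \<longleftrightarrow> sat M e' \<phi>"
    by (rule Imp.IH(1), rule Imp.prems) simp
  moreover have "sat M e \<psi> \<longleftrightarrow> sat M e' \<psi>"
    by (rule Imp.IH(2), rule Imp.prems) simp
  ultimately show ?case by (simp only: sat.simps)
next
  case (All x \<phi>)
  have "sat M (e(x := a)) \<phi> \<longleftrightarrow> sat M (e'(x := a)) \<phi>" for a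
  proof (rule All.IH)
    show "(e(x := a)) v = (e'(x := a)) v" if "v \<in> FV \<phi>" for v
      using All.prems[of v] that by (cases "v = x") simp_all
  qed
  then show ?case by (simp only: sat.simps)
qed simp

lemma finite_tvars [simp]: "finite (tvars t)"
  by (induction t) auto

lemma finite_FV [simp]: "finite (FV \<phi>)"
  by (induction \<phi>) auto

fun rename_tm :: "(nat \<Rightarrow> nat) \<Rightarrow> 'f tm \<Rightarrow> 'f tm" where
  "rename_tm \<rho> (Var x) = Var (\<rho> x)"
| "rename_tm \<rho> (App f ts) = App f (map (rename_tm \<rho>) ts)"

lemma eval_rename_tm: "eval M e (rename_tm \<rho> t) = eval M (e \<circ> \<rho>) t"
proof (induction t)
  case (App f ts)
  have "map (eval M e) (map (rename_tm \<rho>) ts) = map (eval M (e \<circ> \<rho>)) ts"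
    unfolding map_map map_eq_conv comp_apply[of "eval M e"] using App.IH by blast
  then show ?case by (simp only: rename_tm.simps eval.simps)
qed simp

lemma tvars_rename_tm: "tvars (rename_tm \<rho> t) = \<rho> ` tvars t"
  by (induction t) auto

lemma wf_rename_tm: "wf_tm L t \<Longrightarrow> wf_tm L (rename_tm \<rho> t)"
  by (induction t) auto

text \<open>The renaming \<open>\<rho>\<close> is arbitrary and may identify variables, so replacing
  all occurrences could capture. Only existence is claimed: in the quantifier case the bound
  variable moves to a \<open>y\<close> outside the renamed free variables, and the induction
  hypothesis is used at \<open>\<rho>(x := y)\<close>.\<close>

lemma rename_fm_exists:
  "wf_fm L \<phi> \<Longrightarrow> \<exists>\<psi>. wf_fm L \<psi> \<and> FV \<psi> \<subseteq> \<rho> ` FV \<phi> \<and>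
     (\<forall>(M :: ('f, 'r, 'u) fo_struct) e. sat M e \<psi> \<longleftrightarrow> sat M (e \<circ> \<rho>) \<phi>)"
proof (induction \<phi> arbitrary: \<rho>)
  case Fls
  then show ?case by (intro exI[of _ Fls]) simp
next
  case (Eq s t)
  then show ?case
    by (intro exI[of _ "Eq (rename_tm \<rho> s) (rename_tm \<rho> t)"])
      (auto simp: eval_rename_tm tvars_rename_tm wf_rename_tm simp del: comp_apply)
next
  case (Rel r ts)
  have eq: "map (eval M e) (map (rename_tm \<rho>) ts) = map (eval M (e \<circ> \<rho>)) ts"
    for e and M :: "('f, 'r, 'u) fo_struct"
    by (simp add: eval_rename_tm)
  have "wf_fm L (Rel r (map (rename_tm \<rho>) ts))"
    using Rel by (auto intro: wf_rename_tm)
  moreover have "FV (Rel r (map (rename_tm \<rho>) ts)) \<subseteq> \<rho> ` FV (Rel r ts)"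
    by (auto simp: tvars_rename_tm)
  ultimately show ?case
    by (intro exI[of _ "Rel r (map (rename_tm \<rho>) ts)"]) (simp only: sat.simps eq, simp)
next
  case (Imp \<phi>1 \<phi>2)
  obtain \<psi>1 where 1: "wf_fm L \<psi>1" "FV \<psi>1 \<subseteq> \<rho> ` FV \<phi>1"
    "\<forall>(M :: ('f, 'r, 'u) fo_struct) e. sat M e \<psi>1 \<longleftrightarrow> sat M (e \<circ> \<rho>) \<phi>1"
    using Imp.IH(1)[of \<rho>] Imp.prems by (auto simp del: comp_apply)
  obtain \<psi>2 where 2: "wf_fm L \<psi>2" "FV \<psi>2 \<subseteq> \<rho> ` FV \<phi>2"
    "\<forall>(M :: ('f, 'r, 'u) fo_struct) e. sat M e \<psi>2 \<longleftrightarrow> sat M (e \<circ> \<rho>) \<phi>2"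
    using Imp.IH(2)[of \<rho>] Imp.prems by (auto simp del: comp_apply)
  show ?case
    by (intro exI[of _ "Imp \<psi>1 \<psi>2"]) (use 1 2 in \<open>auto simp del: comp_apply\<close>)
next
  case (All x \<phi>)
  have "finite (\<rho> ` (FV \<phi> - {x}))" by simp
  then obtain y where y: "y \<notin> \<rho> ` (FV \<phi> - {x})"
    using ex_new_if_finite infinite_UNIV_nat by blast
  obtain \<psi> where \<psi>: "wf_fm L \<psi>" "FV \<psi> \<subseteq> \<rho>(x := y) ` FV \<phi>"
    "\<forall>(M :: ('f, 'r, 'u) fo_struct) e. sat M e \<psi> \<longleftrightarrow> sat M (e \<circ> \<rho>(x := y)) \<phi>"
    using All.IH[of "\<rho>(x := y)"] All.prems unfolding wf_fm.simps by blast
  have "sat M (e(y := a)) \<psi> \<longleftrightarrow> sat M ((e \<circ> \<rho>)(x := a)) \<phi>"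
    for e a and M :: "('f, 'r, 'u) fo_struct"
    unfolding \<psi>(3)[rule_format] by (rule sat_cong) (use y in auto)
  then show ?case
    by (intro exI[of _ "All y \<psi>"]) (use \<psi>(1,2) All.prems in \<open>auto simp del: comp_apply\<close>)
qed

definition And :: "('f, 'r) fm \<Rightarrow> ('f, 'r) fm \<Rightarrow> ('f, 'r) fm" where
  "And \<phi> \<psi> = Neg (Imp \<phi> (Neg \<psi>))"

definition Exi :: "nat \<Rightarrow> ('f, 'r) fm \<Rightarrow> ('f, 'r) fm" where
  "Exi x \<phi> = Neg (All x (Neg \<phi>))"

definition Conj :: "('f, 'r) fm list \<Rightarrow> ('f, 'r) fm" where
  "Conj \<phi>s = foldr And \<phi>s (Neg Fls)"

definition Exs :: "nat list \<Rightarrow> ('f, 'r) fm \<Rightarrow> ('f, 'r) fm" where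
  "Exs xs \<phi> = foldr Exi xs \<phi>"

lemma And_simps [simp]:
  "sat M e (And \<phi> \<psi>) \<longleftrightarrow> sat M e \<phi> \<and> sat M e \<psi>"
  "FV (And \<phi> \<psi>) = FV \<phi> \<union> FV \<psi>"
  "wf_fm L (And \<phi> \<psi>) \<longleftrightarrow> wf_fm L \<phi> \<and> wf_fm L \<psi>"
  by (auto simp: And_def)

lemma Exi_simps [simp]:
  "sat M e (Exi x \<phi>) \<longleftrightarrow> (\<exists>a\<in>carrier M. sat M (e(x := a)) \<phi>)"
  "FV (Exi x \<phi>) = FV \<phi> - {x}"
  "wf_fm L (Exi x \<phi>) \<longleftrightarrow> wf_fm L \<phi>"
  by (auto simp: Exi_def)

lemma Conj_simps [simp]:
  "sat M e (Conj \<phi>s) \<longleftrightarrow> (\<forall>\<phi>\<in>set \<phi>s. sat M e \<phi>)"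
  "FV (Conj \<phi>s) = (\<Union>\<phi>\<in>set \<phi>s. FV \<phi>)"
  "wf_fm L (Conj \<phi>s) \<longleftrightarrow> (\<forall>\<phi>\<in>set \<phi>s. wf_fm L \<phi>)"
  by (induction \<phi>s) (auto simp: Conj_def)

lemma Exs_simps [simp]:
  "FV (Exs xs \<phi>) = FV \<phi> - set xs"
  "wf_fm L (Exs xs \<phi>) \<longleftrightarrow> wf_fm L \<phi>"
  by (induction xs) (auto simp: Exs_def)

lemma sat_Exs:
  "sat M e (Exs xs \<phi>) \<longleftrightarrow>
     (\<exists>e'. (\<forall>i. i \<notin> set xs \<longrightarrow> e' i = e i) \<and> e' ` set xs \<subseteq> carrier M \<and> sat M e' \<phi>)"
proof (induction xs arbitrary: e)
  case Nil
  have "(\<forall>i. e' i = e i) \<longleftrightarrow> e' = e" for e' by auto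
  then show ?case by (simp add: Exs_def)
next
  case (Cons x xs)
  have "sat M e (Exs (x # xs) \<phi>) \<longleftrightarrow> (\<exists>a\<in>carrier M. sat M (e(x := a)) (Exs xs \<phi>))"
    by (simp add: Exs_def)
  also have "\<dots> \<longleftrightarrow> (\<exists>e'. (\<forall>i. i \<notin> set (x # xs) \<longrightarrow> e' i = e i) \<and>
      e' ` set (x # xs) \<subseteq> carrier M \<and> sat M e' \<phi>)" (is "?l \<longleftrightarrow> ?r")
  proof
    assume ?l
    then obtain a e' where a: "a \<in> carrier M" "\<forall>i. i \<notin> set xs \<longrightarrow> e' i = (e(x := a)) i"
      "e' ` set xs \<subseteq> carrier M" "sat M e' \<phi>"
      unfolding Cons.IH by blast
    \<comment> \<open>\<open>x\<close> may occur again in \<open>xs\<close>, in which case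
      \<open>e' x\<close> need not be \<open>a\<close>.\<close>
    have "e' x \<in> carrier M" using a by (cases "x \<in> set xs") auto
    then show ?r using a by (intro exI[of _ e']) auto
  next
    assume ?r
    then obtain e' where e': "\<forall>i. i \<notin> set (x # xs) \<longrightarrow> e' i = e i"
      "e' ` set (x # xs) \<subseteq> carrier M" "sat M e' \<phi>" by blast
    then show ?l
      unfolding Cons.IH by (intro bexI[of _ "e' x"] exI[of _ e']) auto
  qed
  finally show ?case .
qed

section \<open>Formulas of the base language read in the colored language\<close>

abbreviation lift_fm :: "('f, 'r) fm \<Rightarrow> ('f, 'r option) fm" where
  "lift_fm \<equiv> map_fm id Some"

lemma carrier_reduct [simp]: "carrier (reduct M) = carrier M"
  by (simp add: reduct_def)

lemma eval_reduct: "eval (reduct M) e t = eval M e t"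
proof (induction t)
  case (App f ts)
  then have "map (eval (reduct M) e) ts = map (eval M e) ts" by auto
  then show ?case by (simp only: eval.simps) (simp add: reduct_def)
qed simp

lemma rint_reduct: "rint (reduct M) r xs = rint M (Some r) xs"
  by (simp add: reduct_def)

lemma sat_lift_fm: "sat M e (lift_fm \<phi>) \<longleftrightarrow> sat (reduct M) e \<phi>"
proof (induction \<phi> arbitrary: e)
  case (Rel r ts)
  have "map (eval M e) (map (map_tm id) ts) = map (eval (reduct M) e) ts"
    unfolding map_map map_eq_conv comp_apply[of "eval M e"] by (simp add: tm.map_id eval_reduct)
  then show ?case by (simp only: fm.map sat.simps rint_reduct)
next
  case (All x \<phi>)
  then show ?case by (simp only: fm.map sat.simps id_apply carrier_reduct)
qed (simp_all only: fm.map sat.simps tm.map_id eval_reduct)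

lemma FV_lift_fm: "FV (lift_fm \<phi>) = FV \<phi>"
proof (induction \<phi>)
  case (Rel r ts)
  show ?case by (simp add: tm.map_id tm.map_id0 tm.map_ident)
qed (simp_all add: tm.map_id tm.map_ident)

lemma wf_lift_fm: "wf_fm (colored_language L) (lift_fm \<phi>) \<longleftrightarrow> wf_fm L \<phi>"
proof -
  have t: "wf_tm (colored_language L) t = wf_tm L t" for t
  proof (induction t)
    case (App f ts)
    moreover have "f \<in> Funs (colored_language L) \<longleftrightarrow> f \<in> Funs L"
      "farity (colored_language L) f = farity L f"
      by (simp_all add: colored_language_def)
    ultimately show ?case by (simp only: wf_tm.simps cong: ball_cong)
  qed simp
  have r: "Some r \<in> Rels (colored_language L) \<longleftrightarrow> r \<in> Rels L"
    "rarity (colored_language L) (Some r) = rarity L r" for r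
    by (auto simp: colored_language_def)
  show ?thesis
  proof (induction \<phi>)
    case (Rel r ts)
    show ?case
      by (simp only: fm.map wf_fm.simps r t length_map set_map ball_simps tm.map_id)
  qed (simp_all only: fm.map wf_fm.simps t tm.map_id)
qed

lemma finite_conj_closed:
  assumes "finite Q" "Q \<subseteq> {\<phi>. wf_fm L \<phi> \<and> FV \<phi> \<subseteq> V}"
  obtains \<psi> where "wf_fm L \<psi>" "FV \<psi> \<subseteq> V"
    "\<And>(M :: ('f, 'r, 'u) fo_struct) e. sat M e \<psi> \<longleftrightarrow> (\<forall>\<phi>\<in>Q. sat M e \<phi>)"
proof -
  obtain qs where "set qs = Q" using finite_list[OF assms(1)] by blast
  then show ?thesis using assms by (intro that[of "Conj qs"]) auto
qed

section \<open>Elementary maps and algebraic closure\<close>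

text \<open>Partial elementary maps. The domain need not be a substructure, and an assignment has to
  take values in \<open>Z\<close> only at the free variables, so n-closures can serve as
  domains.\<close>

definition elementary_on ::
    "('f, 'r) language \<Rightarrow> ('f, 'r, 'u) fo_struct \<Rightarrow> ('f, 'r, 'u) fo_struct \<Rightarrow> 'u set \<Rightarrow>
     ('u \<Rightarrow> 'u) \<Rightarrow> bool" where
  "elementary_on L M N Z f \<longleftrightarrow> Z \<subseteq> carrier M \<and> f ` Z \<subseteq> carrier N \<and>
     (\<forall>\<psi> e. wf_fm L \<psi> \<and> e ` FV \<psi> \<subseteq> Z \<longrightarrow> (sat M e \<psi> \<longleftrightarrow> sat N (f \<circ> e) \<psi>))"

lemma elementary_onD:
  "elementary_on L M N Z f \<Longrightarrow> wf_fm L \<psi> \<Longrightarrow> e ` FV \<psi> \<subseteq> Z \<Longrightarrow> sat M e \<psi> \<longleftrightarrow> sat N (f \<circ> e) \<psi>"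
  by (simp add: elementary_on_def)

lemma elementary_on_carrier:
  "elementary_on L M N Z f \<Longrightarrow> Z \<subseteq> carrier M" "elementary_on L M N Z f \<Longrightarrow> f ` Z \<subseteq> carrier N"
  by (simp_all add: elementary_on_def)

lemma elementary_on_subset:
  "elementary_on L M N Z f \<Longrightarrow> Z' \<subseteq> Z \<Longrightarrow> elementary_on L M N Z' f"
  unfolding elementary_on_def by (meson image_mono subset_trans)

lemma elementary_on_inj:
  assumes "elementary_on L M N Z f"
  shows "inj_on f Z"
proof (rule inj_onI)
  fix x y assume xy: "x \<in> Z" "y \<in> Z" "f x = f y"
  define e where "e = (\<lambda>i::nat. if i = 0 then x else y)"
  have "sat M e (Eq (Var 0) (Var 1)) \<longleftrightarrow> sat N (f \<circ> e) (Eq (Var 0) (Var 1))"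
    by (rule elementary_onD[OF assms]) (use xy in \<open>auto simp: e_def\<close>)
  then show "x = y" using xy by (simp add: e_def)
qed

lemma elementary_on_inv:
  assumes "elementary_on L M N Z f"
  shows "elementary_on L N M (f ` Z) (inv_into Z f)"
  unfolding elementary_on_def
proof (intro conjI allI impI)
  show "f ` Z \<subseteq> carrier N" using assms by (simp add: elementary_on_def)
  show "inv_into Z f ` f ` Z \<subseteq> carrier M"
    using assms elementary_on_inj[OF assms] by (auto simp: elementary_on_def)
  fix \<psi> e assume \<psi>: "wf_fm L \<psi> \<and> e ` FV \<psi> \<subseteq> f ` Z"
  have "sat M (inv_into Z f \<circ> e) \<psi> \<longleftrightarrow> sat N (f \<circ> (inv_into Z f \<circ> e)) \<psi>"
    by (rule elementary_onD[OF assms])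
      (use \<psi> elementary_on_inj[OF assms] in \<open>auto simp: inv_into_into image_subset_iff\<close>)
  also have "\<dots> \<longleftrightarrow> sat N e \<psi>"
    by (rule sat_cong) (use \<psi> in \<open>auto simp: f_inv_into_f\<close>)
  finally show "sat N e \<psi> \<longleftrightarrow> sat M (inv_into Z f \<circ> e) \<psi>" by simp
qed

text \<open>Closure under the functions is assumed directly instead of \<open>is_struct L M\<close>,
  because the carrier will be a generated set, which may be empty.\<close>

lemma embedding_eval:
  assumes emb: "embedding L M N g"
    and cl: "\<And>f xs. f \<in> Funs L \<Longrightarrow> xs \<in> tuples M (farity L f) \<Longrightarrow> fint M f xs \<in> carrier M"
  shows "wf_tm L t \<Longrightarrow> e ` tvars t \<subseteq> carrier M \<Longrightarrow>
    eval M e t \<in> carrier M \<and> g (eval M e t) = eval N (g \<circ> e) t"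
proof (induction t)
  case (App f ts)
  have t: "eval M e t \<in> carrier M \<and> g (eval M e t) = eval N (g \<circ> e) t" if "t \<in> set ts" for t
    by (rule App.IH[OF that]) (use App.prems that in auto)
  then have tup: "map (eval M e) ts \<in> tuples M (farity L f)"
    using App.prems by (auto simp: tuples_def)
  have "map g (map (eval M e) ts) = map (eval N (g \<circ> e)) ts"
    unfolding map_map by (rule map_cong[OF refl]) (simp only: comp_apply[of g] t)
  moreover have "g (fint M f (map (eval M e) ts)) = fint N f (map g (map (eval M e) ts))"
    using emb tup App.prems unfolding embedding_def by auto
  moreover have "f \<in> Funs L" using App.prems by simp
  ultimately show ?case using cl[OF _ tup] by (simp only: eval.simps)
qed auto

lemma embedding_qfree:
  assumes emb: "embedding L M N g"
    and cl: "\<And>f xs. f \<in> Funs L \<Longrightarrow> xs \<in> tuples M (farity L f) \<Longrightarrow> fint M f xs \<in> carrier M"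
  shows "wf_fm L \<psi> \<Longrightarrow> qfree \<psi> \<Longrightarrow> e ` FV \<psi> \<subseteq> carrier M \<Longrightarrow> sat M e \<psi> \<longleftrightarrow> sat N (g \<circ> e) \<psi>"
proof (induction \<psi>)
  case (Eq s t)
  have s: "eval M e s \<in> carrier M" "g (eval M e s) = eval N (g \<circ> e) s"
    using embedding_eval[OF emb cl, of s e] Eq.prems by auto
  have t: "eval M e t \<in> carrier M" "g (eval M e t) = eval N (g \<circ> e) t"
    using embedding_eval[OF emb cl, of t e] Eq.prems by auto
  have "inj_on g (carrier M)" using emb by (simp add: embedding_def)
  then show ?case unfolding sat.simps s(2)[symmetric] t(2)[symmetric]
    using s(1) t(1) by (auto dest: inj_onD)
next
  case (Rel r ts)
  have t: "eval M e t \<in> carrier M" "g (eval M e t) = eval N (g \<circ> e) t" if "t \<in> set ts" for t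
    using embedding_eval[OF emb cl, of t e] Rel.prems that by auto
  then have tup: "map (eval M e) ts \<in> tuples M (rarity L r)"
    using Rel.prems by (auto simp: tuples_def)
  have "map g (map (eval M e) ts) = map (eval N (g \<circ> e)) ts"
    unfolding map_map by (rule map_cong[OF refl]) (simp only: comp_apply[of g] t)
  moreover have "rint M r (map (eval M e) ts) \<longleftrightarrow> rint N r (map g (map (eval M e) ts))"
    using emb tup Rel.prems unfolding embedding_def by auto
  ultimately show ?case by (simp only: sat.simps)
qed auto

locale geometric_base =
  fixes L :: "('f, 'r) language" and T :: "('f, 'r) fm set" and U :: "'u itself"
  assumes qe: "quantifier_elimination TYPE('u) L T"
    and no_finite: "no_finite_models TYPE('u) L T"
    and geometric: "geometric_theory TYPE('u) L T"
    and indecomp: "indecomposable TYPE('u) L T"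
begin

text \<open>The hypothesis on quantifier elimination speaks of assignments with all values in the
  carrier. Truth depends on the free variables only, so the other values can be replaced by a fixed
  element \<open>c\<close>. \<open>exists_infty\<close> is the same adjustment for the elimination
  of infinity.\<close>

lemma qe_sat:
  assumes "wf_fm L \<psi>"
  obtains \<psi>' where "wf_fm L \<psi>'" "qfree \<psi>'" "FV \<psi>' \<subseteq> FV \<psi>"
    "\<And>(M :: ('f, 'r, 'u) fo_struct) e. models L T M \<Longrightarrow> e ` FV \<psi> \<subseteq> carrier M \<Longrightarrow>
       sat M e \<psi>' \<longleftrightarrow> sat M e \<psi>"
proof -
  obtain \<psi>' where \<psi>': "wf_fm L \<psi>'" "qfree \<psi>'" "FV \<psi>' \<subseteq> FV \<psi>"
    "entails TYPE('u) L T (Imp \<psi> \<psi>')" "entails TYPE('u) L T (Imp \<psi>' \<psi>)"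
    using qe assms unfolding quantifier_elimination_def by blast
  show ?thesis
  proof (rule that[OF \<psi>'(1-3)])
    fix M :: "('f, 'r, 'u) fo_struct" and e
    assume M: "models L T M" and e: "e ` FV \<psi> \<subseteq> carrier M"
    obtain c where c: "c \<in> carrier M" using M by (auto simp: models_def is_struct_def)
    define e' where "e' = (\<lambda>v. if v \<in> FV \<psi> then e v else c)"
    have "range e' \<subseteq> carrier M" using e c by (auto simp: e'_def)
    then have "sat M e' \<psi>' \<longleftrightarrow> sat M e' \<psi>"
      using \<psi>'(4,5) M unfolding entails_def valid_in_def by auto
    moreover have "sat M e' \<psi> \<longleftrightarrow> sat M e \<psi>" by (rule sat_cong) (simp add: e'_def)
    moreover have "sat M e' \<psi>' \<longleftrightarrow> sat M e \<psi>'"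
      by (rule sat_cong) (use \<psi>'(3) in \<open>auto simp: e'_def\<close>)
    ultimately show "sat M e \<psi>' \<longleftrightarrow> sat M e \<psi>" by simp
  qed
qed

lemma exists_infty:
  assumes "wf_fm L \<phi>"
  obtains \<xi> where "wf_fm L \<xi>" "FV \<xi> \<subseteq> FV \<phi> - {x}"
    "\<And>(M :: ('f, 'r, 'u) fo_struct) e. models L T M \<Longrightarrow> e ` (FV \<phi> - {x}) \<subseteq> carrier M \<Longrightarrow>
       sat M e \<xi> \<longleftrightarrow> infinite {a \<in> carrier M. sat M (e(x := a)) \<phi>}"
proof -
  obtain \<xi> where \<xi>: "wf_fm L \<xi>" "FV \<xi> \<subseteq> FV \<phi> - {x}"
    "\<forall>(M :: ('f, 'r, 'u) fo_struct) e. models L T M \<and> range e \<subseteq> carrier M \<longrightarrow>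
       (sat M e \<xi> \<longleftrightarrow> infinite {a \<in> carrier M. sat M (e(x := a)) \<phi>})"
    using geometric assms unfolding geometric_theory_def eliminates_exists_infty_def by blast
  show ?thesis
  proof (rule that[OF \<xi>(1,2)])
    fix M :: "('f, 'r, 'u) fo_struct" and e
    assume M: "models L T M" and e: "e ` (FV \<phi> - {x}) \<subseteq> carrier M"
    obtain c where c: "c \<in> carrier M" using M by (auto simp: models_def is_struct_def)
    define e' where "e' = (\<lambda>v. if v \<in> FV \<phi> - {x} then e v else c)"
    have "range e' \<subseteq> carrier M" using e c by (auto simp: e'_def)
    then have "sat M e' \<xi> \<longleftrightarrow> infinite {a \<in> carrier M. sat M (e'(x := a)) \<phi>}"
      using \<xi>(3) M by blast
    moreover have "sat M (e'(x := a)) \<phi> \<longleftrightarrow> sat M (e(x := a)) \<phi>" for a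
      by (rule sat_cong) (simp add: e'_def)
    moreover have "sat M e' \<xi> \<longleftrightarrow> sat M e \<xi>"
      by (rule sat_cong) (use \<xi>(2) in \<open>auto simp: e'_def\<close>)
    ultimately show "sat M e \<xi> \<longleftrightarrow> infinite {a \<in> carrier M. sat M (e(x := a)) \<phi>}" by simp
  qed
qed

text \<open>Every formula is equivalent, in \<open>M\<close> and in \<open>N\<close>, to the same
  quantifier-free one. The truth value of the latter does not change on passing to a subset closed
  under the functions, and embeddings preserve it.\<close>

lemma elementary_on_embedding:
  fixes M N :: "('f, 'r, 'u) fo_struct"
  assumes M: "models L T M" and N: "models L T N"
    and S: "S \<subseteq> carrier M" "S' \<subseteq> carrier N"
    and cl: "\<And>f xs. f \<in> Funs L \<Longrightarrow> set xs \<subseteq> S \<Longrightarrow> length xs = farity L f \<Longrightarrow> fint M f xs \<in> S"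
    and emb: "embedding L (M\<lparr>carrier := S\<rparr>) (N\<lparr>carrier := S'\<rparr>) g"
  shows "elementary_on L M N S g"
  unfolding elementary_on_def
proof (intro conjI allI impI)
  show "S \<subseteq> carrier M" by fact
  show gS: "g ` S \<subseteq> carrier N" using emb S by (auto simp: embedding_def)
  have ev: "eval (M\<lparr>carrier := S\<rparr>) e t = eval M e t" for M :: "('f, 'r, 'u) fo_struct" and S e t
  proof (induction t)
    case (App f ts)
    then have "map (eval (M\<lparr>carrier := S\<rparr>) e) ts = map (eval M e) ts" by auto
    then show ?case by (simp only: eval.simps) simp
  qed simp
  have qf: "qfree \<psi> \<Longrightarrow> sat (M\<lparr>carrier := S\<rparr>) e \<psi> \<longleftrightarrow> sat M e \<psi>"
    for M :: "('f, 'r, 'u) fo_struct" and S e \<psi>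
  proof (induction \<psi>)
    case (Rel r ts)
    have "map (eval (M\<lparr>carrier := S\<rparr>) e) ts = map (eval M e) ts" by (auto simp: ev)
    then show ?case by (simp only: sat.simps) simp
  qed (auto simp: ev)
  fix \<psi> e assume \<psi>: "wf_fm L \<psi> \<and> e ` FV \<psi> \<subseteq> S"
  obtain \<psi>' where \<psi>': "wf_fm L \<psi>'" "qfree \<psi>'" "FV \<psi>' \<subseteq> FV \<psi>"
    "\<And>(M :: ('f, 'r, 'u) fo_struct) e. models L T M \<Longrightarrow> e ` FV \<psi> \<subseteq> carrier M \<Longrightarrow>
       sat M e \<psi>' \<longleftrightarrow> sat M e \<psi>"
    using qe_sat \<psi> by blast
  have "sat M e \<psi> \<longleftrightarrow> sat M e \<psi>'" using \<psi>'(4)[OF M, of e] \<psi> S by auto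
  also have "\<dots> \<longleftrightarrow> sat (M\<lparr>carrier := S\<rparr>) e \<psi>'" using qf \<psi>' by simp
  also have "\<dots> \<longleftrightarrow> sat (N\<lparr>carrier := S'\<rparr>) (g \<circ> e) \<psi>'"
  proof (rule embedding_qfree[OF emb _ \<psi>'(1,2)])
    show "e ` FV \<psi>' \<subseteq> carrier (M\<lparr>carrier := S\<rparr>)" using \<psi> \<psi>'(3) by auto
  qed (auto simp: tuples_def intro!: cl)
  also have "\<dots> \<longleftrightarrow> sat N (g \<circ> e) \<psi>'" using qf \<psi>' by simp
  also have "\<dots> \<longleftrightarrow> sat N (g \<circ> e) \<psi>" by (rule \<psi>'(4)[OF N]) (use \<psi> gS in auto)
  finally show "sat M e \<psi> \<longleftrightarrow> sat N (g \<circ> e) \<psi>" .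
qed

text \<open>Converts the hypothesis of the theorem: the isomorphism is elementary on the generated
  structures by quantifier elimination, hence on the generating sets.\<close>

lemma elementary_on_weak_iso:
  fixes M N :: "('f, 'r, 'u) fo_struct"
  assumes M: "models L T M" and N: "models L T N" and XY: "X \<subseteq> carrier M" "Y \<subseteq> carrier N"
    and iso: "isomorphism L (generated L M X) (generated L N Y) g"
  shows "elementary_on L M N X g"
proof -
  have sub: "gen_set L M X \<subseteq> carrier M"
    if "models L T M" "X \<subseteq> carrier M" for X and M :: "('f, 'r, 'u) fo_struct"
  proof
    fix x assume "x \<in> gen_set L M X"
    then show "x \<in> carrier M"
    proof induction
      case (step f xs)
      then have "set xs \<subseteq> carrier M" by auto
      then show ?case using step that(1) by (simp add: models_def is_struct_def)
    qed (use that in auto)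
  qed
  have "elementary_on L M N (gen_set L M X) g"
  proof (rule elementary_on_embedding[OF M N sub[OF M XY(1)] sub[OF N XY(2)]])
    show "embedding L (M\<lparr>carrier := gen_set L M X\<rparr>) (N\<lparr>carrier := gen_set L N Y\<rparr>) g"
      using iso by (simp add: isomorphism_def generated_def)
    show "fint M f xs \<in> gen_set L M X"
      if "f \<in> Funs L" "set xs \<subseteq> gen_set L M X" "length xs = farity L f" for f xs
      using that by (auto intro!: gen_set.step)
  qed
  then show ?thesis by (rule elementary_on_subset) (auto intro: gen_set.base)
qed

section \<open>Algebraic closure as a closure operator\<close>

lemma acl_var:
  fixes M :: "('f, 'r, 'u) fo_struct"
  assumes "wf_fm L \<phi>" "e ` (FV \<phi> - {x}) \<subseteq> X" "a \<in> carrier M" "sat M (e(x := a)) \<phi>"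
    "finite {c \<in> carrier M. sat M (e(x := c)) \<phi>}"
  shows "a \<in> acl L M X"
proof -
  define \<rho> where "\<rho> = (\<lambda>v. if v = x then 0 else Suc v)"
  obtain \<psi> where \<psi>: "wf_fm L \<psi>" "FV \<psi> \<subseteq> \<rho> ` FV \<phi>"
    "\<forall>(M :: ('f, 'r, 'u) fo_struct) e. sat M e \<psi> \<longleftrightarrow> sat M (e \<circ> \<rho>) \<phi>"
    using rename_fm_exists[OF assms(1)] by blast
  define e' where "e' = (\<lambda>v. e (v - 1))"
  have s: "sat M (e'(0 := c)) \<psi> \<longleftrightarrow> sat M (e(x := c)) \<phi>" for c
    unfolding \<psi>(3)[rule_format] by (rule sat_cong) (auto simp: e'_def \<rho>_def)
  have "FV \<psi> - {0} \<subseteq> Suc ` (FV \<phi> - {x})" using \<psi>(2) by (auto simp: \<rho>_def split: if_splits)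
  then have "e' ` (FV \<psi> - {0}) \<subseteq> e' ` Suc ` (FV \<phi> - {x})" by (rule image_mono)
  also have "\<dots> \<subseteq> X" using assms(2) by (auto simp: e'_def)
  finally have "e' ` (FV \<psi> - {0}) \<subseteq> X" .
  then show ?thesis
    unfolding acl_def using assms s \<psi>(1) by (auto intro!: exI[of _ \<psi>] exI[of _ e'])
qed

lemma acl_subset_carrier: "acl L M X \<subseteq> carrier M"
  by (auto simp: acl_def)

lemma acl_extensive:
  fixes M :: "('f, 'r, 'u) fo_struct"
  assumes "X \<subseteq> carrier M"
  shows "X \<subseteq> acl L M X"
proof
  fix a assume "a \<in> X"
  then show "a \<in> acl L M X"
    by (intro acl_var[of "Eq (Var 0) (Var 1)" "\<lambda>_. a" 0])
      (use assms in \<open>auto intro: finite_subset[of _ "{a}"]\<close>)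
qed

lemma acl_mono: "X \<subseteq> Y \<Longrightarrow> acl L M X \<subseteq> acl L M Y"
  unfolding acl_def by blast

lemma acl_finite_subset:
  assumes "a \<in> acl L M X"
  obtains F where "finite F" "F \<subseteq> X" "a \<in> acl L M F"
proof -
  obtain \<phi> e where "a \<in> carrier M" "wf_fm L \<phi>" "e ` (FV \<phi> - {0}) \<subseteq> X" "sat M (e(0 := a)) \<phi>"
    "finite {c \<in> carrier M. sat M (e(0 := c)) \<phi>}"
    using assms by (auto simp: acl_def)
  then show ?thesis by (intro that[of "e ` (FV \<phi> - {0})"]) (auto simp: acl_def)
qed

text \<open>The formula for \<open>a\<close> says that some \<open>y\<close> satisfying
  \<open>\<zeta>\<close> has a finite fiber of solutions of \<open>\<phi>\<close> and that the point
  lies in this fiber; finiteness of the fiber is expressed by elimination of infinity. The solution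
  set is a finite union of finite fibers.\<close>

lemma acl_trans:
  fixes M :: "('f, 'r, 'u) fo_struct"
  assumes M: "models L T M" and X: "X \<subseteq> carrier M"
    and c: "c \<in> acl L M X" and a: "a \<in> acl L M (insert c X)"
  shows "a \<in> acl L M X"
proof -
  obtain \<phi> e where \<phi>: "a \<in> carrier M" "wf_fm L \<phi>" "e ` (FV \<phi> - {0}) \<subseteq> insert c X"
    "sat M (e(0 := a)) \<phi>" "finite {c \<in> carrier M. sat M (e(0 := c)) \<phi>}"
    using a by (auto simp: acl_def)
  obtain \<zeta> d where \<zeta>: "c \<in> carrier M" "wf_fm L \<zeta>" "d ` (FV \<zeta> - {0}) \<subseteq> X"
    "sat M (d(0 := c)) \<zeta>" "finite {c \<in> carrier M. sat M (d(0 := c)) \<zeta>}"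
    using c by (auto simp: acl_def)
  \<comment> \<open>The point keeps the variable 0, and every variable with value \<open>c\<close>
    becomes 1. The remaining parameters of \<open>\<phi>\<close> go to even numbers and, by
    \<open>\<sigma>\<close> below, those of \<open>\<zeta>\<close> to odd ones, so that
    \<open>e'\<close> can carry both assignments.\<close>
  define \<rho> where "\<rho> = (\<lambda>v. if v = 0 then 0 else if e v = c then 1 else 2 * v + 2)"
  obtain \<phi>' where \<phi>': "wf_fm L \<phi>'" "FV \<phi>' \<subseteq> \<rho> ` FV \<phi>"
    "\<forall>(M :: ('f, 'r, 'u) fo_struct) e. sat M e \<phi>' \<longleftrightarrow> sat M (e \<circ> \<rho>) \<phi>"
    using rename_fm_exists[OF \<phi>(2)] by blast
  define \<sigma> where "\<sigma> = (\<lambda>v. if v = 0 then 1 else 2 * v + 3 :: nat)"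
  obtain \<zeta>' where \<zeta>': "wf_fm L \<zeta>'" "FV \<zeta>' \<subseteq> \<sigma> ` FV \<zeta>"
    "\<forall>(M :: ('f, 'r, 'u) fo_struct) e. sat M e \<zeta>' \<longleftrightarrow> sat M (e \<circ> \<sigma>) \<zeta>"
    using rename_fm_exists[OF \<zeta>(2)] by blast
  define e' where "e' = (\<lambda>v. if even v then e ((v - 2) div 2) else d ((v - 3) div 2))"
  have s\<phi>: "sat M (e'(1 := c, 0 := y)) \<phi>' \<longleftrightarrow> sat M (e(0 := y)) \<phi>" for y
    unfolding \<phi>'(3)[rule_format] by (rule sat_cong) (auto simp: \<rho>_def e'_def)
  have s\<zeta>: "sat M (e'(1 := y, 0 := z)) \<zeta>' \<longleftrightarrow> sat M (d(0 := y)) \<zeta>" for y z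
    unfolding \<zeta>'(3)[rule_format] by (rule sat_cong) (auto simp: \<sigma>_def e'_def)
  obtain \<xi> where \<xi>: "wf_fm L \<xi>" "FV \<xi> \<subseteq> FV \<phi>' - {0}"
    "\<And>(M :: ('f, 'r, 'u) fo_struct) e. models L T M \<Longrightarrow> e ` (FV \<phi>' - {0}) \<subseteq> carrier M \<Longrightarrow>
       sat M e \<xi> \<longleftrightarrow> infinite {a \<in> carrier M. sat M (e(0 := a)) \<phi>'}"
    using exists_infty[OF \<phi>'(1)] by blast
  define \<psi> where "\<psi> = Exi 1 (And \<zeta>' (And \<phi>' (Neg \<xi>)))"
  have par: "e' ` (FV \<phi>' - {0, 1}) \<subseteq> X" "e' ` (FV \<zeta>' - {1}) \<subseteq> X" "0 \<notin> FV \<zeta>'"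
  proof -
    have "e' v \<in> X" if v: "v \<in> FV \<phi>'" "v \<noteq> 0" "v \<noteq> 1" for v
    proof -
      obtain w where w: "w \<in> FV \<phi>" "v = \<rho> w" using \<phi>'(2) v(1) by blast
      then have "w \<noteq> 0" "e w \<noteq> c" "v = 2 * w + 2" using v by (auto simp: \<rho>_def split: if_splits)
      then show ?thesis using w \<phi>(3) by (auto simp: e'_def)
    qed
    then show "e' ` (FV \<phi>' - {0, 1}) \<subseteq> X" by blast
    have "e' v \<in> X" if v: "v \<in> FV \<zeta>'" "v \<noteq> 1" for v
    proof -
      obtain w where w: "w \<in> FV \<zeta>" "v = \<sigma> w" using \<zeta>'(2) v(1) by blast
      then have "w \<noteq> 0" "v = 2 * w + 3" using v by (auto simp: \<sigma>_def split: if_splits)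
      then show ?thesis using w \<zeta>(3) by (auto simp: e'_def)
    qed
    then show "e' ` (FV \<zeta>' - {1}) \<subseteq> X" by blast
    show "0 \<notin> FV \<zeta>'" using \<zeta>'(2) by (auto simp: \<sigma>_def split: if_splits)
  qed
  have "sat M (e'(1 := y, 0 := z)) \<xi> \<longleftrightarrow>
      infinite {a \<in> carrier M. sat M (e'(1 := y, 0 := a)) \<phi>'}" if "y \<in> carrier M" for y z
  proof -
    have "sat M (e'(1 := y, 0 := z)) \<xi> \<longleftrightarrow> sat M (e'(1 := y)) \<xi>"
      by (rule sat_cong) (use \<xi>(2) in auto)
    also have "\<dots> \<longleftrightarrow> infinite {a \<in> carrier M. sat M (e'(1 := y, 0 := a)) \<phi>'}"
      by (rule \<xi>(3)[OF M]) (use par(1) X that in auto)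
    finally show ?thesis .
  qed
  note s\<xi> = this
  have tw: "e'(0 := z, 1 := y) = e'(1 := y, 0 := z)" for y z
    by (rule fun_upd_twist) simp
  have s: "sat M (e'(0 := z)) \<psi> \<longleftrightarrow>
      (\<exists>y\<in>carrier M. sat M (d(0 := y)) \<zeta> \<and> sat M (e'(1 := y, 0 := z)) \<phi>' \<and>
         finite {a \<in> carrier M. sat M (e'(1 := y, 0 := a)) \<phi>'})" for z
    unfolding \<psi>_def Exi_simps And_simps sat.simps tw s\<zeta> by (intro bex_cong refl) (simp only: s\<xi>, blast)
  show ?thesis
  proof (rule acl_var[of \<psi> e' 0])
    show "wf_fm L \<psi>" using \<phi>'(1) \<zeta>'(1) \<xi>(1) by (simp add: \<psi>_def)
    have "FV \<psi> - {0} \<subseteq> (FV \<phi>' - {0, 1}) \<union> (FV \<zeta>' - {1})" using \<xi>(2) by (auto simp: \<psi>_def)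
    then show "e' ` (FV \<psi> - {0}) \<subseteq> X" using par by blast
    show "a \<in> carrier M" by fact
    show "sat M (e'(0 := a)) \<psi>" unfolding s using \<zeta> \<phi> by (intro bexI[of _ c]) (simp_all add: s\<phi>[unfolded One_nat_def])
    have "{z \<in> carrier M. sat M (e'(0 := z)) \<psi>} \<subseteq>
        (\<Union>y\<in>{y \<in> carrier M. sat M (d(0 := y)) \<zeta> \<and>
             finite {a \<in> carrier M. sat M (e'(1 := y, 0 := a)) \<phi>'}}.
           {a \<in> carrier M. sat M (e'(1 := y, 0 := a)) \<phi>'})"
      unfolding s by auto
    then show "finite {z \<in> carrier M. sat M (e'(0 := z)) \<psi>}"
      by (rule finite_subset) (auto intro: finite_subset[OF _ \<zeta>(5)])
  qed
qed

text \<open>A point uses only finitely many parameters from \<open>acl L M X\<close>; these are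
  removed one by one with \<open>acl_trans\<close>.\<close>

lemma acl_idem:
  fixes M :: "('f, 'r, 'u) fo_struct"
  assumes M: "models L T M" and X: "X \<subseteq> carrier M"
  shows "acl L M (acl L M X) = acl L M X"
proof
  show "acl L M X \<subseteq> acl L M (acl L M X)"
    by (rule acl_extensive[OF acl_subset_carrier])
  have "acl L M (X \<union> F) \<subseteq> acl L M X" if "finite F" "F \<subseteq> acl L M X" for F
    using that
  proof (induction F)
    case (insert c F)
    have "acl L M (X \<union> insert c F) \<subseteq> acl L M (X \<union> F)"
    proof
      fix a assume "a \<in> acl L M (X \<union> insert c F)"
      then show "a \<in> acl L M (X \<union> F)"
        using acl_trans[OF M, of "X \<union> F" c a] acl_mono[of X "X \<union> F" M] insert.prems X
          acl_subset_carrier[of M X] by auto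
    qed
    then show ?case using insert by auto
  qed simp
  note * = this
  show "acl L M (acl L M X) \<subseteq> acl L M X"
  proof
    fix a assume "a \<in> acl L M (acl L M X)"
    then obtain F where "finite F" "F \<subseteq> acl L M X" "a \<in> acl L M F" by (rule acl_finite_subset)
    then show "a \<in> acl L M X" using *[of F] acl_mono[of F "X \<union> F" M] by auto
  qed
qed

lemma acl_exchange:
  fixes M :: "('f, 'r, 'u) fo_struct"
  assumes "models L T M" "X \<subseteq> carrier M" "a \<in> carrier M" "b \<in> carrier M"
    "a \<in> acl L M (insert b X)" "a \<notin> acl L M X"
  shows "b \<in> acl L M (insert a X)"
  using geometric assms unfolding geometric_theory_def acl_exchange_def by blast

text \<open>The map is not defined on the whole solution set of the algebraic formula. Finiteness of
  that set is instead transported as the failure of \<open>\<xi>\<close>, a formula over the same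
  parameters.\<close>

lemma elementary_on_acl1:
  fixes M N :: "('f, 'r, 'u) fo_struct"
  assumes M: "models L T M" and N: "models L T N" and f: "elementary_on L M N Z f"
    and "S \<subseteq> Z" "a \<in> Z" "a \<in> acl L M S"
  shows "f a \<in> acl L N (f ` S)"
proof -
  note Z = elementary_on_carrier[OF f]
  obtain \<phi> e where \<phi>: "a \<in> carrier M" "wf_fm L \<phi>" "e ` (FV \<phi> - {0}) \<subseteq> S" "sat M (e(0 := a)) \<phi>"
    "finite {c \<in> carrier M. sat M (e(0 := c)) \<phi>}"
    using assms by (auto simp: acl_def)
  obtain \<xi> where \<xi>: "wf_fm L \<xi>" "FV \<xi> \<subseteq> FV \<phi> - {0}"
    "\<And>(M :: ('f, 'r, 'u) fo_struct) e. models L T M \<Longrightarrow> e ` (FV \<phi> - {0}) \<subseteq> carrier M \<Longrightarrow>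
       sat M e \<xi> \<longleftrightarrow> infinite {a \<in> carrier M. sat M (e(0 := a)) \<phi>}"
    using exists_infty[OF \<phi>(2)] by blast
  have "sat M (e(0 := a)) \<phi> \<longleftrightarrow> sat N (f \<circ> e(0 := a)) \<phi>"
    by (rule elementary_onD[OF f]) (use \<phi> assms in auto)
  then have 1: "sat N ((f \<circ> e)(0 := f a)) \<phi>" using \<phi> by (simp add: fun_upd_comp)
  have "\<not> sat M e \<xi>" using \<xi>(3)[OF M, of e] \<phi> assms Z by auto
  moreover have "sat M e \<xi> \<longleftrightarrow> sat N (f \<circ> e) \<xi>"
    by (rule elementary_onD[OF f \<xi>(1)]) (use \<xi>(2) \<phi>(3) \<open>S \<subseteq> Z\<close> in blast)
  moreover have "sat N (f \<circ> e) \<xi> \<longleftrightarrow> infinite {c \<in> carrier N. sat N ((f \<circ> e)(0 := c)) \<phi>}"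
  proof (rule \<xi>(3)[OF N])
    have "e ` (FV \<phi> - {0}) \<subseteq> Z" using \<phi>(3) \<open>S \<subseteq> Z\<close> by blast
    then show "(f \<circ> e) ` (FV \<phi> - {0}) \<subseteq> carrier N" using Z(2) by auto
  qed
  ultimately have 2: "finite {c \<in> carrier N. sat N ((f \<circ> e)(0 := c)) \<phi>}" by simp
  show ?thesis
    by (rule acl_var[OF \<phi>(2) _ _ 1 2]) (use \<phi> assms Z in auto)
qed

lemma elementary_on_acl:
  fixes M N :: "('f, 'r, 'u) fo_struct"
  assumes M: "models L T M" and N: "models L T N" and f: "elementary_on L M N Z f"
    and S: "S \<subseteq> Z" "a \<in> Z"
  shows "f a \<in> acl L N (f ` S) \<longleftrightarrow> a \<in> acl L M S"
proof
  assume "f a \<in> acl L N (f ` S)"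
  then have "inv_into Z f (f a) \<in> acl L M (inv_into Z f ` f ` S)"
    by (intro elementary_on_acl1[OF N M elementary_on_inv[OF f]]) (use S in auto)
  then show "a \<in> acl L M S"
    using elementary_on_inj[OF f] S by (simp add: inv_into_image_cancel)
qed (use elementary_on_acl1[OF assms] in auto)

text \<open>Embeddings between models of \<open>T\<close> are elementary by quantifier elimination.\<close>

lemma acl_univ_eq:
  fixes M :: "('f, 'r, 'u) fo_struct"
  assumes M: "models L T M" and X: "X \<subseteq> carrier M"
  shows "acl_univ L T M X = acl L M X"
proof (intro equalityI subsetI)
  fix a assume "a \<in> acl_univ L T M X"
  then obtain N g where a: "a \<in> carrier M" and N: "models L T N" "embedding L M N g"
    and "g a \<in> acl L N (g ` X)"
    by (auto simp: acl_univ_def)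
  moreover have "elementary_on L M N (carrier M) g"
    by (rule elementary_on_embedding[OF M N(1), where S' = "carrier N"])
      (use M N in \<open>auto simp: models_def is_struct_def\<close>)
  ultimately show "a \<in> acl L M X" using elementary_on_acl[OF M N(1)] X by blast
next
  fix a assume "a \<in> acl L M X"
  moreover have "embedding L M M id" by (simp add: embedding_def)
  ultimately show "a \<in> acl_univ L T M X"
    using M acl_subset_carrier[of M X] unfolding acl_univ_def
    by (auto intro!: exI[of _ M] exI[of _ id])
qed

end

section \<open>Dimension in a pregeometry\<close>

locale pregeometry =
  fixes cl :: "'u set \<Rightarrow> 'u set" and C :: "'u set"
  assumes cl_ext: "X \<subseteq> C \<Longrightarrow> X \<subseteq> cl X"
    and cl_carrier: "cl X \<subseteq> C"
    and cl_mono: "X \<subseteq> Y \<Longrightarrow> cl X \<subseteq> cl Y"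
    and cl_idem: "X \<subseteq> C \<Longrightarrow> cl (cl X) = cl X"
    and cl_exch: "X \<subseteq> C \<Longrightarrow> a \<in> C \<Longrightarrow> b \<in> C \<Longrightarrow> a \<in> cl (insert b X) \<Longrightarrow> a \<notin> cl X \<Longrightarrow>
      b \<in> cl (insert a X)"
begin

abbreviation rk :: "'u set \<Rightarrow> nat" where
  "rk A \<equiv> pdim cl A {}"

lemma cl_least: "X \<subseteq> cl Y \<Longrightarrow> Y \<subseteq> C \<Longrightarrow> cl X \<subseteq> cl Y"
  using cl_idem cl_mono by metis

text \<open>Induction on the number of elements of \<open>B\<close> outside \<open>G\<close>: one
  such \<open>b\<close> is exchanged for a \<open>g\<close> in \<open>G\<close> outside the closure
  of \<open>X\<close> and the rest of \<open>B\<close>. The size of \<open>B\<close> and its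
  independence over \<open>X\<close> are kept.\<close>

lemma steinitz:
  assumes "finite B" "B \<subseteq> C" "finite G" "G \<subseteq> C" "X \<subseteq> C" "B \<subseteq> cl (X \<union> G)"
    "\<forall>b\<in>B. b \<notin> cl (X \<union> (B - {b}))"
  shows "card B \<le> card G"
  using assms
proof (induction "card (B - G)" arbitrary: B rule: less_induct)
  case less
  show ?case
  proof (cases "B \<subseteq> G")
    case True
    then show ?thesis using less.prems card_mono by blast
  next
    case False
    then obtain b where b: "b \<in> B" "b \<notin> G" by blast
    let ?Y = "X \<union> (B - {b})"
    have Y: "?Y \<subseteq> C" using less.prems by blast
    \<comment> \<open>Otherwise \<open>b\<close> would lie in the closure of \<open>X\<close> and
      the rest of \<open>B\<close>.\<close>
    have "\<not> G \<subseteq> cl ?Y"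
    proof
      assume "G \<subseteq> cl ?Y"
      then have "X \<union> G \<subseteq> cl ?Y" using cl_ext[OF Y] by blast
      then have "cl (X \<union> G) \<subseteq> cl ?Y" by (rule cl_least[OF _ Y])
      then show False using less.prems b by blast
    qed
    then obtain g where g: "g \<in> G" "g \<notin> cl ?Y" by blast
    have gB: "g \<notin> B" using g b cl_ext[OF Y] by blast
    define B' where "B' = insert g (B - {b})"
    have "card B \<le> card G"
    proof -
      have "B' - G = B - G - {b}" using g by (auto simp: B'_def)
      then have "card (B' - G) < card (B - G)"
        using b less.prems by (metis Diff_iff card_Diff1_less finite_Diff)
      moreover have "g' \<notin> cl (X \<union> (B' - {g'}))" if "g' \<in> B'" for g'
      proof (cases "g' = g")
        case True
        then have "B' - {g'} = B - {b}" using gB by (auto simp: B'_def)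
        then show ?thesis using g True by simp
      next
        case False
        let ?Z = "X \<union> (B - {b} - {g'})"
        have g': "g' \<in> B" "g' \<noteq> b" using that False by (auto simp: B'_def)
        \<comment> \<open>If \<open>g'\<close> depended on \<open>g\<close> together with
          \<open>?Z\<close>, exchange would put \<open>g\<close> into \<open>cl ?Y\<close>.\<close>
        have "g' \<notin> cl ?Z"
          using less.prems g' cl_mono[of ?Z "X \<union> (B - {g'})"] by blast
        moreover have "insert g' ?Z = ?Y" using g' by blast
        ultimately have "g' \<notin> cl (insert g ?Z)"
          using cl_exch[of ?Z g' g] g g' less.prems by auto
        moreover have "insert g ?Z = X \<union> (B' - {g'})" using False by (auto simp: B'_def)
        ultimately show ?thesis by simp
      qed
      moreover have "B' \<subseteq> cl (X \<union> G)"
        using less.prems g cl_ext[of "X \<union> G"] by (auto simp: B'_def)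
      ultimately have "card B' \<le> card G"
        using less.hyps[of B'] less.prems g by (auto simp: B'_def)
      moreover have "card B' = card B"
        using card_Suc_Diff1[OF less.prems(1) b(1)] gB less.prems(1) by (simp add: B'_def)
      ultimately show ?thesis by simp
    qed
    then show ?thesis .
  qed
qed

lemma pdim_basis:
  assumes B: "is_basis cl B A X" and "A \<subseteq> C" "X \<subseteq> C"
  shows "pdim cl A X = card B"
proof -
  have le: "card B1 \<le> card B2" if "is_basis cl B1 A X" "is_basis cl B2 A X" for B1 B2
    by (rule steinitz[of B1 B2 X]) (use that assms in \<open>auto simp: is_basis_def\<close>)
  have "card B' = card B" if "is_basis cl B' A X" for B'
    using le[OF B that] le[OF that B] by simp
  then show ?thesis unfolding pdim_def using B by (intro Least_equality) (blast, metis order_refl)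
qed

lemma basis_empty: "is_basis cl {} {} X"
  by (simp add: is_basis_def)

lemma basis_insert:
  assumes B: "is_basis cl B A X" and C: "A \<subseteq> C" "X \<subseteq> C" "a \<in> C"
  shows "is_basis cl (if a \<in> cl (X \<union> A) then B else insert a B) (insert a A) X"
proof -
  have B': "finite B" "B \<subseteq> A" "A \<subseteq> cl (X \<union> B)" "\<forall>b\<in>B. b \<notin> cl (X \<union> (B - {b}))"
    using B by (auto simp: is_basis_def)
  have XB: "X \<union> B \<subseteq> C" using B' C by blast
  have "X \<union> A \<subseteq> cl (X \<union> B)" using B'(3) cl_ext[OF XB] by blast
  then have eq: "cl (X \<union> A) = cl (X \<union> B)"
    using cl_least[OF _ XB] cl_mono[of "X \<union> B" "X \<union> A"] B'(2) by blast
  show ?thesis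
  proof (cases "a \<in> cl (X \<union> A)")
    case True
    then show ?thesis using B' eq by (auto simp: is_basis_def)
  next
    case False
    then have a: "a \<notin> cl (X \<union> B)" "a \<notin> B" using eq cl_ext[OF XB] by auto
    have "b \<notin> cl (X \<union> (insert a B - {b}))" if "b \<in> B" for b
    proof
      have ins: "insert b (X \<union> (B - {b})) = X \<union> B" "X \<union> (insert a B - {b}) = insert a (X \<union> (B - {b}))"
        using that a by auto
      assume "b \<in> cl (X \<union> (insert a B - {b}))"
      then have "a \<in> cl (X \<union> B)"
        using cl_exch[of "X \<union> (B - {b})" b a] B' that XB C ins by auto
      then show False using a by simp
    qed
    moreover have "insert a B - {a} = B" using a by blast
    moreover have "insert a A \<subseteq> cl (X \<union> insert a B)"
      using B'(3) cl_mono[of "X \<union> B" "X \<union> insert a B"] cl_ext[of "X \<union> insert a B"] XB C by blast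
    ultimately show ?thesis using False a B' by (auto simp: is_basis_def)
  qed
qed

lemma basis_exists:
  assumes "finite A" "A \<subseteq> C" "X \<subseteq> C"
  shows "\<exists>B. is_basis cl B A X"
  using assms
proof (induction A)
  case (insert a A)
  then show ?case using basis_insert[of _ A X a] by blast
qed (use basis_empty in blast)

lemma pdim_empty [simp]: "X \<subseteq> C \<Longrightarrow> pdim cl {} X = 0"
  using pdim_basis[OF basis_empty] by simp

text \<open>\<open>rk_insert\<close>, \<open>pdim_rk\<close> and \<open>pdim_count\<close> are all
  obtained from this recursion.\<close>

lemma pdim_insert:
  assumes "finite A" "A \<subseteq> C" "X \<subseteq> C" "a \<in> C"
  shows "pdim cl (insert a A) X = pdim cl A X + (if a \<in> cl (X \<union> A) then 0 else 1)"
proof -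
  obtain B where B: "is_basis cl B A X" using basis_exists[OF assms(1-3)] by blast
  have "a \<notin> B" if "a \<notin> cl (X \<union> A)"
    using that cl_ext[of "X \<union> A"] assms B by (auto simp: is_basis_def)
  moreover have "finite B" using B by (simp add: is_basis_def)
  ultimately show ?thesis
    using pdim_basis[OF basis_insert[OF B]] pdim_basis[OF B] assms by auto
qed

lemma pdim_le_card:
  assumes "finite A" "A \<subseteq> C" "X \<subseteq> C" "finite G" "G \<subseteq> C" "A \<subseteq> cl (X \<union> G)"
  shows "pdim cl A X \<le> card G"
proof -
  obtain B where B: "is_basis cl B A X" using basis_exists[OF assms(1-3)] by blast
  then have "finite B" "B \<subseteq> A" "\<forall>b\<in>B. b \<notin> cl (X \<union> (B - {b}))"
    unfolding is_basis_def by blast+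
  then have "card B \<le> card G"
    using steinitz[of B G X] assms by blast
  then show ?thesis using pdim_basis[OF B] assms by simp
qed

lemma rk_insert:
  "finite A \<Longrightarrow> A \<subseteq> C \<Longrightarrow> a \<in> C \<Longrightarrow> rk (insert a A) = rk A + (if a \<in> cl A then 0 else 1)"
  using pdim_insert[of A "{}" a] by simp

lemma pdim_rk:
  assumes "finite A" "A \<subseteq> C" "finite X" "X \<subseteq> C"
  shows "rk (A \<union> X) = pdim cl A X + rk X"
  using assms
proof (induction A)
  case (insert a A)
  then show ?case using rk_insert[of "A \<union> X" a] pdim_insert[of A X a] by (auto simp: Un_commute)
qed simp

lemma rk_mono:
  assumes "A \<subseteq> B" "finite B" "B \<subseteq> C"
  shows "rk A \<le> rk B"
  using pdim_rk[of B A] assms finite_subset[of A B] by (simp add: Un_absorb2)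

lemma rk_le_card: "finite A \<Longrightarrow> A \<subseteq> C \<Longrightarrow> rk A \<le> card A"
  using pdim_le_card[of A "{}" A] cl_ext by auto

text \<open>The points of \<open>B\<close> are added one at a time to \<open>A\<close> and to
  \<open>A \<inter> B\<close>: a point that is new over the larger set is new over the smaller one,
  so the rank of the larger set grows by no more.\<close>

lemma rk_submodular:
  assumes "finite A" "A \<subseteq> C" "finite B" "B \<subseteq> C"
  shows "rk (A \<union> B) + rk (A \<inter> B) \<le> rk A + rk B"
proof -
  have "rk (A \<union> E) + rk D \<le> rk A + rk (D \<union> E)" if "finite E" "E \<subseteq> C" "D \<subseteq> A" for E D
    using that
  proof (induction E)
    case (insert e E)
    have D: "finite D" "D \<subseteq> C" using insert.prems assms finite_subset by blast+
    have "cl (D \<union> E) \<subseteq> cl (A \<union> E)" by (rule cl_mono) (use insert.prems in blast)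
    then show ?case
      using insert assms D rk_insert[of "A \<union> E" e] rk_insert[of "D \<union> E" e] by auto
  qed simp
  from this[of B "A \<inter> B"] show ?thesis using assms by (simp add: Un_absorb1)
qed

text \<open>Indecomposability measures the dimension of closed and usually infinite sets. A basis of
  \<open>S\<close> spans \<open>cl S\<close> as well, so these dimensions reduce to those of finite
  sets.\<close>

lemma basis_cl:
  assumes "finite S" "S \<subseteq> C"
  obtains B where "is_basis cl B S {}" "is_basis cl B (cl S) {}"
proof -
  obtain B where B: "is_basis cl B S {}" using basis_exists[OF assms empty_subsetI] by blast
  have "B \<subseteq> C" using B assms by (auto simp: is_basis_def)
  then have "cl S \<subseteq> cl B" using B cl_least[of S B] by (simp add: is_basis_def)
  moreover have "B \<subseteq> cl S" using B cl_ext[OF assms(2)] by (auto simp: is_basis_def)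
  ultimately have "is_basis cl B (cl S) {}" using B by (simp add: is_basis_def)
  then show ?thesis using that B by blast
qed

lemma rk_cl: "finite S \<Longrightarrow> S \<subseteq> C \<Longrightarrow> rk (cl S) = rk S"
  by (metis basis_cl cl_carrier empty_subsetI pdim_basis)

lemma finite_dimensional_cl: "finite S \<Longrightarrow> S \<subseteq> C \<Longrightarrow> finite_dimensional cl (cl S)"
  unfolding finite_dimensional_def by (metis basis_cl)

end

context geometric_base
begin

lemma pregeometry_acl:
  fixes M :: "('f, 'r, 'u) fo_struct"
  assumes "models L T M"
  shows "pregeometry (acl L M) (carrier M)"
proof
  show "b \<in> acl L M (insert a X)"
    if "X \<subseteq> carrier M" "a \<in> carrier M" "b \<in> carrier M" "a \<in> acl L M (insert b X)" "a \<notin> acl L M X"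
    for X a b
    using acl_exchange[OF assms that] .
qed (simp_all add: acl_extensive acl_subset_carrier acl_mono acl_idem[OF assms])

abbreviation dm :: "('f, 'r, 'u) fo_struct \<Rightarrow> 'u set \<Rightarrow> nat" where
  "dm M A \<equiv> pdim (acl L M) A {}"

text \<open>Preservation of \<open>acl\<close> makes both ranks grow at the same steps.\<close>

lemma elementary_on_dm:
  fixes M N :: "('f, 'r, 'u) fo_struct"
  assumes M: "models L T M" and N: "models L T N" and f: "elementary_on L M N Z f"
    and "finite S" "S \<subseteq> Z"
  shows "dm N (f ` S) = dm M S"
proof -
  interpret M: pregeometry "acl L M" "carrier M" by (rule pregeometry_acl[OF M])
  interpret N: pregeometry "acl L N" "carrier N" by (rule pregeometry_acl[OF N])
  note Z = elementary_on_carrier[OF f]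
  from assms(4,5) show ?thesis
  proof (induction S)
    case (insert a S)
    then have "S \<subseteq> carrier M" "a \<in> carrier M" "f ` S \<subseteq> carrier N" "f a \<in> carrier N"
      using Z by blast+
    then show ?case
      using insert M.rk_insert[of S a] N.rk_insert[of "f ` S" "f a"]
        elementary_on_acl[OF M N f, of S a] by simp
  qed simp
qed

end

section \<open>Predimension\<close>

lemma small_multiple:
  fixes \<alpha> \<epsilon> :: real
  assumes "\<alpha> \<notin> \<rat>" "0 < \<epsilon>"
  obtains k :: nat and h :: int where "0 < k" "\<bar>k * \<alpha> - h\<bar> < \<epsilon>" "k * \<alpha> - h \<noteq> 0"
proof -
  obtain q :: nat where q: "0 < q" "1 / q < \<epsilon>"
    using assms(2) by (metis nat_approx_posE of_nat_Suc zero_less_Suc)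
  \<comment> \<open>Pigeonhole argument of Dirichlet: \<open>g i\<close> numbers the cell of length
    \<open>1 / q\<close> containing the fractional part of \<open>i * \<alpha>\<close>; among the
    \<open>q + 1\<close> indices two share a cell.\<close>
  define g where "g = (\<lambda>i::nat. \<lfloor>q * frac (i * \<alpha>)\<rfloor>)"
  have "g i \<in> {0..<int q}" for i
  proof -
    have "q * frac (i * \<alpha>) < q" using q(1) frac_lt_1[of "i * \<alpha>"] by simp
    moreover have "0 \<le> q * frac (i * \<alpha>)" by simp
    ultimately show ?thesis unfolding g_def atLeastLessThan_iff by linarith
  qed
  then have "g ` {..q} \<subseteq> {0..<int q}" by blast
  then have "card (g ` {..q}) \<le> card {0..<int q}" by (intro card_mono) simp_all
  then have "card (g ` {..q}) < card {..q}" by simp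
  then have "\<not> inj_on g {..q}" by (rule pigeonhole)
  then obtain i j where ij: "i < j" "g i = g j" unfolding inj_on_def by (metis linorder_neqE_nat)
  have "\<bar>q * frac (j * \<alpha>) - q * frac (i * \<alpha>)\<bar> < 1" using ij(2) unfolding g_def by linarith
  also have "q * frac (j * \<alpha>) - q * frac (i * \<alpha>) = q * (frac (j * \<alpha>) - frac (i * \<alpha>))"
    by (simp add: algebra_simps)
  finally have "q * \<bar>frac (j * \<alpha>) - frac (i * \<alpha>)\<bar> < 1" by (simp add: abs_mult)
  then have "\<bar>frac (j * \<alpha>) - frac (i * \<alpha>)\<bar> < 1 / q" using q(1) by (simp add: pos_less_divide_eq mult.commute)
  moreover define h where "h = \<lfloor>j * \<alpha>\<rfloor> - \<lfloor>i * \<alpha>\<rfloor>"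
  have eq: "(j - i) * \<alpha> - h = frac (j * \<alpha>) - frac (i * \<alpha>)"
    using ij(1) by (simp add: frac_def h_def of_nat_diff algebra_simps)
  ultimately have "\<bar>(j - i) * \<alpha> - h\<bar> < \<epsilon>" using q(2) by simp
  moreover have "(j - i) * \<alpha> - h \<noteq> 0"
  proof
    assume "(j - i) * \<alpha> - h = 0"
    then have "\<alpha> = of_int h / of_nat (j - i)" using ij(1) by (simp add: field_simps)
    moreover have "of_int h / of_nat (j - i) \<in> (\<rat> :: real set)" by simp
    ultimately show False using assms(1) by simp
  qed
  ultimately show ?thesis using ij(1) by (intro that[of "j - i" h]) simp_all
qed

text \<open>The sign of the small number \<open>k * \<alpha> - l\<close> is not known. If it is
  positive, the value starts nonnegative with a large \<open>K0\<close> and is lowered in steps of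
  \<open>d\<close>; if it is negative, the value starts at most 0 with a large \<open>N0\<close> and
  is raised. In the application \<open>K\<close> is the rank contributed by a set of new points and
  \<open>N\<close> their number, all of them being colored.\<close>

lemma irrational_approx:
  fixes \<alpha> v \<epsilon> :: real and n :: nat
  assumes "0 < \<alpha>" "\<alpha> \<notin> \<rat>" "0 < \<epsilon>"
  obtains K N :: nat where "n \<le> K" "0 \<le> v + K - \<alpha> * N" "v + K - \<alpha> * N < \<epsilon>"
proof -
  \<comment> \<open>The bound 1 forces \<open>h\<close> to be nonnegative, so that it can contribute
    to a rank.\<close>
  obtain k :: nat and h :: int where k: "0 < k" "\<bar>k * \<alpha> - h\<bar> < min \<epsilon> 1" "k * \<alpha> - h \<noteq> 0"
    using small_multiple[of \<alpha> "min \<epsilon> 1"] assms by auto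
  have "0 < k * \<alpha>" using k(1) assms(1) by simp
  then have "- 1 < real_of_int h" using k(2) by linarith
  then have "0 \<le> h" by linarith
  then obtain l where l: "h = int l" using nonneg_int_cases by blast
  have kl: "\<bar>k * \<alpha> - l\<bar> < \<epsilon>" "k * \<alpha> - l \<noteq> 0" using k(2,3) by (simp_all add: l)
  show ?thesis
  proof (cases "0 < k * \<alpha> - l")
    case True
    obtain K0 :: nat where K0: "n + \<bar>v\<bar> \<le> K0" using real_arch_simple by blast
    define d where "d = k * \<alpha> - l"
    define j where "j = nat \<lfloor>(v + K0) / d\<rfloor>"
    have "0 \<le> (v + K0) / d" using K0 True by (simp add: d_def)
    then have "real j \<le> (v + K0) / d" "(v + K0) / d < j + 1" unfolding j_def by linarith+
    then have "j * d \<le> v + K0" "v + K0 < j * d + d" using True by (simp_all add: d_def field_simps)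
    moreover have "v + real (K0 + j * l) - \<alpha> * real (j * k) = v + K0 - j * d"
      by (simp add: d_def algebra_simps)
    ultimately show ?thesis
      using kl K0 True by (intro that[of "K0 + j * l" "j * k"]) (simp_all add: d_def)
  next
    case False
    obtain N0 :: nat where "(n + v) / \<alpha> \<le> N0" using real_arch_simple by blast
    then have N0: "n + v \<le> \<alpha> * N0" using assms(1) by (simp add: field_simps)
    define d where "d = l - k * \<alpha>"
    have d: "0 < d" "d < \<epsilon>" using False kl by (auto simp: d_def)
    define j where "j = nat \<lceil>(\<alpha> * N0 - (n + v)) / d\<rceil>"
    have "0 \<le> (\<alpha> * N0 - (n + v)) / d" using N0 d by simp
    then have "(\<alpha> * N0 - (n + v)) / d \<le> j" "j < (\<alpha> * N0 - (n + v)) / d + 1" unfolding j_def by linarith+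
    then have "\<alpha> * N0 - (n + v) \<le> j * d" "j * d < \<alpha> * N0 - (n + v) + d"
      using d(1) by (simp_all add: field_simps)
    moreover have "v + real (n + j * l) - \<alpha> * real (N0 + j * k) = j * d - (\<alpha> * N0 - (n + v))"
      by (simp add: d_def algebra_simps)
    ultimately show ?thesis
      using d by (intro that[of "n + j * l" "N0 + j * k"]) simp_all
  qed
qed

text \<open>Only finitely many pairs \<open>(u, l)\<close> have entries at most \<open>s\<close>,
  and a maximum over them bounds \<open>N\<close>. The bound must be known before the models, since
  it enters the choice of \<open>r\<close> in \<open>extend_closed\<close>.\<close>

lemma irrational_approx_bounded:
  fixes \<alpha> \<epsilon> :: real and n s :: nat
  assumes "0 < \<alpha>" "\<alpha> \<notin> \<rat>" "0 < \<epsilon>"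
  obtains E :: nat where "\<And>u l :: nat. u \<le> s \<Longrightarrow> l \<le> s \<Longrightarrow>
    \<exists>K N :: nat. n \<le> K \<and> N \<le> E \<and> 0 \<le> (u - \<alpha> * l) + K - \<alpha> * N \<and> (u - \<alpha> * l) + K - \<alpha> * N < \<epsilon>"
proof -
  have "\<exists>K N :: nat. n \<le> K \<and> 0 \<le> (u - \<alpha> * l) + K - \<alpha> * N \<and> (u - \<alpha> * l) + K - \<alpha> * N < \<epsilon>"
    for u l :: nat
    using irrational_approx[OF assms, of n "u - \<alpha> * l"] by metis
  then obtain K N :: "nat \<Rightarrow> nat \<Rightarrow> nat" where KN:
    "\<And>u l. n \<le> K u l \<and> 0 \<le> (u - \<alpha> * l) + K u l - \<alpha> * N u l \<and> (u - \<alpha> * l) + K u l - \<alpha> * N u l < \<epsilon>"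
    by metis
  have "N u l \<le> Max ((\<lambda>(u, l). N u l) ` ({..s} \<times> {..s}))" if "u \<le> s" "l \<le> s" for u l
    by (rule Max_ge) (use that in auto)
  then show ?thesis using KN by (intro that) blast
qed

text \<open>Finitely many values are involved. The number 1 is inserted so that a minimum exists
  even if none of them is negative; it also gives \<open>\<epsilon> \<le> 1\<close>.\<close>

lemma negative_gap:
  fixes \<alpha> :: real and n :: nat
  obtains \<epsilon> :: real where "0 < \<epsilon>" "\<epsilon> \<le> 1"
    "\<And>u v :: nat. u \<le> n \<Longrightarrow> v \<le> n \<Longrightarrow> u - \<alpha> * v < 0 \<Longrightarrow> u - \<alpha> * v \<le> - \<epsilon>"
proof -
  define F where "F = insert 1 ((\<lambda>(u, v). \<alpha> * real v - real u) ` ({..n} \<times> {..n}) \<inter> {0<..})"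
  have F: "finite F" "F \<noteq> {}" by (simp_all add: F_def)
  show ?thesis
  proof (rule that[of "Min F"])
    show "0 < Min F" using F by (auto simp: F_def)
    show "Min F \<le> 1" using F by (intro Min_le) (auto simp: F_def)
    fix u v :: nat assume "u \<le> n" "v \<le> n" "u - \<alpha> * v < 0"
    then have "\<alpha> * v - u \<in> F" by (auto simp: F_def image_iff intro!: bexI[of _ "(u, v)"])
    then have "Min F \<le> \<alpha> * v - u" using F by simp
    then show "u - \<alpha> * v \<le> - Min F" by simp
  qed
qed

lemma pdim_cong:
  assumes "\<And>Y. Y \<subseteq> C \<Longrightarrow> cl Y = cl' Y" "A \<subseteq> C" "X \<subseteq> C"
  shows "pdim cl A X = pdim cl' A X"
proof -
  have "is_basis cl B A X \<longleftrightarrow> is_basis cl' B A X" for B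
  proof (cases "B \<subseteq> A")
    case True
    then have "X \<union> B \<subseteq> C" "X \<union> (B - {b}) \<subseteq> C" for b using assms(2,3) by blast+
    then have "cl (X \<union> B) = cl' (X \<union> B)" "cl (X \<union> (B - {b})) = cl' (X \<union> (B - {b}))" for b
      by (simp_all only: assms(1))
    then show ?thesis by (simp add: is_basis_def)
  qed (simp add: is_basis_def)
  then show ?thesis by (simp add: pdim_def)
qed

locale colored_base = geometric_base L T U
  for L :: "('f, 'r) language" and T :: "('f, 'r) fm set" and U :: "'u itself" +
  fixes \<alpha> :: real
  assumes \<alpha>_pos: "0 < \<alpha>" and \<alpha>_le_1: "\<alpha> \<le> 1" and \<alpha>_irrational: "\<alpha> \<notin> \<rat>"
begin

abbreviation col :: "('f, 'r option, 'u) fo_struct \<Rightarrow> 'u set \<Rightarrow> 'u set" where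
  "col M A \<equiv> {x \<in> A. colored M x}"

text \<open>The predimension for structures whose reduct is a model of \<open>T\<close>, where
  \<open>acl\<close> replaces the closure computed in extensions; \<open>predim_eq\<close> shows the
  agreement.\<close>

definition delta :: "('f, 'r option, 'u) fo_struct \<Rightarrow> 'u set \<Rightarrow> real" where
  "delta M A = real (dm (reduct M) A) - \<alpha> * real (card (col M A))"

definition good :: "('f, 'r option, 'u) fo_struct \<Rightarrow> bool" where
  "good M \<longleftrightarrow> models L T (reduct M) \<and> (\<forall>A. finite A \<and> A \<subseteq> carrier M \<longrightarrow> 0 \<le> delta M A)"

lemma good_models: "good M \<Longrightarrow> models L T (reduct M)"
  by (simp add: good_def)

lemma dimK_eq:
  fixes M :: "('f, 'r option, 'u) fo_struct"
  assumes "models L T (reduct M)" "A \<subseteq> carrier M" "X \<subseteq> carrier M"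
  shows "dimK L T M A X = pdim (acl L (reduct M)) A X"
  unfolding dimK_def
proof (rule pdim_cong[where C = "carrier M"])
  show "acl_univ L T (reduct M) Y = acl L (reduct M) Y" if "Y \<subseteq> carrier M" for Y
    by (rule acl_univ_eq[OF assms(1)]) (use that in simp)
qed (use assms in auto)

lemma predim_eq:
  assumes "models L T (reduct M)" "A \<subseteq> carrier M"
  shows "predim L T \<alpha> M A = delta M A"
  using dimK_eq[OF assms, of "{}"] by (simp add: predim_def predim_rel_def delta_def)

lemma col_Un: "col M (A \<union> B) = col M A \<union> col M B"
  by auto

lemma card_col_diff:
  "finite A \<Longrightarrow> finite B \<Longrightarrow> card (col M (A \<union> B)) = card (col M A) + card (col M (B - A))"
  by (subst card_Un_disjoint[symmetric]) (auto intro: arg_cong[where f = card])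

lemma dm_diff:
  assumes "models L T (reduct M)" "finite A" "A \<subseteq> carrier M" "finite B" "B \<subseteq> carrier M"
  shows "dm (reduct M) (A \<union> B) = dm (reduct M) A + pdim (acl L (reduct M)) B A"
proof -
  interpret pregeometry "acl L (reduct M)" "carrier (reduct M)" by (rule pregeometry_acl[OF assms(1)])
  show ?thesis using pdim_rk[of B A] assms by (simp add: Un_commute)
qed

lemma predim_rel_eq:
  assumes "models L T (reduct M)" "finite A" "A \<subseteq> carrier M" "finite X" "X \<subseteq> carrier M"
  shows "predim_rel L T \<alpha> M A X = delta M (X \<union> A) - delta M X"
  using dm_diff[OF assms(1,4,5,2,3)] dimK_eq[OF assms(1,3,5)] card_col_diff[OF assms(4,2), of M]
  by (simp add: predim_rel_def delta_def algebra_simps)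

text \<open>Rank is submodular, and the number of colored points is modular.\<close>

lemma delta_submodular:
  assumes "models L T (reduct M)" "finite A" "A \<subseteq> carrier M" "finite B" "B \<subseteq> carrier M"
  shows "delta M (A \<union> B) + delta M (A \<inter> B) \<le> delta M A + delta M B"
proof -
  interpret pregeometry "acl L (reduct M)" "carrier (reduct M)" by (rule pregeometry_acl[OF assms(1)])
  have "rk (A \<union> B) + rk (A \<inter> B) \<le> rk A + rk B" using rk_submodular assms by simp
  then have "real (rk (A \<union> B)) + real (rk (A \<inter> B)) \<le> real (rk A) + real (rk B)" by linarith
  moreover have "card (col M (A \<union> B)) + card (col M (A \<inter> B)) = card (col M A) + card (col M B)"
  proof -
    have "col M (A \<inter> B) = col M A \<inter> col M B" by auto
    then show ?thesis using card_Un_Int[of "col M A" "col M B"] assms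
      unfolding col_Un by simp
  qed
  then have "\<alpha> * real (card (col M (A \<union> B))) + \<alpha> * real (card (col M (A \<inter> B))) =
      \<alpha> * real (card (col M A)) + \<alpha> * real (card (col M B))"
    unfolding distrib_left[symmetric] by (simp only: of_nat_add[symmetric])
  ultimately show ?thesis by (simp add: delta_def)
qed

lemma delta_le_card:
  assumes "models L T (reduct M)" "finite A" "A \<subseteq> carrier M"
  shows "delta M A \<le> card A"
proof -
  interpret pregeometry "acl L (reduct M)" "carrier (reduct M)" by (rule pregeometry_acl[OF assms(1)])
  have "rk A \<le> card A" using rk_le_card assms by simp
  moreover have "0 \<le> \<alpha> * real (card (col M A))" using \<alpha>_pos by simp
  ultimately show ?thesis unfolding delta_def by linarith
qed

text \<open>The change of \<open>delta\<close> is \<open>u - \<alpha> * v\<close> with a rank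
  \<open>u\<close> and a number \<open>v\<close> of colored points, both at most \<open>n\<close>.
  So the gap depends neither on \<open>V\<close> nor on the structure.\<close>

lemma delta_gap:
  obtains \<epsilon> :: real where "0 < \<epsilon>" "\<epsilon> \<le> 1"
    "\<And>M V C. models L T (reduct M) \<Longrightarrow> finite V \<Longrightarrow> V \<subseteq> carrier M \<Longrightarrow> finite C \<Longrightarrow>
      C \<subseteq> carrier M \<Longrightarrow> card (C - V) < n \<Longrightarrow> delta M (V \<union> C) < delta M V \<Longrightarrow>
      delta M (V \<union> C) \<le> delta M V - \<epsilon>"
proof -
  obtain \<epsilon> where \<epsilon>: "0 < \<epsilon>" "\<epsilon> \<le> 1"
    "\<And>u v :: nat. u \<le> n \<Longrightarrow> v \<le> n \<Longrightarrow> u - \<alpha> * v < 0 \<Longrightarrow> u - \<alpha> * v \<le> - \<epsilon>"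
    using negative_gap[where \<alpha> = \<alpha> and n = n] by metis
  show ?thesis
  proof (rule that[OF \<epsilon>(1,2)])
    fix M V C
    assume M: "models L T (reduct M)" and V: "finite V" "V \<subseteq> carrier M"
      and C: "finite C" "C \<subseteq> carrier M" "card (C - V) < n" and less: "delta M (V \<union> C) < delta M V"
    interpret pregeometry "acl L (reduct M)" "carrier (reduct M)" by (rule pregeometry_acl[OF M])
    let ?u = "pdim (acl L (reduct M)) C V" and ?v = "card (col M (C - V))"
    have "C \<subseteq> acl L (reduct M) (V \<union> (C - V))" using cl_ext[of "V \<union> C"] V C by auto
    then have "?u \<le> card (C - V)" using pdim_le_card[of C V "C - V"] V C by auto
    then have u: "?u \<le> n" using C by simp
    have "?v \<le> card (C - V)" using C by (intro card_mono) auto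
    then have v: "?v \<le> n" using C by simp
    have eq: "delta M (V \<union> C) = delta M V + (?u - \<alpha> * ?v)"
      unfolding delta_def dm_diff[OF M V C(1,2)] card_col_diff[OF V(1) C(1)]
      by (simp add: algebra_simps)
    then show "delta M (V \<union> C) \<le> delta M V - \<epsilon>" using \<epsilon>(3)[OF u v] less by simp
  qed
qed

section \<open>Sets closed up to a given number of points, intrinsic cores and n-closures\<close>

definition rclosed :: "nat \<Rightarrow> ('f, 'r option, 'u) fo_struct \<Rightarrow> 'u set \<Rightarrow> bool" where
  "rclosed r M V \<longleftrightarrow> finite V \<and> V \<subseteq> carrier M \<and>
     (\<forall>C. finite C \<and> C \<subseteq> carrier M \<and> card (C - V) < r \<longrightarrow> delta M V \<le> delta M (V \<union> C))"

definition intr :: "('f, 'r option, 'u) fo_struct \<Rightarrow> 'u set \<Rightarrow> 'u set \<Rightarrow> bool" where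
  "intr M A B \<longleftrightarrow> finite B \<and> A \<subseteq> B \<and> (\<forall>A'. A \<subseteq> A' \<and> A' \<subset> B \<longrightarrow> delta M B < delta M A')"

lemma intrinsic_eq:
  assumes "models L T (reduct M)" "B \<subseteq> carrier M"
  shows "intrinsic L T \<alpha> M A B \<longleftrightarrow> intr M A B"
proof -
  have "predim L T \<alpha> M A' = delta M A'" if "A' \<subseteq> B" for A'
    using predim_eq[OF assms(1)] that assms(2) by blast
  then show ?thesis unfolding intrinsic_def intr_def by (auto simp: psubset_eq)
qed

abbreviation ncl :: "('f, 'r option, 'u) fo_struct \<Rightarrow> nat \<Rightarrow> 'u set \<Rightarrow> 'u set" where
  "ncl M n A \<equiv> n_closure L T \<alpha> M n A"

lemma in_ncl:
  assumes "models L T (reduct M)"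
  shows "ncl M n A = \<Union>{B. B \<subseteq> carrier M \<and> intr M A B \<and> card (B - A) < n}"
  unfolding n_closure_def using intrinsic_eq[OF assms] by (metis (no_types, lifting))

text \<open>Each failure of closedness adds fewer than \<open>r\<close> points and lowers
  \<open>delta\<close> by at least \<open>\<epsilon>\<close>. As \<open>delta\<close> starts at no
  more than \<open>m\<close> and is never negative, the number of failures is bounded in terms of
  \<open>m\<close> and \<open>r\<close> alone.\<close>

lemma rclosed_exists:
  obtains R where "\<And>M A. good M \<Longrightarrow> finite A \<Longrightarrow> A \<subseteq> carrier M \<Longrightarrow> card A \<le> m \<Longrightarrow>
    \<exists>V. A \<subseteq> V \<and> rclosed r M V \<and> card V \<le> R"
proof -
  obtain \<epsilon> where \<epsilon>: "0 < \<epsilon>"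
    "\<And>M V C. models L T (reduct M) \<Longrightarrow> finite V \<Longrightarrow> V \<subseteq> carrier M \<Longrightarrow> finite C \<Longrightarrow>
      C \<subseteq> carrier M \<Longrightarrow> card (C - V) < r \<Longrightarrow> delta M (V \<union> C) < delta M V \<Longrightarrow>
      delta M (V \<union> C) \<le> delta M V - \<epsilon>"
    using delta_gap[of r] by metis
  \<comment> \<open>\<open>k\<close> bounds the remaining number of failures; at
    \<open>k = 0\<close> the value of \<open>delta\<close> would be negative.\<close>
  have step: "\<exists>V. A \<subseteq> V \<and> rclosed r M V \<and> card V \<le> card A + k * r"
    if M: "good M" and "finite A" "A \<subseteq> carrier M" "delta M A < k * \<epsilon>" for M A k
    using that(2-)
  proof (induction k arbitrary: A)
    case 0
    then show ?case using M by (auto simp: good_def)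
  next
    case (Suc k)
    show ?case
    proof (cases "rclosed r M A")
      case False
      then obtain C where C: "finite C" "C \<subseteq> carrier M" "card (C - A) < r"
        "delta M (A \<union> C) < delta M A"
        using Suc.prems unfolding rclosed_def by force
      then have "delta M (A \<union> C) \<le> delta M A - \<epsilon>"
        using \<epsilon>(2)[OF good_models[OF M]] Suc.prems by simp
      then have "delta M (A \<union> C) < k * \<epsilon>" using Suc.prems by (simp add: algebra_simps)
      then obtain V where V: "A \<union> C \<subseteq> V" "rclosed r M V" "card V \<le> card (A \<union> C) + k * r"
        using Suc.IH[of "A \<union> C"] Suc.prems C by auto
      have "card (A \<union> C) = card (A \<union> (C - A))" by (rule arg_cong[where f = card]) auto
      also have "\<dots> \<le> card A + card (C - A)" by (rule card_Un_le)
      finally show ?thesis using V C by (intro exI[of _ V]) auto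
    qed (intro exI[of _ A], simp)
  qed
  obtain k :: nat where "real m / \<epsilon> < k" using reals_Archimedean2 by blast
  then have k: "real m < k * \<epsilon>" using \<epsilon> by (simp add: field_simps)
  show ?thesis
  proof (rule that[of "m + k * r"])
    fix M A assume A: "good M" "finite A" "A \<subseteq> carrier M" "card A \<le> m"
    then have "delta M A < k * \<epsilon>" using delta_le_card[OF good_models, of M A] k by linarith
    from step[OF A(1-3) this] A(4) show "\<exists>V. A \<subseteq> V \<and> rclosed r M V \<and> card V \<le> m + k * r"
      by (meson add_le_mono1 order_trans)
  qed
qed

text \<open>Among the sets between \<open>A\<close> and \<open>V\<close> with least
  \<open>delta\<close>, one of least cardinality is taken; every proper subset of it containing
  \<open>A\<close> then has strictly larger \<open>delta\<close>.\<close>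

lemma intr_core:
  assumes "finite V" "A \<subseteq> V"
  obtains X where "A \<subseteq> X" "X \<subseteq> V" "intr M A X" "\<And>Y. A \<subseteq> Y \<Longrightarrow> Y \<subseteq> V \<Longrightarrow> delta M X \<le> delta M Y"
proof -
  define S where "S = {Y. A \<subseteq> Y \<and> Y \<subseteq> V}"
  have S: "finite S" "S \<noteq> {}"
    using assms by (auto simp: S_def intro: finite_subset[of _ "Pow V"])
  define S0 where "S0 = {Y \<in> S. delta M Y = Min (delta M ` S)}"
  have "Min (delta M ` S) \<in> delta M ` S" using S by simp
  then obtain Y where "Y \<in> S" "delta M Y = Min (delta M ` S)" by (metis imageE)
  then have S0: "finite S0" "S0 \<noteq> {}" using S by (auto simp: S0_def)
  have "Min (card ` S0) \<in> card ` S0" using S0 by simp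
  then obtain X where X: "X \<in> S0" "card X = Min (card ` S0)" by auto
  have min: "delta M X \<le> delta M Y" if "Y \<in> S" for Y
    using X that S by (auto simp: S0_def)
  have "delta M X < delta M A'" if "A \<subseteq> A'" "A' \<subset> X" for A'
  proof (rule ccontr)
    assume "\<not> delta M X < delta M A'"
    moreover have "A' \<in> S" using that X by (auto simp: S_def S0_def)
    ultimately have "A' \<in> S0" using min[of A'] X by (auto simp: S0_def)
    then have "card X \<le> card A'" using X S0 by simp
    moreover have "X \<subseteq> V" using X by (simp add: S0_def S_def)
    then have "finite X" by (rule finite_subset[OF _ assms(1)])
    then have "card A' < card X" by (rule psubset_card_mono) fact
    ultimately show False by simp
  qed
  moreover have X': "A \<subseteq> X" "X \<subseteq> V" using X by (simp_all add: S0_def S_def)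
  moreover have "finite X" by (rule finite_subset[OF X'(2) assms(1)])
  ultimately show ?thesis using min by (intro that[of X]) (auto simp: intr_def S_def)
qed

text \<open>By submodularity, adding \<open>C\<close> to \<open>X\<close> changes
  \<open>delta\<close> by at least as much as adding it to \<open>V\<close>, since
  \<open>V \<inter> (X \<union> C)\<close> lies between \<open>A\<close> and \<open>V\<close> and so
  does not go below \<open>X\<close>. Being intrinsic over \<open>A\<close>, the core lies in an
  n-closure of \<open>A\<close>, where a given map is defined; \<open>V\<close> itself need
  not.\<close>

lemma rclosed_core:
  assumes M: "models L T (reduct M)" and V: "rclosed r M V" and "A \<subseteq> V"
  obtains X where "A \<subseteq> X" "X \<subseteq> V" "intr M A X" "rclosed r M X"
proof -
  have V': "finite V" "V \<subseteq> carrier M" using V by (auto simp: rclosed_def)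
  obtain X where X: "A \<subseteq> X" "X \<subseteq> V" "intr M A X"
    "\<And>Y. A \<subseteq> Y \<Longrightarrow> Y \<subseteq> V \<Longrightarrow> delta M X \<le> delta M Y"
    using intr_core[OF V'(1) assms(3), of M] by blast
  have fX: "finite X" "X \<subseteq> carrier M" using finite_subset[OF X(2) V'(1)] X(2) V'(2) by blast+
  have "delta M X \<le> delta M (X \<union> C)" if C: "finite C" "C \<subseteq> carrier M" "card (C - X) < r" for C
  proof -
    have "card (C - V) \<le> card (C - X)" using X C by (intro card_mono) auto
    then have "delta M V \<le> delta M (V \<union> C)" using V C unfolding rclosed_def by auto
    moreover have "delta M (V \<union> (X \<union> C)) + delta M (V \<inter> (X \<union> C)) \<le> delta M V + delta M (X \<union> C)"
      by (rule delta_submodular[OF M]) (use V' C fX in auto)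
    moreover have "V \<union> (X \<union> C) = V \<union> C" using X by blast
    moreover have "delta M X \<le> delta M (V \<inter> (X \<union> C))" by (rule X(4)) (use X in auto)
    ultimately show ?thesis by simp
  qed
  then have "rclosed r M X" using fX by (simp add: rclosed_def)
  then show ?thesis using that X by blast
qed

text \<open>If \<open>B\<close> left \<open>V\<close>, then \<open>V \<inter> B\<close> would have
  larger \<open>delta\<close> than \<open>B\<close>, and by submodularity adding \<open>B\<close>
  would lower the \<open>delta\<close> of \<open>V\<close>.\<close>

lemma rclosed_intr_subset:
  assumes M: "models L T (reduct M)" and V: "rclosed n M V" "A \<subseteq> V"
    and B: "B \<subseteq> carrier M" "intr M A B" "card (B - A) < n"
  shows "B \<subseteq> V"
proof (rule ccontr)
  assume "\<not> B \<subseteq> V"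
  then have "V \<inter> B \<subset> B" by blast
  moreover have "A \<subseteq> V \<inter> B" using V(2) B(2) by (simp add: intr_def)
  ultimately have "delta M B < delta M (V \<inter> B)" using B(2) by (simp add: intr_def)
  moreover have "finite B" using B by (simp add: intr_def)
  then have "card (B - V) \<le> card (B - A)" using V by (intro card_mono) auto
  then have "delta M V \<le> delta M (V \<union> B)" using V B by (auto simp: rclosed_def intr_def)
  moreover have "delta M (V \<union> B) + delta M (V \<inter> B) \<le> delta M V + delta M B"
    by (rule delta_submodular[OF M]) (use V B in \<open>auto simp: rclosed_def intr_def\<close>)
  ultimately show False by simp
qed

lemma ncl_subset_rclosed:
  assumes "models L T (reduct M)" "rclosed n M V" "A \<subseteq> V"
  shows "ncl M n A \<subseteq> V"
  using rclosed_intr_subset[OF assms] unfolding in_ncl[OF assms(1)] by blast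

lemma intr_subset_ncl:
  assumes "models L T (reduct M)" "B \<subseteq> carrier M" "intr M A B" "card (B - A) < n"
  shows "B \<subseteq> ncl M n A"
  unfolding in_ncl[OF assms(1)] using assms by blast

lemma ncl_carrier: "ncl M n A \<subseteq> carrier M"
  by (auto simp: n_closure_def)

lemma subset_ncl:
  assumes "finite A" "A \<subseteq> carrier M" "0 < n" "models L T (reduct M)"
  shows "A \<subseteq> ncl M n A"
  by (rule intr_subset_ncl) (use assms in \<open>auto simp: intr_def\<close>)

end

section \<open>Saturation and generic sets\<close>

text \<open>\<open>aleph1_saturated\<close> speaks of the variable 0, so the formulas are renamed:
  \<open>x\<close> becomes 0, and the parameters, held by \<open>e\<close> on \<open>W\<close>, move
  up by one.\<close>

lemma saturated_type1:
  fixes M :: "('f, 'r, 'u) fo_struct"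
  assumes sat: "aleph1_saturated L M" and W: "finite W" "e ` W \<subseteq> carrier M"
    and \<Delta>: "\<And>\<phi>. \<phi> \<in> \<Delta> \<Longrightarrow> wf_fm L \<phi> \<and> FV \<phi> \<subseteq> insert x W"
    and fin: "\<And>Q. finite Q \<Longrightarrow> Q \<subseteq> \<Delta> \<Longrightarrow> \<exists>c\<in>carrier M. \<forall>\<phi>\<in>Q. sat M (e(x := c)) \<phi>"
  shows "\<exists>c\<in>carrier M. \<forall>\<phi>\<in>\<Delta>. sat M (e(x := c)) \<phi>"
proof -
  define \<rho> where "\<rho> = (\<lambda>v. if v = x then 0 else Suc v)"
  define e' where "e' = (\<lambda>v. e (v - 1))"
  have "\<exists>\<psi>. wf_fm L \<psi> \<and> FV \<psi> \<subseteq> \<rho> ` FV \<phi> \<and>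
      (\<forall>(M :: ('f, 'r, 'u) fo_struct) e. sat M e \<psi> \<longleftrightarrow> sat M (e \<circ> \<rho>) \<phi>)" if "\<phi> \<in> \<Delta>" for \<phi>
    by (rule rename_fm_exists) (use \<Delta>[OF that] in simp)
  then obtain R where R: "\<And>\<phi>. \<phi> \<in> \<Delta> \<Longrightarrow> wf_fm L (R \<phi>) \<and> FV (R \<phi>) \<subseteq> \<rho> ` FV \<phi> \<and>
      (\<forall>(M :: ('f, 'r, 'u) fo_struct) e. sat M e (R \<phi>) \<longleftrightarrow> sat M (e \<circ> \<rho>) \<phi>)"
    by metis
  have s: "sat M (e'(0 := c)) (R \<phi>) \<longleftrightarrow> sat M (e(x := c)) \<phi>" if "\<phi> \<in> \<Delta>" for \<phi> c
  proof -
    have "sat M (e'(0 := c)) (R \<phi>) \<longleftrightarrow> sat M (e'(0 := c) \<circ> \<rho>) \<phi>" using R[OF that] by blast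
    also have "\<dots> \<longleftrightarrow> sat M (e(x := c)) \<phi>" by (rule sat_cong) (simp add: e'_def \<rho>_def)
    finally show ?thesis .
  qed
  define P where "P = (\<lambda>\<phi>. (R \<phi>, e')) ` \<Delta>"
  have "\<exists>c\<in>carrier M. \<forall>(\<phi>, e)\<in>P. sat M (e(0 := c)) \<phi>"
  proof (rule sat[unfolded aleph1_saturated_def, rule_format, of "e ` W"], intro conjI allI impI)
    show "countable (e ` W)" using W by (simp add: countable_finite)
    show "e ` W \<subseteq> carrier M" by fact
    show "\<forall>(\<phi>, e')\<in>P. wf_fm L \<phi> \<and> e' ` (FV \<phi> - {0}) \<subseteq> e ` W"
    proof -
      have "e' v \<in> e ` W" if v: "\<phi> \<in> \<Delta>" "v \<in> FV (R \<phi>)" "v \<noteq> 0" for \<phi> v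
      proof -
        obtain w where w: "w \<in> FV \<phi>" "v = \<rho> w" using R[OF v(1)] v(2) by blast
        then have "w \<noteq> x" "v = Suc w" using v(3) by (auto simp: \<rho>_def split: if_splits)
        moreover have "w \<in> W" using \<Delta>[OF v(1)] w calculation by blast
        ultimately show ?thesis by (simp add: e'_def)
      qed
      then show ?thesis using R by (auto simp: P_def)
    qed
    fix Q assume Q: "finite Q \<and> Q \<subseteq> P"
    then obtain Q' where Q': "Q' \<subseteq> \<Delta>" "finite Q'" "Q = (\<lambda>\<phi>. (R \<phi>, e')) ` Q'"
      unfolding P_def using finite_subset_image[of Q "\<lambda>\<phi>. (R \<phi>, e')" \<Delta>] by blast
    then obtain c where "c \<in> carrier M" "\<forall>\<phi>\<in>Q'. sat M (e(x := c)) \<phi>" using fin by blast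
    then show "\<exists>c\<in>carrier M. \<forall>(\<phi>, e)\<in>Q. sat M (e(0 := c)) \<phi>"
      using Q' s by (intro bexI[of _ c]) (auto simp: subset_iff)
  qed
  then show ?thesis using s by (auto simp: P_def)
qed

text \<open>The variables are realized one at a time. For \<open>x\<close> the type consists of all
  finite conjunctions from \<open>\<Gamma>\<close> with the remaining variables quantified away; the
  value found for \<open>x\<close> therefore keeps \<open>\<Gamma>\<close> finitely satisfiable and
  can join the parameters.\<close>

lemma saturated_types:
  fixes M :: "('f, 'r, 'u) fo_struct"
  assumes sat: "aleph1_saturated L M" and "finite V" and "finite W" "e ` W \<subseteq> carrier M"
    and "\<And>\<phi>. \<phi> \<in> \<Gamma> \<Longrightarrow> wf_fm L \<phi> \<and> FV \<phi> \<subseteq> V \<union> W"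
    and "\<And>Q. finite Q \<Longrightarrow> Q \<subseteq> \<Gamma> \<Longrightarrow> \<exists>e'. (\<forall>i. i \<notin> V \<longrightarrow> e' i = e i) \<and> e' ` V \<subseteq> carrier M \<and>
      (\<forall>\<phi>\<in>Q. sat M e' \<phi>)"
  shows "\<exists>e'. (\<forall>i. i \<notin> V \<longrightarrow> e' i = e i) \<and> e' ` V \<subseteq> carrier M \<and> (\<forall>\<phi>\<in>\<Gamma>. sat M e' \<phi>)"
  using assms(2-)
proof (induction V arbitrary: W e rule: finite_induct)
  case empty
  have "sat M e \<phi>" if \<phi>: "\<phi> \<in> \<Gamma>" for \<phi>
  proof -
    obtain e' where "\<forall>i. e' i = e i" "sat M e' \<phi>" using empty.prems(4)[of "{\<phi>}"] \<phi> by auto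
    then show ?thesis by (metis ext)
  qed
  then show ?case by (intro exI[of _ e]) simp
next
  case (insert x V)
  obtain vs where vs: "set vs = V" using finite_list[OF insert.hyps(1)] by blast
  define \<Delta> where "\<Delta> = {Exs vs (Conj qs) | qs. set qs \<subseteq> \<Gamma>}"
  have "\<exists>c\<in>carrier M. \<forall>\<phi>\<in>\<Delta>. sat M (e(x := c)) \<phi>"
  proof (rule saturated_type1[OF sat insert.prems(1,2)])
    show "wf_fm L \<phi> \<and> FV \<phi> \<subseteq> insert x W" if \<phi>: "\<phi> \<in> \<Delta>" for \<phi>
    proof -
      obtain qs where qs: "\<phi> = Exs vs (Conj qs)" "set qs \<subseteq> \<Gamma>" using \<phi> by (auto simp: \<Delta>_def)
      then have "wf_fm L q \<and> FV q \<subseteq> insert x V \<union> W" if "q \<in> set qs" for q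
        using insert.prems(3) that by blast
      then show ?thesis unfolding qs(1) Exs_simps Conj_simps vs by blast
    qed
    fix Q assume Q: "finite Q" "Q \<subseteq> \<Delta>"
    then have "\<forall>\<phi>\<in>Q. \<exists>qs. \<phi> = Exs vs (Conj qs) \<and> set qs \<subseteq> \<Gamma>" by (auto simp: \<Delta>_def)
    then obtain q where q: "\<forall>\<phi>\<in>Q. \<phi> = Exs vs (Conj (q \<phi>)) \<and> set (q \<phi>) \<subseteq> \<Gamma>" by metis
    have fin: "finite (\<Union>\<phi>\<in>Q. set (q \<phi>))" "(\<Union>\<phi>\<in>Q. set (q \<phi>)) \<subseteq> \<Gamma>" using Q q by auto
    obtain e' where e': "\<forall>i. i \<notin> insert x V \<longrightarrow> e' i = e i" "e' ` insert x V \<subseteq> carrier M"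
      "\<forall>\<phi>\<in>(\<Union>\<phi>\<in>Q. set (q \<phi>)). sat M e' \<phi>"
      using insert.prems(4)[OF fin] by (elim exE conjE) (rule that)
    have "sat M (e(x := e' x)) \<phi>" if "\<phi> \<in> Q" for \<phi>
    proof -
      have "sat M (e(x := e' x)) (Exs vs (Conj (q \<phi>)))"
        unfolding sat_Exs vs by (rule exI[of _ e']) (use e' that in auto)
      then show ?thesis using q that by metis
    qed
    then show "\<exists>c\<in>carrier M. \<forall>\<phi>\<in>Q. sat M (e(x := c)) \<phi>" using e'(2) by blast
  qed
  then obtain c where c: "c \<in> carrier M" "\<forall>\<phi>\<in>\<Delta>. sat M (e(x := c)) \<phi>" by blast
  have "\<exists>e'. (\<forall>i. i \<notin> V \<longrightarrow> e' i = (e(x := c)) i) \<and> e' ` V \<subseteq> carrier M \<and> (\<forall>\<phi>\<in>\<Gamma>. sat M e' \<phi>)"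
  proof (rule insert.IH[of "insert x W"])
    show "finite (insert x W)" using insert.prems by simp
    show "e(x := c) ` insert x W \<subseteq> carrier M" using insert.prems(2) c(1) by auto
    show "wf_fm L \<phi> \<and> FV \<phi> \<subseteq> V \<union> insert x W" if "\<phi> \<in> \<Gamma>" for \<phi>
      using insert.prems(3)[OF that] by auto
    fix Q assume Q: "finite Q" "Q \<subseteq> \<Gamma>"
    then obtain qs where qs: "set qs = Q" using finite_list by blast
    then have "Exs vs (Conj qs) \<in> \<Delta>" using Q by (auto simp: \<Delta>_def)
    then have "sat M (e(x := c)) (Exs vs (Conj qs))" using c(2) by blast
    then show "\<exists>e'. (\<forall>i. i \<notin> V \<longrightarrow> e' i = (e(x := c)) i) \<and> e' ` V \<subseteq> carrier M \<and> (\<forall>\<phi>\<in>Q. sat M e' \<phi>)"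
      unfolding sat_Exs vs Conj_simps qs .
  qed
  then obtain e' where e': "\<forall>i. i \<notin> V \<longrightarrow> e' i = (e(x := c)) i" "e' ` V \<subseteq> carrier M"
    "\<forall>\<phi>\<in>\<Gamma>. sat M e' \<phi>" by blast
  have "e' x = c" using e'(1) insert.hyps(2) by simp
  then show ?case using e' c(1) by (intro exI[of _ e']) auto
qed

lemma saturated_reduct:
  fixes M :: "('f, 'r option, 'u) fo_struct"
  assumes "aleph1_saturated (colored_language L) M"
  shows "aleph1_saturated L (reduct M)"
  unfolding aleph1_saturated_def
proof (intro allI impI, elim conjE)
  fix C and P :: "(('f, 'r) fm \<times> (nat \<Rightarrow> 'u)) set"
  assume C: "countable C" "C \<subseteq> carrier (reduct M)"
    and P: "\<forall>(\<phi>, e)\<in>P. wf_fm L \<phi> \<and> e ` (FV \<phi> - {0}) \<subseteq> C"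
    and fin: "\<forall>Q. finite Q \<and> Q \<subseteq> P \<longrightarrow> (\<exists>c\<in>carrier (reduct M). \<forall>(\<phi>, e)\<in>Q. sat (reduct M) (e(0 := c)) \<phi>)"
  let ?l = "\<lambda>(\<phi>, e). (lift_fm \<phi>, e)"
  have "\<exists>c\<in>carrier M. \<forall>(\<phi>, e)\<in>?l ` P. sat M (e(0 := c)) \<phi>"
  proof (rule assms[unfolded aleph1_saturated_def, rule_format, of C], intro conjI allI impI)
    show "countable C" "C \<subseteq> carrier M" using C by simp_all
    show "\<forall>(\<phi>, e)\<in>?l ` P. wf_fm (colored_language L) \<phi> \<and> e ` (FV \<phi> - {0}) \<subseteq> C"
    proof
      fix p assume "p \<in> ?l ` P"
      then obtain \<phi> e where p: "(\<phi>, e) \<in> P" "p = (lift_fm \<phi>, e)" by auto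
      then show "case p of (\<phi>, e) \<Rightarrow> wf_fm (colored_language L) \<phi> \<and> e ` (FV \<phi> - {0}) \<subseteq> C"
        using bspec[OF P p(1)] by (simp only: prod.case wf_lift_fm FV_lift_fm)
    qed
    fix Q assume "finite Q \<and> Q \<subseteq> ?l ` P"
    then obtain Q' where Q': "Q' \<subseteq> P" "finite Q'" "Q = ?l ` Q'"
      using finite_subset_image[of Q ?l P] by blast
    then obtain c where "c \<in> carrier M" "\<forall>(\<phi>, e)\<in>Q'. sat (reduct M) (e(0 := c)) \<phi>"
      using fin[rule_format, of Q'] by auto
    then show "\<exists>c\<in>carrier M. \<forall>(\<phi>, e)\<in>Q. sat M (e(0 := c)) \<phi>"
      unfolding Q'(3) by (intro bexI[of _ c]) (auto simp: sat_lift_fm)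
  qed
  then show "\<exists>c\<in>carrier (reduct M). \<forall>(\<phi>, e)\<in>P. sat (reduct M) (e(0 := c)) \<phi>"
    by (simp add: ball_simps case_prod_beta sat_lift_fm)
qed

context geometric_base
begin

text \<open>The type to be realized consists of \<open>\<zeta>\<close> and the negations of all
  algebraic formulas over \<open>F\<close>; a finite part of it excludes only finitely many of the
  infinitely many solutions of \<open>\<zeta>\<close>.\<close>

lemma transcendental_solution:
  fixes N :: "('f, 'r, 'u) fo_struct"
  assumes N: "saturated_model L T N" and F: "finite F" "F \<subseteq> carrier N"
    and \<zeta>: "wf_fm L \<zeta>" "e ` (FV \<zeta> - {x}) \<subseteq> carrier N"
    and inf: "infinite {c \<in> carrier N. sat N (e(x := c)) \<zeta>}"
  shows "\<exists>c\<in>carrier N. c \<notin> acl L N F \<and> sat N (e(x := c)) \<zeta>"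
proof -
  define \<rho> where "\<rho> = (\<lambda>v. if v = x then 0 else Suc v)"
  obtain \<psi> where \<psi>: "wf_fm L \<psi>" "FV \<psi> \<subseteq> \<rho> ` FV \<zeta>"
    "\<forall>(M :: ('f, 'r, 'u) fo_struct) e. sat M e \<psi> \<longleftrightarrow> sat M (e \<circ> \<rho>) \<zeta>"
    using rename_fm_exists[OF \<zeta>(1)] by blast
  define e' where "e' = (\<lambda>v. e (v - 1))"
  have s: "sat N (e'(0 := c)) \<psi> \<longleftrightarrow> sat N (e(x := c)) \<zeta>" for c
    unfolding \<psi>(3)[rule_format] by (rule sat_cong) (simp add: e'_def \<rho>_def)
  define A where "A = {(Neg \<phi>, f) | \<phi> f. wf_fm L \<phi> \<and> f ` (FV \<phi> - {0}) \<subseteq> F \<and>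
    finite {c \<in> carrier N. sat N (f(0 := c)) \<phi>}}"
  define C where "C = F \<union> e ` (FV \<zeta> - {x})"
  have "aleph1_saturated L N" using N by (simp add: saturated_model_def)
  then have "\<exists>c\<in>carrier N. \<forall>(\<phi>, e)\<in>insert (\<psi>, e') A. sat N (e(0 := c)) \<phi>"
  proof (rule aleph1_saturated_def[THEN iffD1, rule_format, of _ _ C], intro conjI allI impI)
    show "countable C" "C \<subseteq> carrier N" using F \<zeta> by (auto simp: C_def countable_finite)
    have "FV \<psi> - {0} \<subseteq> Suc ` (FV \<zeta> - {x})" using \<psi>(2) by (auto simp: \<rho>_def split: if_splits)
    then have "e' ` (FV \<psi> - {0}) \<subseteq> e' ` Suc ` (FV \<zeta> - {x})" by (rule image_mono)
    also have "\<dots> = e ` (FV \<zeta> - {x})" by (simp add: e'_def image_image)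
    finally have "e' ` (FV \<psi> - {0}) \<subseteq> C" by (auto simp: C_def)
    moreover have "wf_fm L \<phi> \<and> f ` (FV \<phi> - {0}) \<subseteq> C" if "(\<phi>, f) \<in> A" for \<phi> f
      using that by (auto simp: A_def C_def)
    ultimately have "case p of (\<phi>, e) \<Rightarrow> wf_fm L \<phi> \<and> e ` (FV \<phi> - {0}) \<subseteq> C"
      if "p \<in> insert (\<psi>, e') A" for p
      using that \<psi>(1) by (cases p) (metis (no_types, lifting) Pair_inject insert_iff prod.case)
    then show "\<forall>(\<phi>, e)\<in>insert (\<psi>, e') A. wf_fm L \<phi> \<and> e ` (FV \<phi> - {0}) \<subseteq> C" by blast
    fix Q assume Q: "finite Q \<and> Q \<subseteq> insert (\<psi>, e') A"
    have fin: "finite (\<Union>(\<phi>, f)\<in>Q \<inter> A. {c \<in> carrier N. \<not> sat N (f(0 := c)) \<phi>})"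
    proof (rule finite_UN_I)
      show "finite (Q \<inter> A)" using Q by simp
      fix p assume "p \<in> Q \<inter> A"
      then obtain \<phi> f where p: "p = (Neg \<phi>, f)" "finite {c \<in> carrier N. sat N (f(0 := c)) \<phi>}"
        by (auto simp: A_def)
      then show "finite (case p of (\<phi>, f) \<Rightarrow> {c \<in> carrier N. \<not> sat N (f(0 := c)) \<phi>})" by simp
    qed
    then obtain c where c: "c \<in> {c \<in> carrier N. sat N (e(x := c)) \<zeta>}"
      "c \<notin> (\<Union>(\<phi>, f)\<in>Q \<inter> A. {c \<in> carrier N. \<not> sat N (f(0 := c)) \<phi>})"
      using finite_subset[OF _ fin] inf by blast
    have "sat N (f(0 := c)) \<phi>" if "(\<phi>, f) \<in> Q" for \<phi> f
    proof (cases "(\<phi>, f) \<in> A")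
      case False
      then have "\<phi> = \<psi>" "f = e'" using that Q by auto
      then show ?thesis using s c(1) by simp
    qed (use c that in auto)
    then show "\<exists>c\<in>carrier N. \<forall>(\<phi>, e)\<in>Q. sat N (e(0 := c)) \<phi>" using c(1) by auto
  qed
  then obtain c where c: "c \<in> carrier N" "\<forall>(\<phi>, e)\<in>insert (\<psi>, e') A. sat N (e(0 := c)) \<phi>" by blast
  then have "sat N (e(x := c)) \<zeta>" using s by simp
  moreover have "c \<notin> acl L N F"
  proof
    assume "c \<in> acl L N F"
    then obtain \<phi> f where "wf_fm L \<phi>" "f ` (FV \<phi> - {0}) \<subseteq> F" "sat N (f(0 := c)) \<phi>"
      "finite {c \<in> carrier N. sat N (f(0 := c)) \<phi>}"
      by (auto simp: acl_def)
    moreover from this have "(Neg \<phi>, f) \<in> A" by (auto simp: A_def)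
    ultimately show False using c(2) by auto
  qed
  ultimately show ?thesis using c(1) by blast
qed

lemma transcendental_element:
  fixes N :: "('f, 'r, 'u) fo_struct"
  assumes N: "saturated_model L T N" and F: "finite F" "F \<subseteq> carrier N"
  shows "\<exists>c\<in>carrier N. c \<notin> acl L N F"
proof -
  have "infinite (carrier N)"
    using no_finite N by (simp add: no_finite_models_def saturated_model_def)
  then show ?thesis
    using transcendental_solution[OF N F, of "Eq (Var 0) (Var 0)" _ 0] by auto
qed

text \<open>Up to dimension \<open>dm N P + K\<close> new points are chosen transcendental; beyond it, they are
  chosen by indecomposability outside the closures of all sets of smaller dimension.\<close>

lemma generic_set:
  fixes N :: "('f, 'r, 'u) fo_struct"
  assumes N: "saturated_model L T N" and P: "finite P" "P \<subseteq> carrier N" and K: "2 \<le> K"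
  shows "\<exists>E. finite E \<and> E \<subseteq> carrier N \<and> E \<inter> P = {} \<and> card E = m \<and>
    (\<forall>S Q. S \<subseteq> P \<longrightarrow> Q \<subseteq> E \<longrightarrow> dm N (S \<union> Q) = min (dm N S + card Q) (dm N P + K))"
proof (induction m)
  case 0
  have "models L T N" using N by (simp add: saturated_model_def)
  then interpret pregeometry "acl L N" "carrier N" by (rule pregeometry_acl)
  have "rk S \<le> rk P" if "S \<subseteq> P" for S using rk_mono that P by blast
  then have "rk S = min (rk S) (rk P + K)" if "S \<subseteq> P" for S
    using that by (simp add: min_absorb1 trans_le_add1)
  then show ?case by (intro exI[of _ "{}"]) auto
next
  case (Suc m)
  then obtain E where E: "finite E" "E \<subseteq> carrier N" "E \<inter> P = {}" "card E = m"
    "\<And>S Q. S \<subseteq> P \<Longrightarrow> Q \<subseteq> E \<Longrightarrow> dm N (S \<union> Q) = min (dm N S + card Q) (dm N P + K)" by blast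
  have M: "models L T N" using N by (simp add: saturated_model_def)
  interpret pregeometry "acl L N" "carrier N" by (rule pregeometry_acl[OF M])
  \<comment> \<open>The cap on the rank: below it a further point always adds 1, and no set of the
    configuration exceeds it.\<close>
  define t where "t = rk P + K"
  have PE: "finite (P \<union> E)" "P \<union> E \<subseteq> carrier N" using P E by auto
  have rPE: "rk (P \<union> E) \<le> t" using E(5)[of P E] by (simp add: t_def)
  have "\<exists>e\<in>carrier N. (\<forall>S\<subseteq>P \<union> E. rk S < t \<longrightarrow> e \<notin> acl L N S) \<and> rk (insert e (P \<union> E)) \<le> t"
  proof (cases "rk (P \<union> E) < t")
    case True
    obtain c where c: "c \<in> carrier N" "c \<notin> acl L N (P \<union> E)"
      using transcendental_element[OF N PE] by blast
    moreover have "c \<notin> acl L N S" if "S \<subseteq> P \<union> E" for S using cl_mono[OF that] c by blast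
    moreover have "rk (insert c (P \<union> E)) \<le> t" using rk_insert[OF PE c(1)] True by simp
    ultimately show ?thesis by blast
  next
    case False
    then have r: "rk (P \<union> E) = t" using rPE by simp
    \<comment> \<open>Finitely many closures, since \<open>P \<union> E\<close> is finite. The empty
      set has rank 0, less than \<open>t\<close>, so the family is nonempty and indecomposability
      yields a point of \<open>Z\<close> outside all its members.\<close>
    define F where "F = acl L N ` {S. S \<subseteq> P \<union> E \<and> rk S < t}"
    define Z where "Z = acl L N (P \<union> E)"
    have Z: "Z \<subseteq> carrier N" "acl L N Z = Z" "finite_dimensional (acl L N) Z" "rk Z = t"
      using cl_carrier cl_idem[OF PE(2)] finite_dimensional_cl[OF PE] rk_cl[OF PE] r
      by (simp_all add: Z_def)
    have "finite F" using PE(1) by (simp add: F_def)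
    moreover have "{} \<in> {S. S \<subseteq> P \<union> E \<and> rk S < t}" using K by (simp add: t_def)
    then have "F \<noteq> {}" unfolding F_def by blast
    moreover have "\<forall>Y\<in>F. rk Y < rk Z"
    proof
      fix Y assume "Y \<in> F"
      then obtain S where S: "S \<subseteq> P \<union> E" "rk S < t" "Y = acl L N S" unfolding F_def by blast
      have "finite S" "S \<subseteq> carrier N" using finite_subset[OF S(1) PE(1)] S(1) PE(2) by auto
      then show "rk Y < rk Z" using S rk_cl Z(4) by simp
    qed
    ultimately have "Z \<noteq> \<Union>F"
      using indecomp M Z unfolding indecomposable_def by blast
    moreover have "\<Union>F \<subseteq> Z" using cl_mono by (auto simp: F_def Z_def)
    ultimately obtain e where e: "e \<in> Z" "e \<notin> \<Union>F" by blast
    have "e \<notin> acl L N S" if "S \<subseteq> P \<union> E" "rk S < t" for S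
      using e(2) that unfolding F_def by blast
    moreover have "e \<in> carrier N" using e Z by blast
    moreover have "rk (insert e (P \<union> E)) \<le> t"
      using rk_insert[OF PE \<open>e \<in> carrier N\<close>] e(1) r by (simp add: Z_def)
    ultimately show ?thesis by blast
  qed
  then obtain e where e: "e \<in> carrier N" "\<And>S. S \<subseteq> P \<union> E \<Longrightarrow> rk S < t \<Longrightarrow> e \<notin> acl L N S"
    "rk (insert e (P \<union> E)) \<le> t" by blast
  \<comment> \<open>A point already present lies in the closure of its own singleton, which has rank
    at most 1, less than \<open>t\<close> because of \<open>2 \<le> K\<close>.\<close>
  have ePE: "e \<notin> P \<union> E"
  proof
    assume "e \<in> P \<union> E"
    moreover have "e \<in> acl L N {e}" using cl_ext[of "{e}"] e(1) by simp
    moreover have "rk {e} < t" using rk_le_card[of "{e}"] e(1) K by (simp add: t_def)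
    ultimately show False using e(2)[of "{e}"] by simp
  qed
  have "rk (S \<union> Q) = min (rk S + card Q) t" if SQ: "S \<subseteq> P" "Q \<subseteq> insert e E" for S Q
  proof (cases "e \<in> Q")
    case False
    then show ?thesis using E(5)[of S Q] SQ by (auto simp: t_def)
  next
    case True
    define Q' where "Q' = Q - {e}"
    have Q: "Q = insert e Q'" "e \<notin> Q'" "Q' \<subseteq> E" using True SQ by (auto simp: Q'_def)
    have sub: "S \<union> Q' \<subseteq> P \<union> E" using SQ Q by blast
    have fin: "finite (S \<union> Q')" "S \<union> Q' \<subseteq> carrier N" "finite Q'"
      using finite_subset[OF sub PE(1)] sub PE(2) by auto
    have cQ: "card Q = Suc (card Q')" using Q fin by simp
    have IH: "rk (S \<union> Q') = min (rk S + card Q') t" using E(5)[OF SQ(1) Q(3)] by (simp add: t_def)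
    have eq: "S \<union> Q = insert e (S \<union> Q')" using Q by blast
    show ?thesis
    proof (cases "rk (S \<union> Q') < t")
      case True
      then have "rk (S \<union> Q) = Suc (rk (S \<union> Q'))"
        unfolding eq using rk_insert[OF fin(1,2) e(1)] e(2)[OF sub] by simp
      then show ?thesis using IH True cQ by simp
    next
      case False
      have "rk (S \<union> Q) \<le> rk (insert e (P \<union> E))"
        by (rule rk_mono) (use eq sub PE e(1) in auto)
      moreover have "rk (S \<union> Q') \<le> rk (S \<union> Q)"
        by (rule rk_mono) (use eq fin e(1) in auto)
      ultimately show ?thesis using e(3) IH False cQ by simp
    qed
  qed
  then show ?case
    using E ePE e(1) by (intro exI[of _ "insert e E"]) (auto simp: t_def)
qed

end

section \<open>Strong formulas and definability of dimension\<close>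

text \<open>Reads the dimension off from the positions that are new over the earlier ones, so that
  it can be tested by quantifying over one variable at a time. Repeated entries are simply not
  counted.\<close>

lemma (in pregeometry) pdim_count:
  fixes e :: "nat \<Rightarrow> 'u"
  assumes "e ` {..<n} \<subseteq> C" "X \<subseteq> C"
  shows "pdim cl (e ` {..<n}) X = card {i \<in> {..<n}. e i \<notin> cl (X \<union> e ` {..<i})}"
  using assms(1)
proof (induction n)
  case (Suc n)
  let ?I = "\<lambda>n. {i \<in> {..<n}. e i \<notin> cl (X \<union> e ` {..<i})}"
  have "?I (Suc n) = (if e n \<in> cl (X \<union> e ` {..<n}) then ?I n else insert n (?I n))"
    by (auto simp: less_Suc_eq)
  moreover have "n \<notin> ?I n" "finite (?I n)" by auto
  ultimately have "card (?I (Suc n)) = card (?I n) + (if e n \<in> cl (X \<union> e ` {..<n}) then 0 else 1)"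
    by simp
  moreover have "e ` {..<Suc n} = insert (e n) (e ` {..<n})" by (simp add: lessThan_Suc)
  moreover have "e ` {..<n} \<subseteq> C" "e n \<in> C" using Suc.prems by auto
  ultimately show ?case
    using Suc.IH pdim_insert[of "e ` {..<n}" X "e n"] assms(2) by simp
qed (use assms(2) in simp)

context geometric_base
begin

text \<open>The formula witnessing algebraicity is strengthened by the statement that it has only
  finitely many solutions, expressed by elimination of infinity. It then forces the same dependence
  in every model of \<open>T\<close>.\<close>

lemma algebraic_formula:
  fixes N0 :: "('f, 'r, 'u) fo_struct"
  assumes N0: "models L T N0" and J: "finite J" "e0 ` insert i J \<subseteq> carrier N0"
    and alg: "e0 i \<in> acl L N0 (e0 ` J)"
  obtains \<zeta> where "wf_fm L \<zeta>" "FV \<zeta> \<subseteq> insert i J" "sat N0 e0 \<zeta>"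
    "\<And>(N :: ('f, 'r, 'u) fo_struct) e. models L T N \<Longrightarrow> e ` insert i J \<subseteq> carrier N \<Longrightarrow> sat N e \<zeta> \<Longrightarrow>
       e i \<in> acl L N (e ` J)"
proof -
  obtain \<phi> f where \<phi>: "wf_fm L \<phi>" "f ` (FV \<phi> - {0}) \<subseteq> e0 ` J" "sat N0 (f(0 := e0 i)) \<phi>"
    "finite {c \<in> carrier N0. sat N0 (f(0 := c)) \<phi>}"
    using alg by (auto simp: acl_def)
  have "\<forall>v\<in>FV \<phi> - {0}. \<exists>j\<in>J. e0 j = f v" using \<phi>(2) by force
  then obtain g where g: "\<And>v. v \<in> FV \<phi> - {0} \<Longrightarrow> g v \<in> J \<and> e0 (g v) = f v" by metis
  \<comment> \<open>\<open>i\<close> may belong to \<open>J\<close> and thus also occur as a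
    parameter. The fresh variable \<open>z\<close> keeps the point apart from the parameters and is
    identified with \<open>i\<close> only in \<open>\<zeta>\<close>.\<close>
  obtain z where z: "z \<notin> insert i J"
    using ex_new_if_finite[of "insert i J"] J(1) infinite_UNIV_nat by blast
  define \<rho> where "\<rho> = (\<lambda>v. if v = 0 then z else g v)"
  obtain \<beta> where \<beta>: "wf_fm L \<beta>" "FV \<beta> \<subseteq> \<rho> ` FV \<phi>"
    "\<forall>(M :: ('f, 'r, 'u) fo_struct) e. sat M e \<beta> \<longleftrightarrow> sat M (e \<circ> \<rho>) \<phi>"
    using rename_fm_exists[OF \<phi>(1)] by blast
  have FV\<beta>: "FV \<beta> - {z} \<subseteq> J"
  proof
    fix v assume v: "v \<in> FV \<beta> - {z}"
    then obtain w where w: "w \<in> FV \<phi>" "v = \<rho> w" using \<beta>(2) by blast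
    then have "w \<noteq> 0" using v by (auto simp: \<rho>_def split: if_splits)
    then show "v \<in> J" using w g by (simp add: \<rho>_def)
  qed
  obtain \<xi> where \<xi>: "wf_fm L \<xi>" "FV \<xi> \<subseteq> FV \<beta> - {z}"
    "\<And>(M :: ('f, 'r, 'u) fo_struct) e. models L T M \<Longrightarrow> e ` (FV \<beta> - {z}) \<subseteq> carrier M \<Longrightarrow>
       sat M e \<xi> \<longleftrightarrow> infinite {a \<in> carrier M. sat M (e(z := a)) \<beta>}"
    using exists_infty[OF \<beta>(1)] by blast
  define \<zeta> where "\<zeta> = And (Exi z (And \<beta> (Eq (Var z) (Var i)))) (Neg \<xi>)"
  have s: "sat N e \<zeta> \<longleftrightarrow> sat N (e(z := e i)) \<beta> \<and> finite {a \<in> carrier N. sat N (e(z := a)) \<beta>}"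
    if N: "models L T N" and e: "e ` insert i J \<subseteq> carrier N" for N :: "('f, 'r, 'u) fo_struct" and e
  proof -
    have "sat N e (Exi z (And \<beta> (Eq (Var z) (Var i)))) \<longleftrightarrow> sat N (e(z := e i)) \<beta>"
      using e z by auto
    moreover have "e ` (FV \<beta> - {z}) \<subseteq> carrier N" using FV\<beta> e by blast
    then have "sat N e \<xi> \<longleftrightarrow> infinite {a \<in> carrier N. sat N (e(z := a)) \<beta>}" by (rule \<xi>(3)[OF N])
    ultimately show ?thesis by (simp add: \<zeta>_def del: Exi_simps)
  qed
  show ?thesis
  proof (rule that[of \<zeta>])
    show "wf_fm L \<zeta>" using \<beta>(1) \<xi>(1) by (simp add: \<zeta>_def)
    show "FV \<zeta> \<subseteq> insert i J" using FV\<beta> \<xi>(2) by (auto simp: \<zeta>_def)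
    have "sat N0 (e0(z := a)) \<beta> \<longleftrightarrow> sat N0 (f(0 := a)) \<phi>" for a
      unfolding \<beta>(3)[rule_format]
    proof (rule sat_cong)
      show "(e0(z := a) \<circ> \<rho>) v = (f(0 := a)) v" if "v \<in> FV \<phi>" for v
        using g[of v] that z by (auto simp: \<rho>_def)
    qed
    then show "sat N0 e0 \<zeta>" using s[OF N0 J(2)] \<phi>(3,4) by simp
    fix N :: "('f, 'r, 'u) fo_struct" and e
    assume N: "models L T N" and e: "e ` insert i J \<subseteq> carrier N" and sat: "sat N e \<zeta>"
    note s' = s[OF N e, THEN iffD1, OF sat]
    show "e i \<in> acl L N (e ` J)"
    proof (rule acl_var[OF \<beta>(1)])
      show "e ` (FV \<beta> - {z}) \<subseteq> e ` J" using FV\<beta> by blast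
      show "e i \<in> carrier N" using e by simp
    qed (use s' in auto)
  qed
qed

text \<open>The finitely many dependences among the entries of the tuple are recorded together with
  \<open>\<theta>\<close> and distinctness. A solution may satisfy more dependences than the
  original but not fewer, so its ranks are at most those of the original. Quantifier elimination
  gives the form that \<open>strong_formula\<close> demands.\<close>

lemma dependency_formula:
  fixes N0 :: "('f, 'r, 'u) fo_struct"
  assumes N0: "models L T N0" and I: "finite I" "e0 ` I \<subseteq> carrier N0" "inj_on e0 I"
    and \<theta>: "wf_fm L \<theta>" "FV \<theta> \<subseteq> I" "sat N0 e0 \<theta>"
  obtains \<phi> where "wf_fm L \<phi>" "qfree \<phi>" "FV \<phi> \<subseteq> I" "sat N0 e0 \<phi>"
    "\<And>(N :: ('f, 'r, 'u) fo_struct) e. models L T N \<Longrightarrow> e ` I \<subseteq> carrier N \<Longrightarrow> sat N e \<phi> \<Longrightarrow>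
       sat N e \<theta> \<and> inj_on e I \<and>
       (\<forall>i\<in>I. \<forall>J\<subseteq>I. e0 i \<in> acl L N0 (e0 ` J) \<longrightarrow> e i \<in> acl L N (e ` J))"
proof -
  define S where "S = {(i, J). i \<in> I \<and> J \<subseteq> I \<and> e0 i \<in> acl L N0 (e0 ` J)}"
  have "finite S" by (rule finite_subset[of _ "I \<times> Pow I"]) (use I in \<open>auto simp: S_def\<close>)
  have "\<exists>\<zeta>. wf_fm L \<zeta> \<and> FV \<zeta> \<subseteq> I \<and> sat N0 e0 \<zeta> \<and> (\<forall>(N :: ('f, 'r, 'u) fo_struct) e.
      models L T N \<and> e ` I \<subseteq> carrier N \<and> sat N e \<zeta> \<longrightarrow> e i \<in> acl L N (e ` J))"
    if iJ: "(i, J) \<in> S" for i J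
  proof -
    have iJ': "i \<in> I" "J \<subseteq> I" "e0 i \<in> acl L N0 (e0 ` J)" using iJ by (auto simp: S_def)
    have "finite J" "e0 ` insert i J \<subseteq> carrier N0" using iJ' I finite_subset by blast+
    then obtain \<zeta> where \<zeta>: "wf_fm L \<zeta>" "FV \<zeta> \<subseteq> insert i J" "sat N0 e0 \<zeta>"
      "\<And>(N :: ('f, 'r, 'u) fo_struct) e. models L T N \<Longrightarrow> e ` insert i J \<subseteq> carrier N \<Longrightarrow> sat N e \<zeta> \<Longrightarrow>
       e i \<in> acl L N (e ` J)"
      using algebraic_formula[OF N0 _ _ iJ'(3)] by blast
    have sub: "insert i J \<subseteq> I" using iJ' by blast
    have "FV \<zeta> \<subseteq> I" using \<zeta>(2) sub by (rule subset_trans)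
    moreover have "e i \<in> acl L N (e ` J)"
      if "models L T N" "e ` I \<subseteq> carrier N" "sat N e \<zeta>" for N :: "('f, 'r, 'u) fo_struct" and e
      using \<zeta>(4)[OF that(1) _ that(3)] that(2) image_mono[OF sub, of e] by (meson subset_trans)
    ultimately show ?thesis using \<zeta>(1,3) by blast
  qed
  then have "\<forall>p\<in>S. \<exists>\<zeta>. wf_fm L \<zeta> \<and> FV \<zeta> \<subseteq> I \<and> sat N0 e0 \<zeta> \<and> (\<forall>(N :: ('f, 'r, 'u) fo_struct) e.
      models L T N \<and> e ` I \<subseteq> carrier N \<and> sat N e \<zeta> \<longrightarrow> e (fst p) \<in> acl L N (e ` snd p))"
    by (simp add: split_paired_all)
  then obtain Z where Z: "\<And>p. p \<in> S \<Longrightarrow> wf_fm L (Z p) \<and> FV (Z p) \<subseteq> I \<and> sat N0 e0 (Z p) \<and>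
      (\<forall>(N :: ('f, 'r, 'u) fo_struct) e. models L T N \<and> e ` I \<subseteq> carrier N \<and> sat N e (Z p) \<longrightarrow>
         e (fst p) \<in> acl L N (e ` snd p))"
    by metis
  define D where "D = (\<lambda>(i, j). Neg (Eq (Var i) (Var j)) :: ('f, 'r) fm) ` {(i, j) \<in> I \<times> I. i \<noteq> j}"
  define Q where "Q = insert \<theta> (Z ` S \<union> D)"
  have "finite {(i, j) \<in> I \<times> I. i \<noteq> j}"
    by (rule finite_subset[of _ "I \<times> I"]) (use I in auto)
  then have "finite Q" using \<open>finite S\<close> by (simp add: Q_def D_def)
  moreover have "Q \<subseteq> {\<phi>. wf_fm L \<phi> \<and> FV \<phi> \<subseteq> I}"
  proof
    fix q assume "q \<in> Q"
    then consider "q = \<theta>" | "q \<in> Z ` S" | "q \<in> D" by (auto simp: Q_def)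
    then show "q \<in> {\<phi>. wf_fm L \<phi> \<and> FV \<phi> \<subseteq> I}"
    proof cases
      case 2
      then obtain p where "p \<in> S" "q = Z p" by blast
      then show ?thesis using Z[of p] by simp
    qed (use \<theta> in \<open>auto simp: D_def\<close>)
  qed
  ultimately obtain \<psi> where \<psi>: "wf_fm L \<psi>" "FV \<psi> \<subseteq> I"
    "\<And>(M :: ('f, 'r, 'u) fo_struct) e. sat M e \<psi> \<longleftrightarrow> (\<forall>\<phi>\<in>Q. sat M e \<phi>)"
    using finite_conj_closed[of Q L I] by metis
  obtain \<phi> where \<phi>: "wf_fm L \<phi>" "qfree \<phi>" "FV \<phi> \<subseteq> FV \<psi>"
    "\<And>(M :: ('f, 'r, 'u) fo_struct) e. models L T M \<Longrightarrow> e ` FV \<psi> \<subseteq> carrier M \<Longrightarrow>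
       sat M e \<phi> \<longleftrightarrow> sat M e \<psi>"
    using qe_sat[OF \<psi>(1)] by blast
  have eq: "sat M e \<phi> \<longleftrightarrow> (\<forall>\<phi>\<in>Q. sat M e \<phi>)"
    if "models L T M" "e ` I \<subseteq> carrier M" for M :: "('f, 'r, 'u) fo_struct" and e
    using \<phi>(4)[OF that(1), of e] \<psi>(3) image_mono[OF \<psi>(2), of e] that(2) by (meson subset_trans)
  have Dsat: "(\<forall>\<phi>\<in>D. sat M e \<phi>) \<longleftrightarrow> inj_on e I" for M :: "('f, 'r, 'u) fo_struct" and e
    by (auto simp: D_def inj_on_def)
  show ?thesis
  proof (rule that[OF \<phi>(1,2)])
    show "FV \<phi> \<subseteq> I" using \<phi>(3) \<psi>(2) by (rule subset_trans)
    have "\<forall>\<phi>\<in>Z ` S. sat N0 e0 \<phi>" using Z by blast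
    then show "sat N0 e0 \<phi>" unfolding eq[OF N0 I(2)] Q_def ball_simps ball_Un Dsat
      using \<theta>(3) I(3) by simp
    fix N :: "('f, 'r, 'u) fo_struct" and e
    assume N: "models L T N" and e: "e ` I \<subseteq> carrier N" and sat: "sat N e \<phi>"
    from sat have s: "sat N e \<theta>" "\<forall>\<phi>\<in>Z ` S. sat N e \<phi>" "inj_on e I"
      unfolding eq[OF N e] Q_def ball_simps ball_Un Dsat by simp_all
    have "e i \<in> acl L N (e ` J)" if "i \<in> I" "J \<subseteq> I" "e0 i \<in> acl L N0 (e0 ` J)" for i J
    proof -
      have p: "(i, J) \<in> S" using that by (simp add: S_def)
      then have "sat N e (Z (i, J))" using s(2) by blast
      then show ?thesis using Z[OF p] N e by simp
    qed
    then show "sat N e \<theta> \<and> inj_on e I \<and>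
       (\<forall>i\<in>I. \<forall>J\<subseteq>I. e0 i \<in> acl L N0 (e0 ` J) \<longrightarrow> e i \<in> acl L N (e ` J))"
      using s by blast
  qed
qed

text \<open>The formula is \<open>Q\<^sub>0 x\<^sub>0 \<dots> Q\<^sub>k x\<^sub>k \<phi>\<close> where \<open>Q\<^sub>i\<close> says ``infinitely many'' for \<open>i \<in> J\<close> and is
  the existential quantifier otherwise.\<close>

lemma independent_solution_formula:
  assumes \<phi>: "wf_fm L \<phi>" "FV \<phi> \<subseteq> {..<n + m}" and "j \<le> n"
  shows "\<exists>\<zeta>. wf_fm L \<zeta> \<and> FV \<zeta> \<subseteq> {..<j} \<union> {n..<n + m} \<and>
    (\<forall>(N :: ('f, 'r, 'u) fo_struct) e. saturated_model L T N \<and>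
       e ` ({..<j} \<union> {n..<n + m}) \<subseteq> carrier N \<longrightarrow>
       (sat N e \<zeta> \<longleftrightarrow> (\<exists>e'. (\<forall>i. i \<notin> {j..<n} \<longrightarrow> e' i = e i) \<and> e' ` {j..<n} \<subseteq> carrier N \<and>
          sat N e' \<phi> \<and> (\<forall>i\<in>J. j \<le> i \<longrightarrow> i < n \<longrightarrow> e' i \<notin> acl L N (e' ` ({..<i} \<union> {n..<n + m}))))))"
  using \<open>j \<le> n\<close>
proof (induction rule: inc_induct)
  case base
  have "(\<exists>e'. (\<forall>i. i \<notin> {n..<n} \<longrightarrow> e' i = e i) \<and> e' ` {n..<n} \<subseteq> carrier N \<and> sat N e' \<phi> \<and>
      (\<forall>i\<in>J. n \<le> i \<longrightarrow> i < n \<longrightarrow> e' i \<notin> acl L N (e' ` ({..<i} \<union> {n..<n + m})))) \<longleftrightarrow> sat N e \<phi>"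
    for N :: "('f, 'r, 'u) fo_struct" and e
  proof -
    have "(\<forall>i. i \<notin> {n..<n} \<longrightarrow> e' i = e i) \<longleftrightarrow> e' = e" for e' by (auto simp: fun_eq_iff)
    then show ?thesis by (simp only:) auto
  qed
  moreover have "FV \<phi> \<subseteq> {..<n} \<union> {n..<n + m}" using \<phi>(2) by auto
  ultimately show ?case using \<phi>(1) by (intro exI[of _ \<phi>] conjI allI impI) simp_all
next
  case (step j)
  let ?P = "{n..<n + m}"
  obtain \<zeta>' where \<zeta>': "wf_fm L \<zeta>'" "FV \<zeta>' \<subseteq> {..<Suc j} \<union> ?P"
    and \<zeta>'3: "\<forall>(N :: ('f, 'r, 'u) fo_struct) e. saturated_model L T N \<and>
       e ` ({..<Suc j} \<union> ?P) \<subseteq> carrier N \<longrightarrow>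
       (sat N e \<zeta>' \<longleftrightarrow> (\<exists>e'. (\<forall>i. i \<notin> {Suc j..<n} \<longrightarrow> e' i = e i) \<and> e' ` {Suc j..<n} \<subseteq> carrier N \<and>
          sat N e' \<phi> \<and> (\<forall>i\<in>J. Suc j \<le> i \<longrightarrow> i < n \<longrightarrow> e' i \<notin> acl L N (e' ` ({..<i} \<union> ?P)))))"
    using step.IH by (elim exE conjE) (rule that)
  have FV\<zeta>': "FV \<zeta>' - {j} \<subseteq> {..<j} \<union> ?P" using \<zeta>'(2) by (auto simp: less_Suc_eq)
  have "\<exists>\<zeta>. wf_fm L \<zeta> \<and> FV \<zeta> \<subseteq> {..<j} \<union> ?P \<and> (\<forall>(N :: ('f, 'r, 'u) fo_struct) e.
      saturated_model L T N \<and> e ` ({..<j} \<union> ?P) \<subseteq> carrier N \<longrightarrow>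
      (sat N e \<zeta> \<longleftrightarrow> (\<exists>c\<in>carrier N. (j \<in> J \<longrightarrow> c \<notin> acl L N (e ` ({..<j} \<union> ?P))) \<and> sat N (e(j := c)) \<zeta>')))"
  proof (cases "j \<in> J")
    case False
    then show ?thesis
      by (intro exI[of _ "Exi j \<zeta>'"] conjI) (use \<zeta>'(1) FV\<zeta>' in simp_all)
  next
    case True
    obtain \<xi> where \<xi>: "wf_fm L \<xi>" "FV \<xi> \<subseteq> FV \<zeta>' - {j}"
      "\<And>(M :: ('f, 'r, 'u) fo_struct) e. models L T M \<Longrightarrow> e ` (FV \<zeta>' - {j}) \<subseteq> carrier M \<Longrightarrow>
         sat M e \<xi> \<longleftrightarrow> infinite {a \<in> carrier M. sat M (e(j := a)) \<zeta>'}"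
      using exists_infty[OF \<zeta>'(1)] by blast
    \<comment> \<open>By saturation an infinite solution set contains a point outside the closure of
      the parameters; conversely, such a point cannot belong to a finite solution set.\<close>
    have equiv: "sat N e \<xi> \<longleftrightarrow> (\<exists>c\<in>carrier N. c \<notin> acl L N (e ` ({..<j} \<union> ?P)) \<and> sat N (e(j := c)) \<zeta>')"
      if N: "saturated_model L T N" and e: "e ` ({..<j} \<union> ?P) \<subseteq> carrier N"
      for N :: "('f, 'r, 'u) fo_struct" and e
    proof -
      have par: "e ` (FV \<zeta>' - {j}) \<subseteq> e ` ({..<j} \<union> ?P)" using FV\<zeta>' by (rule image_mono)
      then have par': "e ` (FV \<zeta>' - {j}) \<subseteq> carrier N" using e by (rule subset_trans)
      have "models L T N" using N by (simp add: saturated_model_def)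
      then have "sat N e \<xi> \<longleftrightarrow> infinite {a \<in> carrier N. sat N (e(j := a)) \<zeta>'}"
        using \<xi>(3) par' by blast
      also have "\<dots> \<longleftrightarrow> (\<exists>c\<in>carrier N. c \<notin> acl L N (e ` ({..<j} \<union> ?P)) \<and> sat N (e(j := c)) \<zeta>')"
      proof
        assume inf: "infinite {a \<in> carrier N. sat N (e(j := a)) \<zeta>'}"
        have "finite (e ` ({..<j} \<union> ?P))" by simp
        from transcendental_solution[OF N this e \<zeta>'(1) par' inf]
        show "\<exists>c\<in>carrier N. c \<notin> acl L N (e ` ({..<j} \<union> ?P)) \<and> sat N (e(j := c)) \<zeta>'" .
      next
        assume "\<exists>c\<in>carrier N. c \<notin> acl L N (e ` ({..<j} \<union> ?P)) \<and> sat N (e(j := c)) \<zeta>'"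
        then obtain c where c: "c \<in> carrier N" "c \<notin> acl L N (e ` ({..<j} \<union> ?P))"
          "sat N (e(j := c)) \<zeta>'" by blast
        show "infinite {a \<in> carrier N. sat N (e(j := a)) \<zeta>'}"
          using acl_var[OF \<zeta>'(1) par c(1,3)] c(2) by blast
      qed
      finally show ?thesis .
    qed
    show ?thesis
    proof (intro exI[of _ \<xi>] conjI allI impI; (elim conjE)?)
      show "wf_fm L \<xi>" by fact
      show "FV \<xi> \<subseteq> {..<j} \<union> ?P" using \<xi>(2) FV\<zeta>' by (rule subset_trans)
    qed (simp only: True simp_thms, rule equiv)
  qed
  then obtain \<zeta> where \<zeta>: "wf_fm L \<zeta>" "FV \<zeta> \<subseteq> {..<j} \<union> ?P"
    and \<zeta>3: "\<forall>(N :: ('f, 'r, 'u) fo_struct) e. saturated_model L T N \<and> e ` ({..<j} \<union> ?P) \<subseteq> carrier N \<longrightarrow>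
      (sat N e \<zeta> \<longleftrightarrow> (\<exists>c\<in>carrier N. (j \<in> J \<longrightarrow> c \<notin> acl L N (e ` ({..<j} \<union> ?P))) \<and> sat N (e(j := c)) \<zeta>'))"
    by (elim exE conjE) (rule that)
  have "sat N e \<zeta> \<longleftrightarrow> (\<exists>e'. (\<forall>i. i \<notin> {j..<n} \<longrightarrow> e' i = e i) \<and> e' ` {j..<n} \<subseteq> carrier N \<and>
          sat N e' \<phi> \<and> (\<forall>i\<in>J. j \<le> i \<longrightarrow> i < n \<longrightarrow> e' i \<notin> acl L N (e' ` ({..<i} \<union> ?P))))"
    (is "_ \<longleftrightarrow> (\<exists>e'. ?R e')")
    if N: "saturated_model L T N" and e: "e ` ({..<j} \<union> ?P) \<subseteq> carrier N"
    for N :: "('f, 'r, 'u) fo_struct" and e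
  proof
    assume "sat N e \<zeta>"
    then obtain c where c: "c \<in> carrier N" "j \<in> J \<longrightarrow> c \<notin> acl L N (e ` ({..<j} \<union> ?P))"
      "sat N (e(j := c)) \<zeta>'"
      using \<zeta>3[THEN spec, THEN spec, THEN mp, OF conjI[OF N e]] by blast
    have "(e(j := c)) ` ({..<Suc j} \<union> ?P) \<subseteq> carrier N" using e c(1) by (auto simp: less_Suc_eq)
    from \<zeta>'3[THEN spec, THEN spec, THEN mp, OF conjI[OF N this]] c(3) obtain e' where e': "\<forall>i. i \<notin> {Suc j..<n} \<longrightarrow> e' i = (e(j := c)) i"
      "e' ` {Suc j..<n} \<subseteq> carrier N" "sat N e' \<phi>"
      "\<forall>i\<in>J. Suc j \<le> i \<longrightarrow> i < n \<longrightarrow> e' i \<notin> acl L N (e' ` ({..<i} \<union> ?P))" by blast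
    have "e' j = c" using e'(1) by simp
    have "e' ` ({..<j} \<union> ?P) = e ` ({..<j} \<union> ?P)"
      by (rule image_cong) (use e'(1) step.hyps in auto)
    then have "e' i \<notin> acl L N (e' ` ({..<i} \<union> ?P))" if "i \<in> J" "j \<le> i" "i < n" for i
      using e'(4) c(2) \<open>e' j = c\<close> that by (cases "i = j") auto
    moreover have "e' i \<in> carrier N" if "i \<in> {j..<n}" for i
      using that e'(2) c(1) \<open>e' j = c\<close> by (cases "i = j") auto
    moreover have "e' i = e i" if "i \<notin> {j..<n}" for i
      using that e'(1) step.hyps by (cases "i = j") auto
    ultimately have "?R e'" using e'(3) by auto
    then show "\<exists>e'. ?R e'" by (rule exI[of _ e'])
  next
    assume "\<exists>e'. ?R e'"
    then obtain e' where e': "\<forall>i. i \<notin> {j..<n} \<longrightarrow> e' i = e i" "e' ` {j..<n} \<subseteq> carrier N"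
      "sat N e' \<phi>" "\<forall>i\<in>J. j \<le> i \<longrightarrow> i < n \<longrightarrow> e' i \<notin> acl L N (e' ` ({..<i} \<union> ?P))" by blast
    have c: "e' j \<in> carrier N" using e'(2) step.hyps by auto
    have "e' ` ({..<j} \<union> ?P) = e ` ({..<j} \<union> ?P)"
      by (rule image_cong) (use e'(1) step.hyps in auto)
    then have "j \<in> J \<longrightarrow> e' j \<notin> acl L N (e ` ({..<j} \<union> ?P))" using e'(4) step.hyps by auto
    moreover have sub: "(e(j := e' j)) ` ({..<Suc j} \<union> ?P) \<subseteq> carrier N"
      using e c by (auto simp: less_Suc_eq)
    have "sat N (e(j := e' j)) \<zeta>'"
      unfolding \<zeta>'3[THEN spec, THEN spec, THEN mp, OF conjI[OF N sub]]
    proof (intro exI[of _ e'] conjI)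
      show "\<forall>i. i \<notin> {Suc j..<n} \<longrightarrow> e' i = (e(j := e' j)) i" using e'(1) by auto
      show "e' ` {Suc j..<n} \<subseteq> carrier N" using e'(2) by auto
      show "sat N e' \<phi>" by fact
      show "\<forall>i\<in>J. Suc j \<le> i \<longrightarrow> i < n \<longrightarrow> e' i \<notin> acl L N (e' ` ({..<i} \<union> ?P))" using e'(4) by auto
    qed
    ultimately show "sat N e \<zeta>" using \<zeta>3[THEN spec, THEN spec, THEN mp, OF conjI[OF N e]] c by blast
  qed
  note equiv = this
  show ?case
    by (intro exI[of _ \<zeta>] conjI allI impI, rule \<zeta>(1), rule \<zeta>(2), elim conjE, rule equiv, assumption+)
qed

end

lemma nth_append_images:
  fixes d a :: "'a list"
  assumes "length d = n" "length a = m"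
  shows "(!) (d @ a) ` {..<n} = set d" "(!) (d @ a) ` {n..<n + m} = set a"
    "(!) (d @ a) ` {..<n + m} = set (d @ a)" "I \<subseteq> {..<n} \<Longrightarrow> (!) (d @ a) ` I = (!) d ` I"
proof -
  show 1: "(!) (d @ a) ` I = (!) d ` I" if "I \<subseteq> {..<n}" for I
    by (rule image_cong) (use that assms in \<open>auto simp: nth_append\<close>)
  show "(!) (d @ a) ` {..<n} = set d"
    unfolding 1[OF order_refl] using assms by (auto simp: set_conv_nth)
  have "(!) (d @ a) ` {n..<n + m} = (!) (d @ a) ` (\<lambda>i. i + n) ` {..<m}"
    by (simp add: lessThan_atLeast0 add.commute)
  also have "\<dots> = (!) a ` {..<m}"
    unfolding image_image by (rule image_cong) (use assms in \<open>auto simp: nth_append\<close>)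
  also have "\<dots> = set a" using assms by (auto simp: set_conv_nth)
  finally show "(!) (d @ a) ` {n..<n + m} = set a" .
  have "(!) xs ` {..<length xs} = set xs" for xs :: "'a list" by (auto simp: set_conv_nth)
  from this[of "d @ a"] show "(!) (d @ a) ` {..<n + m} = set (d @ a)" using assms by simp
qed

context colored_base
begin

text \<open>Every dependence of the original tuple carries over to the solutions of
  \<open>\<phi>\<close>, so no part of a solution has larger dimension over another part than in the
  original; this gives strongness. It also bounds the dimension of solutions by that of
  \<open>d\<close>, and a solution attaining the bound has no entry algebraic over the parameters.
  Hence one formula \<open>\<zeta>\<close>, saying that some solution has full dimension, serves for
  both definability conditions; it holds at \<open>a\<close> because \<open>d\<close> is such a
  solution.\<close>

lemma strong_formula_exists:
  fixes M' :: "('f, 'r option, 'u) fo_struct"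
  assumes sat: "saturated_model L T (reduct M')" and dist: "distinct (d @ a)"
    and car: "set (d @ a) \<subseteq> carrier M'"
    and trans: "\<And>x. x \<in> set d \<Longrightarrow> x \<notin> acl L (reduct M') (set a)"
    and \<theta>: "wf_fm L \<theta>" "FV \<theta> \<subseteq> {..<length d + length a}" "holds (reduct M') \<theta> (d @ a)"
  obtains \<phi> \<zeta> where "strong_formula L T M' d a \<phi>"
    "defines_D TYPE('u) L T \<phi> (length d) (length a) (dimK L T M' (set d) (set a)) \<zeta>"
    "defines_d TYPE('u) L T \<phi> (length d) (length a) (dimK L T M' (set d) (set a)) \<zeta>"
    "holds (reduct M') \<zeta> a"
    "\<And>(N :: ('f, 'r, 'u) fo_struct) e. models L T N \<Longrightarrow>
       e ` {..<length d + length a} \<subseteq> carrier N \<Longrightarrow> sat N e \<phi> \<Longrightarrow> sat N e \<theta>"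
proof -
  define n m where nm: "n = length d" "m = length a"
  define N0 where "N0 = reduct M'"
  define e0 where "e0 = (!) (d @ a)"
  define k where "k = dimK L T M' (set d) (set a)"
  let ?D = "{..<n}" and ?A = "{n..<n + m}" and ?I = "{..<n + m}"
  have N0: "models L T N0" "saturated_model L T N0"
    using sat by (simp_all add: saturated_model_def N0_def)
  have C0: "carrier N0 = carrier M'" by (simp add: N0_def)
  note im = nth_append_images[OF nm[symmetric], folded e0_def]
  have e0I: "e0 ` ?I \<subseteq> carrier N0" unfolding im C0 by (rule car)
  have inj0: "inj_on e0 ?I"
    using dist unfolding e0_def nm distinct_conv_nth inj_on_def by auto
  obtain \<phi> where \<phi>: "wf_fm L \<phi>" "qfree \<phi>" "FV \<phi> \<subseteq> ?I" "sat N0 e0 \<phi>"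
    and \<phi>N: "\<And>(N :: ('f, 'r, 'u) fo_struct) e. models L T N \<Longrightarrow> e ` ?I \<subseteq> carrier N \<Longrightarrow> sat N e \<phi> \<Longrightarrow>
       sat N e \<theta> \<and> inj_on e ?I \<and>
       (\<forall>i\<in>?I. \<forall>J\<subseteq>?I. e0 i \<in> acl L N0 (e0 ` J) \<longrightarrow> e i \<in> acl L N (e ` J))"
    using dependency_formula[OF N0(1) finite_lessThan e0I inj0 \<theta>(1)] \<theta>(2,3)
    unfolding holds_def nm[symmetric] N0_def e0_def by metis
  have DI: "?D \<union> ?A = ?I" by auto
  interpret N0: pregeometry "acl L N0" "carrier N0" by (rule pregeometry_acl[OF N0(1)])
  have dimK: "dimK L T M' (e0 ` X) (e0 ` Y) = pdim (acl L N0) (e0 ` X) (e0 ` Y)"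
    if "X \<subseteq> ?I" "Y \<subseteq> ?I" for X Y
    unfolding N0_def
    by (rule dimK_eq) (use N0 e0I C0 image_mono[OF that(1), of e0] image_mono[OF that(2), of e0]
        in \<open>simp_all add: N0_def\<close>)
  \<comment> \<open>A basis of the original part is pulled back to a set \<open>J\<close> of
    positions. The corresponding entries of the solution still span, though they need not be
    independent.\<close>
  have upper: "pdim (acl L N) (e ` X) (e ` Y) \<le> pdim (acl L N0) (e0 ` X) (e0 ` Y)"
    if N: "models L T N" and e: "e ` ?I \<subseteq> carrier N" and s: "sat N e \<phi>"
      and XY: "X \<subseteq> ?I" "Y \<subseteq> ?I"
    for N :: "('f, 'r, 'u) fo_struct" and e X Y
  proof -
    interpret N: pregeometry "acl L N" "carrier N" by (rule pregeometry_acl[OF N])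
    have fin: "finite X" "finite Y" using XY finite_subset by blast+
    have c0: "e0 ` X \<subseteq> carrier N0" "e0 ` Y \<subseteq> carrier N0"
      using image_mono[OF XY(1), of e0] image_mono[OF XY(2), of e0] e0I by blast+
    have c: "e ` X \<subseteq> carrier N" "e ` Y \<subseteq> carrier N"
      using image_mono[OF XY(1), of e] image_mono[OF XY(2), of e] e by blast+
    obtain B where B: "is_basis (acl L N0) B (e0 ` X) (e0 ` Y)"
      using N0.basis_exists[OF finite_imageI[OF fin(1)] c0] by blast
    then have B': "finite B" "B \<subseteq> e0 ` X" "e0 ` X \<subseteq> acl L N0 (e0 ` Y \<union> B)"
      by (auto simp: is_basis_def)
    obtain J where J: "J \<subseteq> X" "B = e0 ` J" "inj_on e0 J"
      using B'(2) subset_image_inj by metis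
    have "e ` X \<subseteq> acl L N (e ` Y \<union> e ` J)"
    proof
      fix y assume "y \<in> e ` X"
      then obtain i where i: "i \<in> X" "y = e i" by blast
      have "e0 i \<in> acl L N0 (e0 ` (Y \<union> J))" using B'(3) i(1) J(2) by (auto simp: image_Un)
      moreover have "i \<in> ?I" "Y \<union> J \<subseteq> ?I" using i XY J by blast+
      ultimately have "e i \<in> acl L N (e ` (Y \<union> J))" using \<phi>N[OF N e s] by blast
      then show "y \<in> acl L N (e ` Y \<union> e ` J)" using i by (simp add: image_Un)
    qed
    moreover have "finite J" by (rule finite_subset[OF J(1) fin(1)])
    moreover have "e ` J \<subseteq> carrier N" using image_mono[OF J(1), of e] c(1) by (rule subset_trans)
    ultimately have "pdim (acl L N) (e ` X) (e ` Y) \<le> card (e ` J)"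
      by (intro N.pdim_le_card finite_imageI fin c)
    also have "\<dots> \<le> card J" by (rule card_image_le) fact
    also have "\<dots> = card B" unfolding J(2) by (rule card_image[OF J(3), symmetric])
    also have "\<dots> = pdim (acl L N0) (e0 ` X) (e0 ` Y)"
      by (rule N0.pdim_basis[OF B c0, symmetric])
    finally show ?thesis .
  qed
  have k: "k = pdim (acl L N0) (e0 ` ?D) (e0 ` ?A)"
    unfolding k_def im(1,2)[symmetric] by (rule dimK) auto
  have le_k: "pdim (acl L N) (e ` ?D) (e ` ?A) \<le> k"
    if "models L T N" "e ` ?I \<subseteq> carrier N" "sat N e \<phi>" for N :: "('f, 'r, 'u) fo_struct" and e
    unfolding k by (rule upper[OF that]) auto
  have strong: "strong_formula L T M' d a \<phi>"
    unfolding strong_formula_def nm[symmetric]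
  proof (intro conjI allI impI)
    show "distinct (d @ a)" "wf_fm L \<phi>" "qfree \<phi>" "FV \<phi> \<subseteq> {..<n + m}" by fact+
    show "holds (reduct M') \<phi> (d @ a)" using \<phi>(4) by (simp add: holds_def N0_def e0_def)
    fix N :: "('f, 'r, 'u) fo_struct" and d' a'
    assume H: "saturated_model L T N \<and> d' \<in> tuples N n \<and> a' \<in> tuples N m \<and> holds N \<phi> (d' @ a')"
    define e where "e = (!) (d' @ a')"
    have len: "length d' = n" "length a' = m" using H by (auto simp: tuples_def)
    note im' = nth_append_images[OF len, folded e_def]
    have N: "models L T N" using H by (simp add: saturated_model_def)
    have e: "e ` ?I \<subseteq> carrier N" unfolding im' using H by (auto simp: tuples_def)
    have s: "sat N e \<phi>" using H by (simp add: holds_def e_def)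
    show "distinct (d' @ a')"
      using \<phi>N[OF N e s] len unfolding distinct_conv_nth e_def inj_on_def by auto
    show "pdim (acl L N) ((!) d' ` ({..<n} - I)) ((!) d' ` I \<union> set a')
        \<le> dimK L T M' ((!) d ` ({..<n} - I)) ((!) d ` I \<union> set a)" if I: "I \<subseteq> {..<n}" for I
    proof -
      have XY: "?D - I \<subseteq> ?I" "I \<union> ?A \<subseteq> ?I" "?D - I \<subseteq> ?D" using I by auto
      have 1: "(!) d' ` (?D - I) = e ` (?D - I)" "(!) d' ` I \<union> set a' = e ` (I \<union> ?A)"
        unfolding image_Un im'(2) im'(4)[OF I] im'(4)[OF XY(3)] by simp_all
      have 2: "(!) d ` (?D - I) = e0 ` (?D - I)" "(!) d ` I \<union> set a = e0 ` (I \<union> ?A)"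
        unfolding image_Un im(2) im(4)[OF I] im(4)[OF XY(3)] by simp_all
      show ?thesis unfolding 1 2 dimK[OF XY(1,2)] by (rule upper[OF N e s XY(1,2)])
    qed
  qed
  \<comment> \<open>The positions at which the original tuple gains rank. A solution gains rank at
    most there, and at all of them exactly if its dimension is \<open>k\<close>.\<close>
  define J where "J = {i \<in> ?D. e0 i \<notin> acl L N0 (e0 ` ?A \<union> e0 ` {..<i})}"
  have kJ: "k = card J"
    unfolding k J_def
    by (rule N0.pdim_count) (use e0I image_mono[of ?D ?I e0] image_mono[of ?A ?I e0] in auto)
  have dim_k: "pdim (acl L N) (e ` ?D) (e ` ?A) = k \<longleftrightarrow>
      (\<forall>i\<in>J. e i \<notin> acl L N (e ` ({..<i} \<union> ?A)))"
    if N: "models L T N" and e: "e ` ?I \<subseteq> carrier N" and s: "sat N e \<phi>"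
    for N :: "('f, 'r, 'u) fo_struct" and e
  proof -
    interpret N: pregeometry "acl L N" "carrier N" by (rule pregeometry_acl[OF N])
    let ?J = "{i \<in> ?D. e i \<notin> acl L N (e ` ?A \<union> e ` {..<i})}"
    have "e ` ?D \<subseteq> carrier N" "e ` ?A \<subseteq> carrier N"
      using e image_mono[of ?D ?I e] image_mono[of ?A ?I e] by auto
    then have c: "pdim (acl L N) (e ` ?D) (e ` ?A) = card ?J" by (rule N.pdim_count)
    have sub: "?J \<subseteq> J"
    proof
      fix i assume i: "i \<in> ?J"
      have sub: "?A \<union> {..<i} \<subseteq> ?I" "i \<in> ?I" using i by auto
      have "e i \<notin> acl L N (e ` (?A \<union> {..<i}))" using i by (simp add: image_Un)
      then have "e0 i \<notin> acl L N0 (e0 ` (?A \<union> {..<i}))" using \<phi>N[OF N e s] sub by blast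
      then show "i \<in> J" using i by (simp add: J_def image_Un)
    qed
    have "finite J" by (simp add: J_def)
    have "card ?J = card J \<longleftrightarrow> ?J = J"
    proof
      assume "card ?J = card J"
      then show "?J = J" by (rule card_subset_eq[OF \<open>finite J\<close> sub])
    qed (rule arg_cong)
    also have "\<dots> \<longleftrightarrow> (\<forall>i\<in>J. e i \<notin> acl L N (e ` ({..<i} \<union> ?A)))"
    proof -
      have "J \<subseteq> ?D" by (auto simp: J_def)
      moreover have "e ` ({..<i} \<union> ?A) = e ` ?A \<union> e ` {..<i}" for i by (simp add: image_Un Un_commute)
      ultimately show ?thesis using sub by (simp only:) blast
    qed
    finally show ?thesis unfolding c kJ .
  qed
  obtain \<zeta>0 where \<zeta>0: "wf_fm L \<zeta>0" "FV \<zeta>0 \<subseteq> {..<0} \<union> ?A"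
    and \<zeta>0N: "\<forall>(N :: ('f, 'r, 'u) fo_struct) e. saturated_model L T N \<and>
       e ` ({..<0} \<union> ?A) \<subseteq> carrier N \<longrightarrow>
       (sat N e \<zeta>0 \<longleftrightarrow> (\<exists>e'. (\<forall>i. i \<notin> {0..<n} \<longrightarrow> e' i = e i) \<and> e' ` {0..<n} \<subseteq> carrier N \<and>
          sat N e' \<phi> \<and> (\<forall>i\<in>J. 0 \<le> i \<longrightarrow> i < n \<longrightarrow> e' i \<notin> acl L N (e' ` ({..<i} \<union> ?A)))))"
    using independent_solution_formula[OF \<phi>(1,3) le0, of J] by (elim exE conjE) (rule that)
  \<comment> \<open>In \<open>\<zeta>0\<close> the parameters occupy the variables from
    \<open>n\<close> on; \<open>\<zeta>\<close> is evaluated at the parameter tuple alone, so they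
    are shifted down to 0.\<close>
  define \<rho> where "\<rho> = (\<lambda>i. i - n)"
  obtain \<zeta> where \<zeta>: "wf_fm L \<zeta>" "FV \<zeta> \<subseteq> \<rho> ` FV \<zeta>0"
    "\<forall>(M :: ('f, 'r, 'u) fo_struct) e. sat M e \<zeta> \<longleftrightarrow> sat M (e \<circ> \<rho>) \<zeta>0"
    using rename_fm_exists[OF \<zeta>0(1)] by blast
  have "\<rho> ` ({..<0} \<union> ?A) \<subseteq> {..<m}" by (auto simp: \<rho>_def)
  with image_mono[OF \<zeta>0(2)] have "\<rho> ` FV \<zeta>0 \<subseteq> {..<m}" by (rule subset_trans)
  with \<zeta>(2) have FV\<zeta>: "FV \<zeta> \<subseteq> {..<m}" by (rule subset_trans)
  have J_less: "i < n" if "i \<in> J" for i using that by (simp add: J_def)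
  have Sol: "holds N \<zeta> b \<longleftrightarrow>
      (\<exists>d'\<in>tuples N n. holds N \<phi> (d' @ b) \<and> pdim (acl L N) (set d') (set b) = k)"
    if N: "saturated_model L T N" and b: "b \<in> tuples N m" for N :: "('f, 'r, 'u) fo_struct" and b
  proof -
    have NT: "models L T N" using N by (simp add: saturated_model_def)
    have lb: "length b = m" "set b \<subseteq> carrier N" using b by (auto simp: tuples_def)
    define f where "f = (!) b \<circ> \<rho>"
    have fA: "f i = b ! (i - n)" for i by (simp add: f_def \<rho>_def)
    have fcar: "f ` ({..<0} \<union> ?A) \<subseteq> carrier N"
    proof -
      have "f i \<in> carrier N" if "i \<in> ?A" for i
      proof -
        have "i - n < length b" using that lb by auto
        then show ?thesis using lb(2) nth_mem fA by (metis subsetD)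
      qed
      then show ?thesis by auto
    qed
    have "holds N \<zeta> b \<longleftrightarrow> sat N f \<zeta>0" by (simp add: holds_def \<zeta>(3) f_def)
    also have "\<dots> \<longleftrightarrow> (\<exists>e'. (\<forall>i. i \<notin> {0..<n} \<longrightarrow> e' i = f i) \<and> e' ` {0..<n} \<subseteq> carrier N \<and>
          sat N e' \<phi> \<and> (\<forall>i\<in>J. 0 \<le> i \<longrightarrow> i < n \<longrightarrow> e' i \<notin> acl L N (e' ` ({..<i} \<union> ?A))))"
      by (rule \<zeta>0N[THEN spec, THEN spec, THEN mp, OF conjI[OF N fcar]])
    also have "\<dots> \<longleftrightarrow> (\<exists>d'\<in>tuples N n. holds N \<phi> (d' @ b) \<and> pdim (acl L N) (set d') (set b) = k)"
    proof
      assume "\<exists>d'\<in>tuples N n. holds N \<phi> (d' @ b) \<and> pdim (acl L N) (set d') (set b) = k"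
      then obtain d' where d': "d' \<in> tuples N n" "holds N \<phi> (d' @ b)"
        "pdim (acl L N) (set d') (set b) = k" by blast
      define e where "e = (!) (d' @ b)"
      have len: "length d' = n" "set d' \<subseteq> carrier N" using d' by (auto simp: tuples_def)
      note im' = nth_append_images[OF len(1) lb(1), folded e_def]
      have eI: "e ` ?I \<subseteq> carrier N" unfolding im' using len lb by auto
      have s: "sat N e \<phi>" using d'(2) by (simp add: holds_def e_def)
      have "\<forall>i\<in>J. e i \<notin> acl L N (e ` ({..<i} \<union> ?A))"
        by (rule iffD1[OF dim_k[OF NT eI s]]) (unfold im'(1,2), rule d'(3))
      moreover have "e i = f i" if "i \<notin> {0..<n}" for i
        using that len by (simp add: e_def fA nth_append)
      moreover have "e ` {0..<n} \<subseteq> carrier N" using im'(1) len(2) by (simp add: atLeast0LessThan)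
      ultimately show "\<exists>e'. (\<forall>i. i \<notin> {0..<n} \<longrightarrow> e' i = f i) \<and> e' ` {0..<n} \<subseteq> carrier N \<and>
          sat N e' \<phi> \<and> (\<forall>i\<in>J. 0 \<le> i \<longrightarrow> i < n \<longrightarrow> e' i \<notin> acl L N (e' ` ({..<i} \<union> ?A)))"
        using s by (intro exI[of _ e]) simp
    next
      assume "\<exists>e'. (\<forall>i. i \<notin> {0..<n} \<longrightarrow> e' i = f i) \<and> e' ` {0..<n} \<subseteq> carrier N \<and>
          sat N e' \<phi> \<and> (\<forall>i\<in>J. 0 \<le> i \<longrightarrow> i < n \<longrightarrow> e' i \<notin> acl L N (e' ` ({..<i} \<union> ?A)))"
      then obtain e' where e': "\<forall>i. i \<notin> {0..<n} \<longrightarrow> e' i = f i" "e' ` {0..<n} \<subseteq> carrier N"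
          "sat N e' \<phi>" "\<forall>i\<in>J. 0 \<le> i \<longrightarrow> i < n \<longrightarrow> e' i \<notin> acl L N (e' ` ({..<i} \<union> ?A))"
        by (elim exE conjE) (rule that)
      define d' where "d' = map e' [0..<n]"
      define e where "e = (!) (d' @ b)"
      have len: "length d' = n" "set d' \<subseteq> carrier N" using e'(2) by (auto simp: d'_def)
      note im' = nth_append_images[OF len(1) lb(1), folded e_def]
      have eI: "e ` ?I \<subseteq> carrier N" unfolding im' using len lb by auto
      have ee: "e i = e' i" if "i < n + m" for i
        using that e'(1) by (auto simp: e_def d'_def nth_append fA)
      have s: "sat N e \<phi>"
        using sat_cong[of \<phi> e e' N] \<phi>(3) ee e'(3) by auto
      have "e i \<notin> acl L N (e ` ({..<i} \<union> ?A))" if "i \<in> J" for i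
      proof -
        have "e ` ({..<i} \<union> ?A) = e' ` ({..<i} \<union> ?A)"
          by (rule image_cong[OF refl], rule ee) (use J_less[OF that] in auto)
        then show ?thesis using e'(4) J_less[OF that] ee[of i] that by simp
      qed
      then have "pdim (acl L N) (e ` ?D) (e ` ?A) = k" using dim_k[OF NT eI s] by blast
      then have "pdim (acl L N) (set d') (set b) = k" unfolding im'(1,2) .
      moreover have "d' \<in> tuples N n" using len by (simp add: tuples_def)
      moreover have "holds N \<phi> (d' @ b)" using s by (simp add: holds_def e_def)
      ultimately show "\<exists>d'\<in>tuples N n. holds N \<phi> (d' @ b) \<and> pdim (acl L N) (set d') (set b) = k"
        by blast
    qed
    finally show ?thesis .
  qed
  have bound: "pdim (acl L N) (set d') (set b) \<le> k"
    "pdim (acl L N) (set d') (set b) = k \<Longrightarrow> x \<in> set d' \<Longrightarrow> x \<notin> acl L N (set b)"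
    if N: "saturated_model L T N" and b: "b \<in> tuples N m" and d': "d' \<in> tuples N n"
      and h: "holds N \<phi> (d' @ b)" for N :: "('f, 'r, 'u) fo_struct" and b d' x
  proof -
    have NT: "models L T N" using N by (simp add: saturated_model_def)
    define e where "e = (!) (d' @ b)"
    have lb: "length b = m" "set b \<subseteq> carrier N" using b by (auto simp: tuples_def)
    have len: "length d' = n" "set d' \<subseteq> carrier N" using d' by (auto simp: tuples_def)
    note im' = nth_append_images[OF len(1) lb(1), folded e_def]
    have eI: "e ` ?I \<subseteq> carrier N" unfolding im' using len lb by auto
    have s: "sat N e \<phi>" using h by (simp add: holds_def e_def)
    show "pdim (acl L N) (set d') (set b) \<le> k" using le_k[OF NT eI s] by (simp only: im')
    assume eq: "pdim (acl L N) (set d') (set b) = k" and "x \<in> set d'"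
    then obtain i where i: "i < n" "x = e i" unfolding im'(1)[symmetric] by blast
    interpret N: pregeometry "acl L N" "carrier N" by (rule pregeometry_acl[OF NT])
    \<comment> \<open>Position \<open>i\<close> is split off. In the original it contributes 1 to
      \<open>k\<close>, which leaves \<open>k - 1\<close> as a bound for the other entries over it;
      a solution of dimension \<open>k\<close> therefore needs the contribution of its own entry
      \<open>i\<close>.\<close>
    have split: "pdim (acl L N') (g ` ?D) (g ` ?A) =
        pdim (acl L N') (g ` (?D - {i})) (g ` ({i} \<union> ?A)) + (if g i \<in> acl L N' (g ` ?A) then 0 else 1)"
      if N': "models L T N'" and g: "g ` ?I \<subseteq> carrier N'" for N' :: "('f, 'r, 'u) fo_struct" and g
    proof -
      interpret N': pregeometry "acl L N'" "carrier N'" by (rule pregeometry_acl[OF N'])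
      have sub: "g ` X \<subseteq> carrier N'" if "X \<subseteq> ?I" for X
        using image_mono[OF that, of g] g by (rule subset_trans)
      have iA: "g ` ({i} \<union> ?A) = insert (g i) (g ` ?A)" by simp
      have gi: "g i \<in> carrier N'" using sub[of "{i}"] i(1) by simp
      have "?D \<union> ?A = (?D - {i}) \<union> ({i} \<union> ?A)" using i(1) by blast
      then have un: "g ` ?D \<union> g ` ?A = g ` (?D - {i}) \<union> g ` ({i} \<union> ?A)"
        by (simp only: image_Un[symmetric])
      have s: "g ` ?D \<subseteq> carrier N'" "g ` ?A \<subseteq> carrier N'" "g ` (?D - {i}) \<subseteq> carrier N'"
        "g ` ({i} \<union> ?A) \<subseteq> carrier N'"
        by (rule sub, use i(1) in force)+
      have "pdim (acl L N') (g ` ?D) (g ` ?A) + N'.rk (g ` ?A) = N'.rk (g ` ?D \<union> g ` ?A)"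
        by (rule N'.pdim_rk[symmetric]) (simp_all add: s del: image_Un)
      also have "\<dots> = pdim (acl L N') (g ` (?D - {i})) (g ` ({i} \<union> ?A)) + N'.rk (g ` ({i} \<union> ?A))"
        unfolding un by (rule N'.pdim_rk) (use s in simp_all)
      finally have "pdim (acl L N') (g ` ?D) (g ` ?A) + N'.rk (g ` ?A) =
          pdim (acl L N') (g ` (?D - {i})) (g ` ({i} \<union> ?A)) + N'.rk (g ` ({i} \<union> ?A))" .
      moreover have "N'.rk (g ` ({i} \<union> ?A)) =
          N'.rk (g ` ?A) + (if g i \<in> acl L N' (g ` ?A) then 0 else 1)"
        unfolding iA by (rule N'.rk_insert[OF finite_imageI s(2) gi]) simp
      ultimately show ?thesis by linarith
    qed
    have "e0 i \<notin> acl L N0 (e0 ` ?A)"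
    proof -
      have "e0 i \<in> set d" using im(1) i(1) by blast
      then show ?thesis unfolding im(2) N0_def by (rule trans)
    qed
    then have "k = pdim (acl L N0) (e0 ` (?D - {i})) (e0 ` ({i} \<union> ?A)) + 1"
      unfolding k split[OF N0(1) e0I] by simp
    moreover have "pdim (acl L N) (e ` (?D - {i})) (e ` ({i} \<union> ?A)) \<le>
        pdim (acl L N0) (e0 ` (?D - {i})) (e0 ` ({i} \<union> ?A))"
      by (rule upper[OF NT eI s]) (use i(1) in auto)
    moreover have "k = pdim (acl L N) (e ` (?D - {i})) (e ` ({i} \<union> ?A)) +
        (if e i \<in> acl L N (e ` ?A) then 0 else 1)"
      using split[OF NT eI] eq unfolding im'(1,2) by simp
    ultimately have "e i \<notin> acl L N (e ` ?A)" by (auto split: if_splits)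
    then show "x \<notin> acl L N (set b)" using i im' by simp
  qed
  have d: "defines_d TYPE('u) L T \<phi> n m k \<zeta>"
    unfolding defines_d_def
  proof (intro conjI allI ballI impI)
    fix N :: "('f, 'r, 'u) fo_struct" and b
    assume b: "b \<in> tuples N m" and N: "saturated_model L T N"
    have "\<forall>e\<in>tuples N n. holds N \<phi> (e @ b) \<longrightarrow> pdim (acl L N) (set e) (set b) \<le> k"
      using bound(1)[OF N b] by blast
    then show "holds N \<zeta> b \<longleftrightarrow>
          (\<exists>e\<in>tuples N n. holds N \<phi> (e @ b) \<and> pdim (acl L N) (set e) (set b) = k) \<and>
          (\<forall>e\<in>tuples N n. holds N \<phi> (e @ b) \<longrightarrow> pdim (acl L N) (set e) (set b) \<le> k)"
      unfolding Sol[OF N b] by blast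
  qed (fact \<zeta>(1) FV\<zeta>)+
  have D: "defines_D TYPE('u) L T \<phi> n m k \<zeta>"
    unfolding defines_D_def
  proof (intro conjI allI ballI impI)
    fix N :: "('f, 'r, 'u) fo_struct" and b
    assume b: "b \<in> tuples N m" and N: "saturated_model L T N"
    have "pdim (acl L N) (set e) (set b) \<ge> k \<and> (\<forall>x\<in>set e. x \<notin> acl L N (set b)) \<longleftrightarrow>
        pdim (acl L N) (set e) (set b) = k" if "e \<in> tuples N n" "holds N \<phi> (e @ b)" for e
      using bound(1)[OF N b that] bound(2)[OF N b that] by (metis le_antisym order_refl)
    then show "holds N \<zeta> b \<longleftrightarrow>
          (\<exists>e\<in>tuples N n. holds N \<phi> (e @ b) \<and> pdim (acl L N) (set e) (set b) \<ge> k \<and>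
             (\<forall>x\<in>set e. x \<notin> acl L N (set b)))"
      unfolding Sol[OF N b] by blast
  qed (fact \<zeta>(1) FV\<zeta>)+
  have "holds N0 \<zeta> a"
  proof -
    have "a \<in> tuples N0 m" "d \<in> tuples N0 n" using car by (auto simp: tuples_def nm C0)
    moreover have "holds N0 \<phi> (d @ a)" using \<phi>(4) by (simp add: holds_def e0_def)
    ultimately show ?thesis using Sol[OF N0(2)] k im by auto
  qed
  then show ?thesis
    using that[OF strong] D d \<phi>N unfolding k_def nm N0_def by blast
qed

end

section \<open>Colored elementary maps\<close>

text \<open>Entries of the first tuple may repeat: \<open>p\<close> picks one index for each value,
  and the choice does not matter because equalities between entries belong to the common
  type.\<close>

lemma elementary_from_tuples:
  fixes M N :: "('f, 'r, 'u) fo_struct"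
  assumes e1: "e1 ` {..<t} \<subseteq> carrier M" and e2: "e2 ` {..<t} \<subseteq> carrier N"
    and eq: "\<And>\<theta>. wf_fm L \<theta> \<Longrightarrow> FV \<theta> \<subseteq> {..<t} \<Longrightarrow> sat M e1 \<theta> \<longleftrightarrow> sat N e2 \<theta>"
  obtains h where "elementary_on L M N (e1 ` {..<t}) h" "\<And>i. i < t \<Longrightarrow> h (e1 i) = e2 i"
proof -
  define p where "p = (\<lambda>x. SOME i. i < t \<and> e1 i = x)"
  have p: "p x < t \<and> e1 (p x) = x" if "x \<in> e1 ` {..<t}" for x
  proof -
    obtain i where "i < t \<and> e1 i = x" using \<open>x \<in> e1 ` {..<t}\<close> by auto
    then show ?thesis unfolding p_def by (rule someI)
  qed
  define h where "h = e2 \<circ> p"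
  have h: "h (e1 i) = e2 i" if i: "i < t" for i
  proof -
    have pi: "p (e1 i) < t" "e1 (p (e1 i)) = e1 i" using p[of "e1 i"] i by auto
    have "sat M e1 (Eq (Var (p (e1 i))) (Var i)) \<longleftrightarrow> sat N e2 (Eq (Var (p (e1 i))) (Var i))"
      by (rule eq) (use pi i in auto)
    then show ?thesis using pi by (simp add: h_def)
  qed
  have "elementary_on L M N (e1 ` {..<t}) h"
    unfolding elementary_on_def
  proof (intro conjI allI impI)
    show "e1 ` {..<t} \<subseteq> carrier M" by fact
    show "h ` e1 ` {..<t} \<subseteq> carrier N" using e2 h by auto
    fix \<psi> e assume \<psi>: "wf_fm L \<psi> \<and> e ` FV \<psi> \<subseteq> e1 ` {..<t}"
    obtain \<psi>' where \<psi>': "wf_fm L \<psi>'" "FV \<psi>' \<subseteq> (p \<circ> e) ` FV \<psi>"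
      "\<forall>(M :: ('f, 'r, 'u) fo_struct) e'. sat M e' \<psi>' \<longleftrightarrow> sat M (e' \<circ> (p \<circ> e)) \<psi>"
      using rename_fm_exists[of L \<psi> "p \<circ> e"] \<psi> by blast
    have pe: "p (e v) < t" "e1 (p (e v)) = e v" if "v \<in> FV \<psi>" for v
      using p[of "e v"] \<psi> that by auto
    have "FV \<psi>' \<subseteq> {..<t}" using \<psi>'(2) pe(1) by auto
    then have "sat M e1 \<psi>' \<longleftrightarrow> sat N e2 \<psi>'" by (rule eq[OF \<psi>'(1)])
    moreover have "sat M e1 \<psi>' \<longleftrightarrow> sat M e \<psi>"
      unfolding \<psi>'(3)[rule_format] by (rule sat_cong) (simp add: pe(2))
    moreover have "sat N e2 \<psi>' \<longleftrightarrow> sat N (h \<circ> e) \<psi>"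
      unfolding \<psi>'(3)[rule_format] by (rule sat_cong) (simp add: h_def)
    ultimately show "sat M e \<psi> \<longleftrightarrow> sat N (h \<circ> e) \<psi>" by simp
  qed
  then show ?thesis using that h by blast
qed

context colored_base
begin

text \<open>Colors are compared on \<open>Z\<close> alone, just as a weak isomorphism does not
  compare the colors of generated elements outside the given sets.\<close>

definition cmap ::
    "('f, 'r option, 'u) fo_struct \<Rightarrow> ('f, 'r option, 'u) fo_struct \<Rightarrow> 'u set \<Rightarrow> ('u \<Rightarrow> 'u) \<Rightarrow> bool" where
  "cmap M N Z f \<longleftrightarrow> elementary_on L (reduct M) (reduct N) Z f \<and>
     (\<forall>x\<in>Z. colored M x \<longleftrightarrow> colored N (f x))"

lemma cmapD:
  assumes "cmap M N Z f"
  shows "elementary_on L (reduct M) (reduct N) Z f" "Z \<subseteq> carrier M" "f ` Z \<subseteq> carrier N"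
    "inj_on f Z" "\<And>x. x \<in> Z \<Longrightarrow> colored N (f x) \<longleftrightarrow> colored M x"
  using assms elementary_on_carrier[of L "reduct M" "reduct N" Z f] elementary_on_inj
  by (auto simp: cmap_def)

lemma cmap_subset: "cmap M N Z f \<Longrightarrow> Z' \<subseteq> Z \<Longrightarrow> cmap M N Z' f"
  unfolding cmap_def using elementary_on_subset by blast

lemma cmap_inv:
  assumes f: "cmap M N Z f"
  shows "cmap N M (f ` Z) (inv_into Z f)"
  unfolding cmap_def
proof (intro conjI ballI)
  show "elementary_on L (reduct N) (reduct M) (f ` Z) (inv_into Z f)"
    by (rule elementary_on_inv[OF cmapD(1)[OF f]])
  fix y assume y: "y \<in> f ` Z"
  have "colored N (f (inv_into Z f y)) \<longleftrightarrow> colored M (inv_into Z f y)"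
    by (rule cmapD(5)[OF f inv_into_into[OF y]])
  then show "colored N y \<longleftrightarrow> colored M (inv_into Z f y)" by (simp add: f_inv_into_f[OF y])
qed

lemma cmap_delta:
  assumes M: "models L T (reduct M)" and N: "models L T (reduct N)" and f: "cmap M N Z f"
    and S: "finite S" "S \<subseteq> Z"
  shows "delta N (f ` S) = delta M S"
proof -
  have "col N (f ` S) = f ` col M S" using cmapD(5)[OF f] S(2) by auto
  moreover have "inj_on f (col M S)" using cmapD(4)[OF f] S(2) by (auto intro: inj_on_subset)
  ultimately have "card (col N (f ` S)) = card (col M S)" by (simp add: card_image)
  then show ?thesis
    using elementary_on_dm[OF M N cmapD(1)[OF f] S] by (simp add: delta_def)
qed

lemma cmap_intr:
  assumes M: "models L T (reduct M)" and N: "models L T (reduct N)" and f: "cmap M N Z f"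
    and AB: "A \<subseteq> Z" "B \<subseteq> Z" and B: "intr M A B"
  shows "intr N (f ` A) (f ` B)"
proof -
  have B': "finite B" "A \<subseteq> B" using B by (simp_all add: intr_def)
  have "delta N (f ` B) < delta N A'" if A': "f ` A \<subseteq> A'" "A' \<subset> f ` B" for A'
  proof -
    obtain S where S: "S \<subseteq> B" "A' = f ` S" using A' subset_image_iff[of A' f B] by blast
    have SZ: "S \<subseteq> Z" using S AB by blast
    have "A \<subseteq> S"
    proof
      fix x assume x: "x \<in> A"
      then obtain y where "y \<in> S" "f x = f y" using A'(1) S(2) by blast
      then show "x \<in> S" using inj_onD[OF cmapD(4)[OF f], of x y] x AB SZ by blast
    qed
    moreover have "S \<subset> B" using S A'(2) by blast
    ultimately have "delta M B < delta M S" using B by (simp add: intr_def)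
    then show ?thesis
      using cmap_delta[OF M N f B'(1) AB(2)] cmap_delta[OF M N f finite_subset[OF S(1) B'(1)] SZ] S(2)
      by simp
  qed
  then show ?thesis using B' by (auto simp: intr_def)
qed

lemma cmap_ncl_le:
  assumes M: "models L T (reduct M)" and N: "models L T (reduct N)" and f: "cmap M N Z f"
    and A: "A \<subseteq> Z" and sub: "ncl M n A \<subseteq> Z"
  shows "f ` ncl M n A \<subseteq> ncl N n (f ` A)"
proof
  fix y assume "y \<in> f ` ncl M n A"
  then obtain B where B: "B \<subseteq> carrier M" "intr M A B" "card (B - A) < n" "y \<in> f ` B"
    unfolding in_ncl[OF M] by blast
  have BZ: "B \<subseteq> Z" using intr_subset_ncl[OF M B(1-3)] sub by blast
  have "A \<subseteq> B" "finite B" using B(2) by (simp_all add: intr_def)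
  have "f ` B - f ` A = f ` (B - A)"
    using inj_on_image_set_diff[OF cmapD(4)[OF f], of B A] BZ A by auto
  then have "card (f ` B - f ` A) < n"
    using B(3) card_image_le[of "B - A" f] \<open>finite B\<close> by simp
  moreover have "f ` B \<subseteq> carrier N" using cmapD(3)[OF f] BZ by blast
  ultimately have "f ` B \<subseteq> ncl N n (f ` A)"
    by (intro intr_subset_ncl[OF N] cmap_intr[OF M N f A BZ B(2)])
  then show "y \<in> ncl N n (f ` A)" using B(4) by blast
qed

text \<open>One inclusion comes from \<open>f\<close> and one from its inverse. Intrinsic sets have
  to be moved across, so each closure must already lie in the domain or in the range.\<close>

lemma cmap_ncl:
  assumes M: "models L T (reduct M)" and N: "models L T (reduct N)" and f: "cmap M N Z f"
    and A: "A \<subseteq> Z" and sub: "ncl M n A \<subseteq> Z" "ncl N n (f ` A) \<subseteq> f ` Z"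
  shows "f ` ncl M n A = ncl N n (f ` A)"
proof
  show "f ` ncl M n A \<subseteq> ncl N n (f ` A)" by (rule cmap_ncl_le[OF M N f A sub(1)])
  let ?g = "inv_into Z f"
  have "?g ` ncl N n (f ` A) \<subseteq> ncl M n (?g ` f ` A)"
    by (rule cmap_ncl_le[OF N M cmap_inv[OF f]]) (use A sub in auto)
  also have "?g ` f ` A = A" by (rule inv_into_image_cancel[OF cmapD(4)[OF f] A])
  finally have "f ` ?g ` ncl N n (f ` A) \<subseteq> f ` ncl M n A" by (rule image_mono)
  moreover have "f ` ?g ` ncl N n (f ` A) = ncl N n (f ` A)"
    by (rule image_inv_into_cancel[OF refl sub(2)])
  ultimately show "ncl N n (f ` A) \<subseteq> f ` ncl M n A" by simp
qed

lemma delta_insert_colored: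
  assumes M: "models L T (reduct M)" and A: "finite A" "A \<subseteq> carrier M"
    and y: "y \<in> acl L (reduct M) A" "y \<notin> A" "colored M y"
  shows "delta M (insert y A) = delta M A - \<alpha>"
proof -
  interpret pregeometry "acl L (reduct M)" "carrier (reduct M)" by (rule pregeometry_acl[OF M])
  have "y \<in> carrier (reduct M)" using y(1) cl_carrier by blast
  then have "rk (insert y A) = rk A" using rk_insert[of A y] A y(1) by simp
  moreover have "col M (insert y A) = insert y (col M A)" using y(3) by auto
  moreover have "card (insert y (col M A)) = Suc (card (col M A))" using A(1) y(2) by simp
  ultimately show ?thesis by (simp add: delta_def algebra_simps)
qed

text \<open>A colored point of this kind would cost \<alpha> and bring no rank. The color of points
  algebraic over a closed set therefore never has to be arranged.\<close>

lemma rclosed_acl_uncolored: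
  assumes M: "models L T (reduct M)" and X: "rclosed r M X" "2 \<le> r"
    and y: "y \<in> acl L (reduct M) X" "y \<notin> X"
  shows "\<not> colored M y"
proof
  assume "colored M y"
  have X': "finite X" "X \<subseteq> carrier M" using X by (auto simp: rclosed_def)
  have "y \<in> carrier M" using y(1) acl_subset_carrier[of "reduct M" X] by auto
  moreover have "{y} - X = {y}" using y(2) by blast
  then have "card ({y} - X) < r" using X(2) by simp
  ultimately have "delta M X \<le> delta M (X \<union> {y})" using X unfolding rclosed_def by auto
  then show False
    using delta_insert_colored[OF M X' y \<open>colored M y\<close>] \<alpha>_pos by simp
qed

text \<open>A bad set \<open>C\<close> over the image of \<open>X\<close> may lie outside the range
  of \<open>f\<close>. The core of the union over the image of \<open>A\<close> is intrinsic and has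
  fewer than \<open>k\<close> points, so it lies in the k-closure, which is the range; its preimage
  \<open>W\<close> contradicts the closedness of \<open>X\<close>. The bound on \<open>k\<close> is
  the size allowed for this core.\<close>

lemma cmap_rclosed:
  assumes M: "models L T (reduct M)" and N: "models L T (reduct N)"
    and f: "cmap M N (ncl M k A) f" "f ` ncl M k A = ncl N k (f ` A)"
    and X: "A \<subseteq> X" "X \<subseteq> ncl M k A" "intr M A X" "rclosed r M X" and k: "card X + r \<le> k"
  shows "rclosed r N (f ` X)"
  unfolding rclosed_def
proof (intro conjI allI impI)
  have X': "finite X" "X \<subseteq> carrier M" using X(4) by (auto simp: rclosed_def)
  then show fX: "finite (f ` X)" by simp
  show fXN: "f ` X \<subseteq> carrier N" using cmapD(3)[OF f(1)] X(2) by blast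
  fix C assume C: "finite C \<and> C \<subseteq> carrier N \<and> card (C - f ` X) < r"
  show "delta N (f ` X) \<le> delta N (f ` X \<union> C)"
  proof (rule ccontr)
    assume less: "\<not> delta N (f ` X) \<le> delta N (f ` X \<union> C)"
    let ?V = "f ` X \<union> C"
    have V: "finite ?V" "f ` A \<subseteq> ?V" using fX C X(1) by auto
    obtain Z where Z: "f ` A \<subseteq> Z" "Z \<subseteq> ?V" "intr N (f ` A) Z"
      and Zmin: "\<And>Y. f ` A \<subseteq> Y \<Longrightarrow> Y \<subseteq> ?V \<Longrightarrow> delta N Z \<le> delta N Y"
      using intr_core[OF V, of N] by blast
    have "card (Z - f ` A) \<le> card ?V" using Z(2) V(1) by (intro card_mono) auto
    also have "?V = f ` X \<union> (C - f ` X)" by blast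
    also have "card \<dots> \<le> card (f ` X) + card (C - f ` X)" by (rule card_Un_le)
    also have "\<dots> < k" using card_image_le[OF X'(1), of f] C k by linarith
    finally have "Z \<subseteq> ncl N k (f ` A)"
      using Z(2,3) C fXN by (intro intr_subset_ncl[OF N]) blast+
    then obtain W where W: "W \<subseteq> ncl M k A" "Z = f ` W"
      unfolding f(2)[symmetric] by (rule subset_imageE)
    have inj: "inj_on f (ncl M k A)" by (rule cmapD(4)[OF f(1)])
    have Acl: "A \<subseteq> ncl M k A" using X by blast
    have AW: "A \<subseteq> W"
    proof
      fix x assume x: "x \<in> A"
      then obtain w where "w \<in> W" "f x = f w" using Z(1) W(2) by blast
      then show "x \<in> W" using inj_onD[OF inj, of x w] x Acl W(1) by blast
    qed
    have "finite Z" by (rule finite_subset[OF Z(2) V(1)])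
    then have Wfin: "finite W"
      unfolding W(2) by (rule finite_imageD) (rule inj_on_subset[OF inj W(1)])
    have Wc: "W \<subseteq> carrier M" using W(1) ncl_carrier by (rule subset_trans)
    have dW: "delta M W = delta N Z"
      unfolding W(2) by (rule cmap_delta[OF M N f(1) Wfin W(1), symmetric])
    have dX: "delta N (f ` X) = delta M X" by (rule cmap_delta[OF M N f(1) X'(1) X(2)])
    have "delta N Z \<le> delta N ?V" by (rule Zmin) (use V in auto)
    then have lt: "delta M W < delta M X" using less dW dX by simp
    have "f ` (W - X) \<subseteq> C - f ` X"
    proof
      fix y assume "y \<in> f ` (W - X)"
      then obtain w where w: "w \<in> W" "w \<notin> X" "y = f w" by blast
      have "y \<notin> f ` X"
      proof
        assume "y \<in> f ` X"
        then obtain x where x: "f w = f x" "x \<in> X" unfolding w(3) by (rule imageE)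
        have "w = x" by (rule inj_onD[OF inj x(1) subsetD[OF W(1) w(1)] subsetD[OF X(2) x(2)]])
        then show False using w(2) x(2) by simp
      qed
      moreover have "y \<in> Z" unfolding W(2) w(3) by (rule imageI[OF w(1)])
      then have "y \<in> ?V" by (rule subsetD[OF Z(2)])
      ultimately show "y \<in> C - f ` X" by blast
    qed
    then have "card (f ` (W - X)) \<le> card (C - f ` X)" using C by (intro card_mono) auto
    moreover have "card (f ` (W - X)) = card (W - X)"
      by (rule card_image) (use inj_on_subset[OF inj] W(1) in blast)
    ultimately have "card (W - X) < r" using C by simp
    then have "delta M X \<le> delta M (X \<union> W)" using X(4) Wfin Wc unfolding rclosed_def by blast
    moreover have "delta M (X \<union> W) + delta M (X \<inter> W) \<le> delta M X + delta M W"
      by (rule delta_submodular[OF M X' Wfin Wc])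
    \<comment> \<open>\<open>X\<close> is intrinsic over \<open>A\<close>, so
      \<open>X \<inter> W\<close>, which contains \<open>A\<close>, cannot have smaller
      \<open>delta\<close>.\<close>
    moreover have "delta M X \<le> delta M (X \<inter> W)"
    proof (cases "X \<inter> W = X")
      case False
      then have "X \<inter> W \<subset> X" "A \<subseteq> X \<inter> W" using X(1) AW by auto
      then show ?thesis using X(3) by (simp add: intr_def less_imp_le)
    qed simp
    ultimately show False using lt by simp
  qed
qed

section \<open>Saturated models of the colored theory, and recoloring\<close>

definition Tmodel :: "('f, 'r option, 'u) fo_struct \<Rightarrow> bool" where
  "Tmodel M \<longleftrightarrow> models_T_alpha L T \<alpha> M \<and> aleph1_saturated (colored_language L) M"

lemma Tmodel_good: "Tmodel M \<Longrightarrow> good M"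
proof -
  assume "Tmodel M"
  then have M: "models L T (reduct M)" "class_K_plus L T \<alpha> M"
    by (simp_all add: Tmodel_def models_T_alpha_def)
  then show "good M" using predim_eq[OF M(1)] by (auto simp: good_def class_K_plus_def)
qed

lemma Tmodel_models: "Tmodel M \<Longrightarrow> models L T (reduct M)"
  using good_models[OF Tmodel_good] .

lemma Tmodel_saturated: "Tmodel M \<Longrightarrow> saturated_model L T (reduct M)"
  using Tmodel_models saturated_reduct by (auto simp: Tmodel_def saturated_model_def)

text \<open>Makes recolored structures eligible as the structure \<open>M'\<close> in the
  axioms.\<close>

lemma good_class_K_plus:
  assumes "good M"
  shows "class_K_plus L T \<alpha> M"
proof -
  have M: "models L T (reduct M)" by (rule good_models[OF assms])
  then have s: "is_struct L (reduct M)" by (simp add: models_def)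
  then have "is_struct (colored_language L) M"
    by (simp add: is_struct_def colored_language_def reduct_def)
  moreover have "models_univ L T (reduct M)"
    using M s by (auto simp: models_univ_def models_def univ_part_def entails_def)
  ultimately show ?thesis
    using assms predim_eq[OF M] by (auto simp: class_K_plus_def class_K_def good_def)
qed

text \<open>Only the color predicate changes, so ranks and types in \<open>L\<close> are those of
  \<open>M\<close>. The result is in general no model of the axioms; it is the structure from which
  an instance of them is read.\<close>

definition recolor :: "('f, 'r option, 'u) fo_struct \<Rightarrow> 'u set \<Rightarrow> ('f, 'r option, 'u) fo_struct" where
  "recolor M p = M\<lparr>rint := (\<lambda>r xs. case r of None \<Rightarrow> \<exists>x\<in>p. xs = [x] | Some q \<Rightarrow> rint M (Some q) xs)\<rparr>"

lemma recolor_simps [simp]: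
  "reduct (recolor M p) = reduct M" "carrier (recolor M p) = carrier M"
  "colored (recolor M p) x \<longleftrightarrow> x \<in> p"
  by (auto simp: recolor_def reduct_def colored_def)

end

section \<open>Extending a map by one element\<close>

context colored_base
begin

text \<open>A subset is split as \<open>S \<union> Q\<close> with \<open>S\<close> in
  \<open>P\<close> and \<open>Q\<close> in \<open>E\<close>, and its rank is a minimum. In the first
  branch every point of \<open>Q\<close> adds 1 and costs only \<alpha>, while \<open>S\<close> has
  fewer than \<open>r\<close> points outside \<open>X\<close>. In the second branch the rank is the
  full one and at most all points of \<open>E\<close> and of the colored part of \<open>P\<close>
  are charged, so the numerical hypothesis on \<open>K\<close> applies.\<close>

lemma recolor_generic:
  assumes M: "good M" and X: "rclosed r M X" and P: "finite P" "P \<subseteq> carrier M" "X \<subseteq> P" "card (P - X) < r"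
    and E: "finite E" "E \<subseteq> carrier M" "E \<inter> P = {}"
    and gen: "\<And>S Q. S \<subseteq> P \<Longrightarrow> Q \<subseteq> E \<Longrightarrow>
      dm (reduct M) (S \<union> Q) = min (dm (reduct M) S + card Q) (dm (reduct M) P + K)"
    and K: "delta M X \<le> delta M P + K - \<alpha> * card E"
  defines "M' \<equiv> recolor M (col M P \<union> E)"
  shows "good M'" "closed_in L T \<alpha> M' X (P \<union> E)"
proof -
  have MT: "models L T (reduct M)" by (rule good_models[OF M])
  then have MT': "models L T (reduct M')" by (simp add: M'_def)
  interpret pregeometry "acl L (reduct M)" "carrier (reduct M)" by (rule pregeometry_acl[OF MT])
  have X': "finite X" "X \<subseteq> carrier M" using X by (auto simp: rclosed_def)
  have colP: "col M' S = col M S" if "S \<subseteq> P" for S using that E(3) by (auto simp: M'_def)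
  have dP: "delta M' S = delta M S" if "S \<subseteq> P" for S
    using colP[OF that] by (simp add: delta_def M'_def)
  have dSQ: "delta M' (S \<union> Q) = real (min (rk S + card Q) (rk P + K)) - \<alpha> * (card (col M S) + card Q)"
    if "S \<subseteq> P" "Q \<subseteq> E" for S Q
  proof -
    have "col M' (S \<union> Q) = col M S \<union> Q" using that E(3) by (auto simp: M'_def)
    moreover have "card (col M S \<union> Q) = card (col M S) + card Q"
      using finite_subset[OF that(1) P(1)] finite_subset[OF that(2) E(1)] that E(3)
      by (intro card_Un_disjoint) auto
    ultimately show ?thesis using gen[OF that] by (simp add: delta_def M'_def)
  qed
  have XZ: "delta M X \<le> delta M' (X \<union> Z)" if Z: "Z \<subseteq> P \<union> E" for Z
  proof -
    define S Q where "S = (X \<union> Z) \<inter> P" and "Q = Z \<inter> E"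
    have SQ: "X \<union> Z = S \<union> Q" "S \<subseteq> P" "Q \<subseteq> E" "X \<subseteq> S"
      using Z P(3) by (auto simp: S_def Q_def)
    have cQ: "card Q \<le> card E" using SQ(3) E(1) by (simp add: card_mono)
    have fS: "finite S" "S \<subseteq> carrier M" using finite_subset[OF SQ(2) P(1)] SQ(2) P(2) by auto
    have cS: "card (col M S) \<le> card (col M P)" using SQ(2) P(1) by (intro card_mono) auto
    have "card (S - X) \<le> card (P - X)" using SQ(2) P(1) by (intro card_mono) auto
    then have "card (S - X) < r" using P(4) by simp
    then have "delta M X \<le> delta M (X \<union> S)" using X fS unfolding rclosed_def by blast
    also have "X \<union> S = S" using SQ(4) by blast
    finally have dS: "delta M X \<le> delta M S" .
    have "\<alpha> * card Q \<le> card Q" using \<alpha>_le_1 by (simp add: mult_left_le_one_le \<alpha>_pos less_imp_le)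
    then have 1: "delta M X \<le> real (rk S + card Q) - \<alpha> * (card (col M S) + card Q)"
      using dS by (simp add: delta_def algebra_simps)
    have "\<alpha> * (card (col M S) + card Q) \<le> \<alpha> * (card (col M P) + card E)"
      using \<alpha>_pos cS cQ by simp
    then have 2: "delta M X \<le> real (rk P + K) - \<alpha> * (card (col M S) + card Q)"
      using K by (simp add: delta_def algebra_simps)
    show ?thesis unfolding SQ(1) dSQ[OF SQ(2,3)] using 1 2 by (simp add: min_def)
  qed
  \<comment> \<open>Only the colored part of \<open>Z\<close> matters. All colors outside
    \<open>P \<union> E\<close> have been removed, so this part lies in \<open>P \<union> E\<close>,
    and submodularity against \<open>X\<close> reduces the claim to \<open>XZ\<close>.\<close>
  have pos: "0 \<le> delta M' Z" if Z: "finite Z" "Z \<subseteq> carrier M" for Z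
  proof -
    define Y where "Y = col M' Z"
    have Y: "Y \<subseteq> P \<union> E" "finite Y" "Y \<subseteq> carrier M" "Y \<subseteq> Z" using Z by (auto simp: Y_def M'_def)
    have "rk Y \<le> rk Z" using rk_mono[OF Y(4)] Z by simp
    moreover have "col M' Y = col M' Z" by (auto simp: Y_def)
    ultimately have "delta M' Y \<le> delta M' Z" by (simp add: delta_def M'_def)
    moreover have "delta M' (X \<union> Y) + delta M' (X \<inter> Y) \<le> delta M' X + delta M' Y"
      by (rule delta_submodular[OF MT']) (use X' Y in \<open>simp_all add: M'_def\<close>)
    moreover have "delta M' X = delta M X" by (rule dP[OF P(3)])
    moreover have "0 \<le> delta M' (X \<inter> Y)"
    proof -
      have "X \<inter> Y \<subseteq> P" "finite (X \<inter> Y)" "X \<inter> Y \<subseteq> carrier M" using P(3) X' by auto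
      then show ?thesis using dP[of "X \<inter> Y"] M by (simp add: good_def)
    qed
    ultimately show ?thesis using XZ[OF Y(1)] by linarith
  qed
  then show "good M'" using MT' by (simp add: good_def M'_def)
  have "0 \<le> predim_rel L T \<alpha> M' A X" if "finite A" "A \<subseteq> P \<union> E" for A
  proof -
    have "A \<subseteq> carrier M" using that P E by blast
    then have "predim_rel L T \<alpha> M' A X = delta M' (X \<union> A) - delta M' X"
      using predim_rel_eq[OF MT' that(1) _ X'(1)] X'(2) by (simp add: M'_def)
    then show ?thesis using XZ[OF that(2)] dP[OF P(3)] by simp
  qed
  then show "closed_in L T \<alpha> M' X (P \<union> E)" using P(3) by (auto simp: closed_in_def)
qed

text \<open>For each formula true of \<open>D\<close> over \<open>X\<close>, an axiom read from the
  recolored structure gives a solution in \<open>N\<close> over the image of \<open>X\<close> with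
  the right colors. Saturation of \<open>N\<close> in the colored language collects these into one
  realization. The points of \<open>W\<close> are carried along with their type but with no
  condition on their colors.\<close>

lemma realize_recolored:
  fixes M N :: "('f, 'r option, 'u) fo_struct" and p :: "'u set"
  defines "M' \<equiv> recolor M p"
  assumes M: "Tmodel M" and N: "Tmodel N" and good: "good M'"
    and X: "finite X" "cmap M N X f" and D: "finite D" "D \<inter> X = {}" "D \<subseteq> carrier M"
    and cl: "closed_in L T \<alpha> M' X (X \<union> D)"
    and trans: "\<And>x. x \<in> D \<Longrightarrow> x \<notin> acl L (reduct M) X"
    and W: "finite W" "W \<subseteq> carrier M"
  obtains h where "elementary_on L (reduct M) (reduct N) (X \<union> D \<union> W) h"
    "\<And>x. x \<in> X \<Longrightarrow> h x = f x" "\<And>x. x \<in> D \<Longrightarrow> colored N (h x) \<longleftrightarrow> x \<in> p"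
proof -
  obtain a where a: "set a = X" "distinct a" using finite_distinct_list[OF X(1)] by blast
  obtain d where d: "set d = D" "distinct d" using finite_distinct_list[OF D(1)] by blast
  obtain w where w: "set w = W" using finite_list[OF W(1)] by blast
  define n m q where nm: "n = length d" "m = length a" and q: "q = length w"
  let ?N0 = "reduct M" and ?N2 = "reduct N"
  have MT: "models L T ?N0" and NT: "models L T ?N2"
    using Tmodel_models M N by auto
  have Xc: "X \<subseteq> carrier M" using cmapD(2)[OF X(2)] .
  have red: "reduct M' = reduct M" "carrier M' = carrier M" by (simp_all add: M'_def)
  have dist: "distinct (d @ a)" using a d D(2) by auto
  have car: "set (d @ a) \<subseteq> carrier M'" using a d D Xc red by auto
  have MT': "models L T (reduct M')" using MT red by simp
  interpret pregeometry "acl L (reduct M)" "carrier (reduct M)" by (rule pregeometry_acl[OF MT])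
  have transc: "transcendental L T \<alpha> M' d a"
    unfolding transcendental_def
  proof (intro conjI ballI)
    show "closed_in L T \<alpha> M' (set a) (set a \<union> set d)" using cl a d by simp
    fix x assume "x \<in> set d - set a"
    then have x: "x \<in> D" "x \<in> carrier M" using d D(3) by auto
    have "dimK L T M' {x} (set a) = pdim (acl L (reduct M)) {x} X"
      using dimK_eq[OF MT', of "{x}" X] x Xc red a by simp
    also have "\<dots> = 1" using pdim_insert[of "{}" X x] Xc x trans[OF x(1)] by simp
    finally show "dimK L T M' {x} (set a) = 1" .
  qed
  have sat': "saturated_model L T (reduct M')" using Tmodel_saturated[OF M] red by simp
  have trans': "\<And>x. x \<in> set d \<Longrightarrow> x \<notin> acl L (reduct M') (set a)" using trans a d red by simp
  define b where "b = map f a"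
  have b: "b \<in> tuples N m" using cmapD(3)[OF X(2)] a by (auto simp: b_def tuples_def nm)
  \<comment> \<open>Layout of the variables: \<open>d\<close> below \<open>n\<close>, then the
    \<open>m\<close> entries of \<open>a\<close>, then the \<open>q\<close> entries of
    \<open>w\<close>. The first and third block are unknowns; the second is fixed to the image of
    \<open>a\<close>.\<close>
  let ?t = "n + m + q"
  define e1 where "e1 = (!) (d @ a @ w)"
  have e1im: "e1 ` {..<?t} = X \<union> D \<union> W"
    using nth_append_images(3)[of "d @ a" "n + m" w q] nm q a d w by (auto simp: e1_def)
  have realize: "\<exists>z\<in>tuples N n. sat ?N2 ((!) (z @ b)) \<theta> \<and> (\<forall>i<n. colored N (z ! i) \<longleftrightarrow> colored M' (d ! i))"
    if \<theta>: "wf_fm L \<theta>" "FV \<theta> \<subseteq> {..<n + m}" "sat ?N0 ((!) (d @ a)) \<theta>" for \<theta>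
  proof -
    have "FV \<theta> \<subseteq> {..<length d + length a}" "holds (reduct M') \<theta> (d @ a)"
      using \<theta>(2,3) by (simp_all add: nm holds_def red)
    then obtain \<phi> \<zeta> where str: "strong_formula L T M' d a \<phi>"
      and defD: "defines_D TYPE('u) L T \<phi> (length d) (length a) (dimK L T M' (set d) (set a)) \<zeta>"
      and defd: "defines_d TYPE('u) L T \<phi> (length d) (length a) (dimK L T M' (set d) (set a)) \<zeta>"
      and h: "holds (reduct M') \<zeta> a"
      and imp: "\<And>(N :: ('f, 'r, 'u) fo_struct) e. models L T N \<Longrightarrow>
         e ` {..<length d + length a} \<subseteq> carrier N \<Longrightarrow> sat N e \<phi> \<Longrightarrow> sat N e \<theta>"
      using strong_formula_exists[OF sat' dist car trans' \<theta>(1)] by metis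
    have FV\<zeta>: "wf_fm L \<zeta>" "FV \<zeta> \<subseteq> {..<m}" using defd by (simp_all add: defines_d_def nm)
    have hb: "holds ?N2 \<zeta> b"
    proof -
      have "(!) a ` FV \<zeta> \<subseteq> X" using FV\<zeta>(2) a(1) nm(2) nth_mem by fastforce
      then have "sat ?N0 ((!) a) \<zeta> \<longleftrightarrow> sat ?N2 (f \<circ> (!) a) \<zeta>"
        by (rule elementary_onD[OF cmapD(1)[OF X(2)] FV\<zeta>(1)])
      also have "\<dots> \<longleftrightarrow> sat ?N2 ((!) b) \<zeta>"
        by (rule sat_cong) (use FV\<zeta>(2) in \<open>auto simp: b_def nm\<close>)
      finally show ?thesis using h by (simp add: holds_def red)
    qed
    have axiom: "\<forall>(M' :: ('f, 'r option, 'u) fo_struct) a d \<phi> k \<zeta>D \<zeta>d.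
        class_K_plus L T \<alpha> M' \<and> set a \<subseteq> carrier M' \<and> set d \<subseteq> carrier M' \<and>
        closed_in L T \<alpha> M' (set a) (set a \<union> set d) \<and> transcendental L T \<alpha> M' d a \<and>
        dimK L T M' (set d) (set a) = k \<and> strong_formula L T M' d a \<phi> \<and>
        defines_D TYPE('u) L T \<phi> (length d) (length a) k \<zeta>D \<and>
        defines_d TYPE('u) L T \<phi> (length d) (length a) k \<zeta>d \<longrightarrow>
        (\<forall>b\<in>tuples N (length a). holds (reduct N) \<zeta>D b \<and> holds (reduct N) \<zeta>d b \<longrightarrow>
           (\<exists>z\<in>tuples N (length d). holds (reduct N) \<phi> (z @ b) \<and>
              (\<forall>i<length d. colored N (z ! i) \<longleftrightarrow> colored M' (d ! i))))"
      using N unfolding Tmodel_def models_T_alpha_def by (elim conjE) assumption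
    have "\<exists>z\<in>tuples N (length d). holds (reduct N) \<phi> (z @ b) \<and>
              (\<forall>i<length d. colored N (z ! i) \<longleftrightarrow> colored M' (d ! i))"
    proof (rule axiom[THEN spec, THEN spec, THEN spec, THEN spec, THEN spec, THEN spec, THEN spec,
          THEN mp, THEN bspec, THEN mp])
      show "class_K_plus L T \<alpha> M' \<and> set a \<subseteq> carrier M' \<and> set d \<subseteq> carrier M' \<and>
        closed_in L T \<alpha> M' (set a) (set a \<union> set d) \<and> transcendental L T \<alpha> M' d a \<and>
        dimK L T M' (set d) (set a) = dimK L T M' (set d) (set a) \<and> strong_formula L T M' d a \<phi> \<and>
        defines_D TYPE('u) L T \<phi> (length d) (length a) (dimK L T M' (set d) (set a)) \<zeta> \<and>
        defines_d TYPE('u) L T \<phi> (length d) (length a) (dimK L T M' (set d) (set a)) \<zeta>"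
        using good_class_K_plus[OF good] car transc str defD defd
        by (simp add: transcendental_def)
      show "b \<in> tuples N (length a)" using b by (simp add: nm)
      show "holds (reduct N) \<zeta> b \<and> holds (reduct N) \<zeta> b" using hb by simp
    qed
    then obtain z where z: "z \<in> tuples N n" "holds ?N2 \<phi> (z @ b)"
      "\<forall>i<n. colored N (z ! i) \<longleftrightarrow> colored M' (d ! i)" by (auto simp: nm)
    have "(!) (z @ b) ` {..<n + m} = set (z @ b)"
      by (rule nth_append_images(3)) (use z b in \<open>auto simp: tuples_def\<close>)
    then have "(!) (z @ b) ` {..<length d + length a} \<subseteq> carrier ?N2"
      using z(1) b by (auto simp: tuples_def nm)
    then have "sat ?N2 ((!) (z @ b)) \<theta>" using imp[OF NT] z(2) by (simp add: holds_def)
    then show ?thesis using z by blast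
  qed
  define eb where "eb = (\<lambda>i. f (a ! (i - n)))"
  define \<Theta> where "\<Theta> = {\<theta>. wf_fm L \<theta> \<and> FV \<theta> \<subseteq> {..<?t} \<and> sat ?N0 e1 \<theta>}"
  define c :: "nat \<Rightarrow> ('f, 'r option) fm" where
    "c = (\<lambda>i. if colored M' (d ! i) then Rel None [Var i] else Neg (Rel None [Var i]))"
  define \<Gamma> where "\<Gamma> = lift_fm ` \<Theta> \<union> c ` {..<n}"
  let ?V = "{..<n} \<union> {n + m..<?t}" and ?W = "{n..<n + m}"
  have csat: "sat N e (c i) \<longleftrightarrow> (colored N (e i) \<longleftrightarrow> colored M' (d ! i))" for e i
    by (simp add: c_def colored_def)
  have "\<exists>e'. (\<forall>i. i \<notin> ?V \<longrightarrow> e' i = eb i) \<and> e' ` ?V \<subseteq> carrier N \<and> (\<forall>\<phi>\<in>\<Gamma>. sat N e' \<phi>)"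
  proof (rule saturated_types[of "colored_language L"])
    show "aleph1_saturated (colored_language L) N" using N by (simp add: Tmodel_def)
    show "finite ?V" "finite ?W" by simp_all
    have "eb i \<in> carrier N" if i: "i \<in> ?W" for i
    proof -
      have "a ! (i - n) \<in> X" using i a(1) nm by auto
      then show ?thesis using cmapD(3)[OF X(2)] by (auto simp: eb_def)
    qed
    then show "eb ` ?W \<subseteq> carrier N" by blast
    show "wf_fm (colored_language L) \<phi> \<and> FV \<phi> \<subseteq> ?V \<union> ?W" if \<phi>: "\<phi> \<in> \<Gamma>" for \<phi>
    proof -
      have eq: "?V \<union> ?W = {..<?t}" by auto
      from \<phi> consider \<theta> where "\<theta> \<in> \<Theta>" "\<phi> = lift_fm \<theta>" | i where "i < n" "\<phi> = c i"
        by (auto simp: \<Gamma>_def)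
      then show ?thesis
      proof cases
        case 1
        then show ?thesis unfolding eq by (simp add: \<Theta>_def wf_lift_fm FV_lift_fm)
      next
        case 2
        then show ?thesis unfolding eq by (simp add: c_def colored_language_def)
      qed
    qed
    fix Q assume Q: "finite Q" "Q \<subseteq> \<Gamma>"
    have "finite (Q \<inter> lift_fm ` \<Theta>)" "Q \<inter> lift_fm ` \<Theta> \<subseteq> lift_fm ` \<Theta>" using Q by auto
    then obtain Q' where Q': "Q' \<subseteq> \<Theta>" "finite Q'" "Q \<inter> lift_fm ` \<Theta> = lift_fm ` Q'"
      using finite_subset_image by metis
    have "Q' \<subseteq> {\<phi>. wf_fm L \<phi> \<and> FV \<phi> \<subseteq> {..<?t}}" using Q'(1) by (auto simp: \<Theta>_def)
    then obtain \<theta> where \<theta>: "wf_fm L \<theta>" "FV \<theta> \<subseteq> {..<?t}"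
      "\<And>(M :: ('f, 'r, 'u) fo_struct) e. sat M e \<theta> \<longleftrightarrow> (\<forall>\<phi>\<in>Q'. sat M e \<phi>)"
      by (rule finite_conj_closed[OF Q'(2), where 'u = 'u]) (rule that)
    \<comment> \<open>The axioms see only \<open>d\<close> and \<open>a\<close>; the block of
      \<open>w\<close> is hidden behind existential quantifiers and recovered in
      \<open>e'\<close>.\<close>
    define \<theta>' where "\<theta>' = Exs [n + m..<?t] \<theta>"
    have \<theta>': "wf_fm L \<theta>'" "FV \<theta>' \<subseteq> {..<n + m}"
      using \<theta>(1,2) by (auto simp: \<theta>'_def)
    have e1sat: "sat ?N0 e1 \<theta>" using \<theta>(3) Q'(1) by (auto simp: \<Theta>_def)
    have "sat ?N0 ((!) (d @ a)) \<theta>'"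
      unfolding \<theta>'_def sat_Exs
    proof (intro exI[of _ "\<lambda>i. if i < ?t then e1 i else (d @ a) ! i"] conjI allI impI)
      show "(if i < ?t then e1 i else (d @ a) ! i) = (d @ a) ! i" if "i \<notin> set [n + m..<?t]" for i
        using that by (auto simp: e1_def nth_append nm)
      have "e1 ` {..<?t} \<subseteq> carrier M" unfolding e1im using Xc D(3) W(2) by simp
      then show "(\<lambda>i. if i < ?t then e1 i else (d @ a) ! i) ` set [n + m..<?t] \<subseteq> carrier ?N0"
        by auto
      have "sat ?N0 (\<lambda>i. if i < ?t then e1 i else (d @ a) ! i) \<theta> \<longleftrightarrow> sat ?N0 e1 \<theta>"
        by (rule sat_cong) (use \<theta>(2) in auto)
      then show "sat ?N0 (\<lambda>i. if i < ?t then e1 i else (d @ a) ! i) \<theta>" using e1sat by simp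
    qed
    then obtain z where z: "z \<in> tuples N n" "sat ?N2 ((!) (z @ b)) \<theta>'"
      "\<forall>i<n. colored N (z ! i) \<longleftrightarrow> colored M' (d ! i)"
      using realize[OF \<theta>'] by blast
    have lz: "length z = n" "set z \<subseteq> carrier N" using z(1) by (auto simp: tuples_def)
    from z(2) obtain e' where e': "\<forall>i. i \<notin> set [n + m..<?t] \<longrightarrow> e' i = (z @ b) ! i"
      "e' ` set [n + m..<?t] \<subseteq> carrier ?N2" "sat ?N2 e' \<theta>"
      unfolding \<theta>'_def sat_Exs by blast
    define e2 where "e2 = (\<lambda>i. if i \<in> ?V then e' i else eb i)"
    have z_i: "e' i = z ! i" if "i < n" for i using e'(1) that lz by (simp add: nth_append)
    have agree: "e2 i = e' i" if "i < ?t" for i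
    proof (cases "i \<in> ?V")
      case False
      then have i: "n \<le> i" "i < n + m" using that by auto
      then have "e' i = b ! (i - n)" using e'(1) lz by (simp add: nth_append)
      also have "\<dots> = eb i" using i by (simp add: b_def eb_def nm)
      finally show ?thesis using False by (simp add: e2_def)
    qed (simp add: e2_def)
    have \<theta>2: "sat ?N2 e2 \<theta>"
      using sat_cong[of \<theta> e2 e' ?N2] agree \<theta>(2) e'(3) by auto
    show "\<exists>e'. (\<forall>i. i \<notin> ?V \<longrightarrow> e' i = eb i) \<and> e' ` ?V \<subseteq> carrier N \<and> (\<forall>\<phi>\<in>Q. sat N e' \<phi>)"
    proof (intro exI[of _ e2] conjI allI impI ballI)
      show "e2 i = eb i" if "i \<notin> ?V" for i using that unfolding e2_def by (simp only: if_False)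
      show "e2 ` ?V \<subseteq> carrier N"
      proof
        fix y assume "y \<in> e2 ` ?V"
        then obtain i where i0: "y = e2 i" "i \<in> ?V" by (rule imageE)
        then have i: "i \<in> ?V" "y = e' i" unfolding e2_def by (simp_all only: if_True)
        show "y \<in> carrier N"
        proof (cases "i < n")
          case True
          then show ?thesis using i z_i lz nth_mem by fastforce
        next
          case False
          then show ?thesis using i e'(2) by auto
        qed
      qed
      fix \<phi> assume \<phi>: "\<phi> \<in> Q"
      show "sat N e2 \<phi>"
      proof (cases "\<phi> \<in> lift_fm ` \<Theta>")
        case True
        then obtain \<theta>1 where "\<theta>1 \<in> Q'" "\<phi> = lift_fm \<theta>1" using \<phi> Q'(3) by blast
        then show ?thesis using \<theta>2 \<theta>(3) by (simp add: sat_lift_fm)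
      next
        case False
        then obtain i where i: "i < n" "\<phi> = c i" using \<phi> Q(2) by (auto simp: \<Gamma>_def)
        then have "e2 i = z ! i" using agree[of i] z_i by simp
        then show ?thesis using i csat z(3) by simp
      qed
    qed
  qed
  then obtain e2 where e2': "\<forall>i. i \<notin> ?V \<longrightarrow> e2 i = eb i" "e2 ` ?V \<subseteq> carrier N"
    "\<forall>\<phi>\<in>\<Gamma>. sat N e2 \<phi>" by (elim exE conjE) (rule that)
  note e2 = e2'(1)[rule_format] e2'(2) e2'(3)[rule_format]
  have e1X: "e1 i = a ! (i - n)" if "n \<le> i" "i < n + m" for i
  proof -
    have "i - n < m" using that by linarith
    then show ?thesis using that by (simp add: e1_def nth_append nm)
  qed
  have e2X: "e2 i = f (e1 i)" if "n \<le> i" "i < n + m" for i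
    unfolding e1X[OF that] using e2(1)[of i] that by (simp add: eb_def)
  have e1c: "e1 ` {..<?t} \<subseteq> carrier ?N0" unfolding e1im using Xc D(3) W(2) by simp
  have e2c: "e2 ` {..<?t} \<subseteq> carrier ?N2"
  proof
    fix y assume "y \<in> e2 ` {..<?t}"
    then obtain i where i: "i < ?t" "y = e2 i" by blast
    show "y \<in> carrier ?N2"
    proof (cases "i \<in> ?V")
      case False
      then have i': "n \<le> i" "i < n + m" using i by auto
      then have "i - n < length a" using nm by linarith
      then have "e1 i \<in> X" using e1X[OF i'] a(1) nth_mem by metis
      then show ?thesis using e2X[OF i'] i cmapD(3)[OF X(2)] by auto
    qed (use i e2(2) in auto)
  qed
  \<comment> \<open>For every formula the type contains it or its negation, so inclusion of types is
    equality.\<close>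
  have equiv: "sat ?N0 e1 \<theta> \<longleftrightarrow> sat ?N2 e2 \<theta>" if \<theta>: "wf_fm L \<theta>" "FV \<theta> \<subseteq> {..<?t}" for \<theta>
  proof -
    have imp: "sat ?N2 e2 \<theta>" if "wf_fm L \<theta>" "FV \<theta> \<subseteq> {..<?t}" "sat ?N0 e1 \<theta>" for \<theta>
    proof -
      have "lift_fm \<theta> \<in> \<Gamma>" using that by (auto simp: \<Gamma>_def \<Theta>_def)
      then show ?thesis using e2(3) sat_lift_fm by blast
    qed
    from imp[of \<theta>] imp[of "Neg \<theta>"] \<theta> show ?thesis by auto
  qed
  obtain h where h: "elementary_on L ?N0 ?N2 (e1 ` {..<?t}) h" "\<And>i. i < ?t \<Longrightarrow> h (e1 i) = e2 i"
    using elementary_from_tuples[where L = L, OF e1c e2c equiv] by blast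
  show ?thesis
  proof (rule that)
    show "elementary_on L ?N0 ?N2 (X \<union> D \<union> W) h" using h(1) unfolding e1im .
    fix x
    show "h x = f x" if x: "x \<in> X"
    proof -
      obtain j where j: "j < m" "x = a ! j" using x a(1) nm by (metis in_set_conv_nth)
      then have "x = e1 (n + j)" using e1X[of "n + j"] by simp
      then show ?thesis using h(2)[of "n + j"] e2X[of "n + j"] j by simp
    qed
    show "colored N (h x) \<longleftrightarrow> x \<in> p" if x: "x \<in> D"
    proof -
      obtain j where j: "j < n" "x = d ! j" using x d(1) nm by (metis in_set_conv_nth)
      then have "x = e1 j" by (simp add: e1_def nth_append nm)
      moreover have "sat N e2 (c j)" using j by (intro e2(3)) (simp add: \<Gamma>_def)
      ultimately show ?thesis using h(2)[of j] csat[of e2 j] j by (simp add: M'_def)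
    qed
  qed
qed

end

lemma (in pregeometry) rk_Un_cl:
  assumes "finite S" "S \<subseteq> C" "finite W" "W \<subseteq> cl S"
  shows "rk (S \<union> W) = rk S"
proof -
  have W: "W \<subseteq> C" using assms(4) cl_carrier by (rule subset_trans)
  have "pdim cl W S = 0" using pdim_le_card[of W S "{}"] assms W by simp
  then show ?thesis using pdim_rk[OF assms(3) W assms(1,2)] by (simp add: Un_commute)
qed

context colored_base
begin

text \<open>Each point of \<open>Q\<close> adds 1 to the rank and costs at most \<alpha>, which is
  at most 1.\<close>

lemma delta_small_subset_generic:
  assumes "models L T (reduct N)" "finite Y" "Y \<subseteq> carrier N" "finite Q" "Q \<subseteq> carrier N"
    and "Y \<inter> Q = {}" "dm (reduct N) (Y \<union> Q) = dm (reduct N) Y + card Q"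
  shows "delta N Y \<le> delta N (Y \<union> Q)"
proof -
  have "Q - Y = Q" using assms(6) by blast
  then have "card (col N (Y \<union> Q)) = card (col N Y) + card (col N Q)"
    using card_col_diff[OF assms(2,4), of N] by simp
  moreover have "card (col N Q) \<le> card Q" using assms(4) by (intro card_mono) auto
  then have "\<alpha> * card (col N Q) \<le> card Q"
    using mult_left_le_one_le[of "real (card (col N Q))" \<alpha>] \<alpha>_pos \<alpha>_le_1 by linarith
  ultimately show ?thesis using assms(7) by (simp add: delta_def algebra_simps)
qed

text \<open>\<open>s\<close> bounds the part to be added, and \<open>n\<close> is the closedness
  wanted for the image. That \<open>r\<close> is computed from these two alone, for all models and
  maps, is the source of the uniformity in the theorem.\<close>

lemma extend_closed:
  obtains r where "\<And>M N X f W. Tmodel M \<Longrightarrow> Tmodel N \<Longrightarrow> cmap M N X f \<Longrightarrow> rclosed r M X \<Longrightarrow>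
    rclosed r N (f ` X) \<Longrightarrow> finite W \<Longrightarrow> W \<subseteq> carrier M \<Longrightarrow> card W \<le> s \<Longrightarrow>
    \<exists>h. cmap M N (X \<union> W) h \<and> (\<forall>x\<in>X. h x = f x) \<and> rclosed n N (h ` (X \<union> W))"
proof -
  obtain \<epsilon> where \<epsilon>: "0 < \<epsilon>" "\<epsilon> \<le> 1"
    "\<And>M V C. models L T (reduct M) \<Longrightarrow> finite V \<Longrightarrow> V \<subseteq> carrier M \<Longrightarrow> finite C \<Longrightarrow>
      C \<subseteq> carrier M \<Longrightarrow> card (C - V) < n \<Longrightarrow> delta M (V \<union> C) < delta M V \<Longrightarrow>
      delta M (V \<union> C) \<le> delta M V - \<epsilon>"
    using delta_gap[of n] by metis
  \<comment> \<open>In \<open>n + 2 \<le> K\<close>, the \<open>n\<close> makes any fewer than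
    \<open>n\<close> points of \<open>E\<close> independent over \<open>P\<close>, and the 2 is
    required by \<open>generic_set\<close>. \<open>B\<close> will bound the size of
    \<open>E\<close>.\<close>
  obtain B where B: "\<And>u l :: nat. u \<le> s \<Longrightarrow> l \<le> s \<Longrightarrow>
    \<exists>K N :: nat. n + 2 \<le> K \<and> N \<le> B \<and> 0 \<le> (u - \<alpha> * l) + K - \<alpha> * N \<and> (u - \<alpha> * l) + K - \<alpha> * N < \<epsilon>"
    using irrational_approx_bounded[OF \<alpha>_pos \<alpha>_irrational \<epsilon>(1), of s "n + 2"] by metis
  \<comment> \<open>Room for \<open>W\<close>, for the copy of \<open>E\<close> and for a bad set of
    fewer than \<open>n\<close> points; the 2 is what \<open>rclosed_acl_uncolored\<close> asks
    for.\<close>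
  define r where "r = s + B + n + 2"
  show ?thesis
  proof (rule that[of r])
    fix M N X f W
    assume M: "Tmodel M" and N: "Tmodel N" and f: "cmap M N X f" and X: "rclosed r M X"
      and fX: "rclosed r N (f ` X)" and W: "finite W" "W \<subseteq> carrier M" "card W \<le> s"
    let ?M = "reduct M" and ?N = "reduct N"
    have gM: "good M" using Tmodel_good M .
    have MT: "models L T ?M" and NT: "models L T ?N"
      using Tmodel_models M N by auto
    interpret M: pregeometry "acl L ?M" "carrier ?M" by (rule pregeometry_acl[OF MT])
    have X': "finite X" "X \<subseteq> carrier M" using X by (auto simp: rclosed_def)
    \<comment> \<open>The axioms reach the points transcendental over \<open>X\<close>; the
      algebraic ones outside \<open>X\<close> form \<open>Wa\<close> and follow by
      elementarity.\<close>
    define Wt where "Wt = W - acl L ?M X"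
    define Wa where "Wa = W - Wt - X"
    have Wt: "finite Wt" "Wt \<subseteq> carrier M" "card Wt \<le> s" "Wt \<inter> X = {}"
      using W M.cl_ext[of X] X' card_mono[OF W(1), of Wt] by (auto simp: Wt_def)
    have Wa: "finite Wa" "Wa \<subseteq> carrier M" "Wa \<subseteq> acl L ?M X" "Wa \<inter> X = {}"
      using W by (auto simp: Wa_def Wt_def)
    define P where "P = X \<union> Wt"
    have P: "finite P" "P \<subseteq> carrier M" "X \<subseteq> P" using X' Wt by (auto simp: P_def)
    have PX: "P - X = Wt" using Wt(4) by (auto simp: P_def)
    have XW: "X \<union> W = P \<union> Wa" by (auto simp: P_def Wa_def Wt_def)
    let ?u = "pdim (acl L ?M) Wt X" and ?l = "card (col M Wt)"
    have "?u \<le> card Wt"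
      by (rule M.pdim_le_card) (use Wt X' M.cl_ext[of "X \<union> Wt"] in auto)
    then have u: "?u \<le> s" using Wt by simp
    have l: "?l \<le> s" using card_mono[OF Wt(1), of "col M Wt"] Wt(3) by auto
    have dP: "delta M P = delta M X + (?u - \<alpha> * ?l)"
    proof -
      have "Wt - X = Wt" using Wt(4) by blast
      then show ?thesis
        using dm_diff[OF MT X' Wt(1,2)] card_col_diff[OF X'(1) Wt(1), of M]
        by (simp add: P_def delta_def algebra_simps)
    qed
    obtain K m :: nat where Km: "n + 2 \<le> K" "m \<le> B" "0 \<le> (?u - \<alpha> * ?l) + K - \<alpha> * m"
      "(?u - \<alpha> * ?l) + K - \<alpha> * m < \<epsilon>"
      using B[OF u l] by blast
    have "card (P - X) < r" using PX Wt(3) by (simp add: r_def)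
    then have dXP: "delta M X \<le> delta M P"
      using X P(1,2) P(3) Un_absorb1[OF P(3)] unfolding rclosed_def by metis
    \<comment> \<open>With \<open>K \<le> m\<close> the rank of \<open>P \<union> E\<close> attains
      the cap \<open>dm ?M P + K\<close>, so the chosen numbers do describe its predimension. The
      reason: \<open>P\<close> has no smaller \<open>delta\<close> than \<open>X\<close>, \<alpha>
      is at most 1, and the chosen value is below \<open>\<epsilon> \<le> 1\<close>.\<close>
    have mK: "K \<le> m"
    proof (rule ccontr)
      assume "\<not> K \<le> m"
      then have "real m + 1 \<le> K" by linarith
      moreover have "\<alpha> * m \<le> m" using mult_left_le_one_le[of "real m" \<alpha>] \<alpha>_pos \<alpha>_le_1 by simp
      ultimately show False using Km(4) \<epsilon>(2) dP dXP by linarith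
    qed
    obtain E where E: "finite E" "E \<subseteq> carrier ?M" "E \<inter> P = {}" "card E = m"
      and gen: "\<And>S Q. S \<subseteq> P \<Longrightarrow> Q \<subseteq> E \<Longrightarrow> dm ?M (S \<union> Q) = min (dm ?M S + card Q) (dm ?M P + K)"
    proof -
      have "P \<subseteq> carrier ?M" "2 \<le> K" using P Km by auto
      from generic_set[OF Tmodel_saturated[OF M] P(1) this, of m] show thesis
        using that by blast
    qed
    have E': "E \<subseteq> carrier M" using E(2) by simp
    define p where "p = col M P \<union> E"
    have le: "delta M X \<le> delta M P + K - \<alpha> * card E" using Km(3) dP E(4) by simp
    have rec: "good (recolor M p)" "closed_in L T \<alpha> (recolor M p) X (P \<union> E)"
      unfolding p_def
      by (rule recolor_generic[OF gM X P \<open>card (P - X) < r\<close> E(1) E' E(3) gen le]; assumption)+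
    define D where "D = Wt \<union> E"
    have D: "finite D" "D \<inter> X = {}" "D \<subseteq> carrier M"
      using Wt E E' P(3) by (auto simp: D_def)
    have XD: "X \<union> D = P \<union> E" by (auto simp: D_def P_def)
    have EX: "x \<notin> acl L ?M X" if x: "x \<in> E" for x
    proof -
      have "dm ?M X \<le> dm ?M P" using M.rk_mono[OF P(3)] P by simp
      then have "dm ?M (X \<union> {x}) = dm ?M X + 1"
        using gen[OF P(3), of "{x}"] x Km(1) by simp
      then show ?thesis using M.rk_insert[of X x] X' x E' by (auto split: if_splits)
    qed
    have trans: "x \<notin> acl L ?M X" if "x \<in> D" for x
      using that EX by (auto simp: D_def Wt_def)
    obtain h where h: "elementary_on L ?M ?N (X \<union> D \<union> Wa) h" "\<And>x. x \<in> X \<Longrightarrow> h x = f x"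
      "\<And>x. x \<in> D \<Longrightarrow> colored N (h x) \<longleftrightarrow> x \<in> p"
      using realize_recolored[OF M N rec(1) X'(1) f D _ trans Wa(1,2)] rec(2) XD by metis
    define Y where "Y = X \<union> W"
    have Y: "Y = P \<union> Wa" "finite Y" "Y \<subseteq> carrier M" using XW X' W unfolding Y_def by blast+
    have Z: "X \<union> D \<union> Wa = Y \<union> E" using XD Y by auto
    note hel = h(1)[unfolded Z]
    have EY: "E \<inter> Y = {}" using E(3) EX Wa(3) Y(1) by blast
    have hX: "h ` X = f ` X" by (rule image_cong[OF refl h(2)])
    have two: "2 \<le> r" by (simp add: r_def)
    \<comment> \<open>Closedness is used on both sides: that of \<open>X\<close> in \<open>M\<close>
      and that of its image in \<open>N\<close>.\<close>
    have Wa_unc: "\<not> colored M x" "\<not> colored N (h x)" if x: "x \<in> Wa" for x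
    proof -
      have xX: "x \<in> acl L ?M X" "x \<notin> X" using x Wa by blast+
      show "\<not> colored M x" by (rule rclosed_acl_uncolored[OF MT X two xX])
      have xY: "x \<in> Y \<union> E" "X \<subseteq> Y \<union> E" using x Y(1) by (auto simp: Y_def)
      have "h x \<in> acl L ?N (h ` X)" using elementary_on_acl[OF MT NT hel xY(2,1)] xX(1) by simp
      moreover have "h x \<notin> h ` X"
      proof
        assume "h x \<in> h ` X"
        then obtain y where y: "h x = h y" "y \<in> X" by (rule imageE)
        have "x = y" by (rule inj_onD[OF elementary_on_inj[OF hel] y(1) xY(1)]) (use y xY in blast)
        then show False using xX y by simp
      qed
      ultimately show "\<not> colored N (h x)"
        unfolding hX by (rule rclosed_acl_uncolored[OF NT fX two])
    qed
    have hY: "cmap M N Y h"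
      unfolding cmap_def
    proof (intro conjI ballI)
      show "elementary_on L ?M ?N Y h" by (rule elementary_on_subset[OF hel]) simp
      fix x assume "x \<in> Y"
      then consider "x \<in> X" | "x \<in> Wt" | "x \<in> Wa" by (auto simp: Y(1) P_def)
      then show "colored M x \<longleftrightarrow> colored N (h x)"
      proof cases
        case 1
        then show ?thesis using cmapD(5)[OF f] h(2) by simp
      next
        case 2
        then have "x \<in> p \<longleftrightarrow> colored M x" using E(3) by (auto simp: p_def P_def)
        then show ?thesis using h(3)[of x] 2 by (simp add: D_def)
      next
        case 3
        then show ?thesis using Wa_unc by simp
      qed
    qed
    have hYE: "h ` (Y \<union> E) \<subseteq> carrier N" using elementary_on_carrier(2)[OF hel] by simp
    have hYc: "finite (h ` Y)" "h ` Y \<subseteq> carrier N" "finite (h ` E)" "h ` E \<subseteq> carrier N"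
      using Y(2) E(1) hYE by (auto simp: image_Un)
    have inj: "inj_on h (Y \<union> E)" by (rule elementary_on_inj[OF hel])
    \<comment> \<open>\<open>Wa\<close> does not change ranks, so the general position of
      \<open>E\<close> over \<open>P\<close> becomes that of its copy over the image of
      \<open>Y\<close>.\<close>
    have dmYQ: "dm ?N (h ` Y \<union> h ` Q) = min (dm ?M P + card Q) (dm ?M P + K)" if Q: "Q \<subseteq> E" for Q
    proof -
      have fin: "finite Q" "Q \<subseteq> carrier M" using finite_subset[OF Q E(1)] Q E' by auto
      have 1: "dm ?N (h ` (Y \<union> Q)) = dm ?M (Y \<union> Q)"
        by (rule elementary_on_dm[OF MT NT hel]) (use Y(2) fin Q in auto)
      have 2: "Y \<union> Q = (P \<union> Q) \<union> Wa" using Y(1) by blast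
      have 3: "dm ?M ((P \<union> Q) \<union> Wa) = dm ?M (P \<union> Q)"
      proof (rule M.rk_Un_cl)
        have "acl L ?M X \<subseteq> acl L ?M (P \<union> Q)" by (rule M.cl_mono) (use P(3) in blast)
        with Wa(3) show "Wa \<subseteq> acl L ?M (P \<union> Q)" by (rule subset_trans)
      qed (use P fin Wa in auto)
      show ?thesis unfolding image_Un[symmetric] 1 unfolding 2 3 by (rule gen[OF order_refl Q])
    qed
    have dmY: "dm ?N (h ` Y) = dm ?M P" using dmYQ[of "{}"] by simp
    have disj: "h ` Y \<inter> h ` E = {}"
      using inj_on_image_Int[OF inj, of Y E] EY by auto
    have colhE: "col N (h ` E) = h ` E"
      using h(3) by (auto simp: D_def p_def)
    have "card (col N (h ` Y)) = card (col M P)"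
    proof -
      have "col N (h ` Y) = h ` col M Y" using cmapD(5)[OF hY] by auto
      moreover have "col M Y = col M P" using Wa_unc(1) Y(1) by auto
      moreover have "inj_on h (col M P)" using inj Y(1) by (auto intro: inj_on_subset)
      ultimately show ?thesis by (simp add: card_image)
    qed
    moreover have "card (col N (h ` Y \<union> h ` E)) = card (col N (h ` Y)) + m"
    proof -
      have "h ` E - h ` Y = h ` E" using disj by blast
      moreover have "card (h ` E) = m" using E(4) inj by (metis card_image inj_on_Un)
      ultimately show ?thesis using card_col_diff[OF hYc(1,3), of N] colhE by simp
    qed
    moreover have "dm ?N (h ` Y \<union> h ` E) = dm ?M P + K" using dmYQ[of E] E(4) mK by simp
    ultimately have "delta N (h ` Y \<union> h ` E) = delta M P + K - \<alpha> * m"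
      by (simp add: delta_def algebra_simps)
    also have "\<dots> < delta M X + \<epsilon>" using Km(4) dP by simp
    also have "delta M X = delta N (f ` X)"
      by (rule cmap_delta[OF MT NT f X'(1) order_refl, symmetric])
    finally have small: "delta N (h ` Y \<union> h ` E) < delta N (f ` X) + \<epsilon>" .
    have "delta N (h ` Y) \<le> delta N (h ` Y \<union> C)"
      if C: "finite C" "C \<subseteq> carrier N" "card (C - h ` Y) < n" for C
    proof (rule ccontr)
      assume "\<not> ?thesis"
      then have 1: "delta N (h ` Y \<union> C) \<le> delta N (h ` Y) - \<epsilon>"
        using \<epsilon>(3)[OF NT hYc(1,2) C] by simp
      \<comment> \<open>The overlap of \<open>C\<close> with the copy of \<open>E\<close> has fewer
        than \<open>n\<close> points and is therefore independent over the image of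
        \<open>Y\<close>. By \<open>delta_small_subset_generic\<close> it lowers nothing, which
        controls the intersection term in the submodular inequality.\<close>
      obtain Q where Q: "Q \<subseteq> E" "C \<inter> h ` E = h ` Q"
        by (metis inf_le2 subset_imageE)
      have hQ: "h ` Q \<subseteq> h ` E" "finite (h ` Q)" using Q(1) finite_subset[OF Q(1) E(1)] by auto
      have cQ: "card (h ` Q) = card Q"
        by (rule card_image) (rule inj_on_subset[OF inj], use Q(1) in blast)
      have "h ` Q \<subseteq> C - h ` Y" using Q(2) disj hQ(1) by blast
      then have "card (h ` Q) \<le> card (C - h ` Y)" using C(1) by (intro card_mono) auto
      then have "card Q \<le> K" using cQ C(3) Km(1) by simp
      then have dQ: "dm ?N (h ` Y \<union> h ` Q) = dm ?N (h ` Y) + card (h ` Q)"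
        using dmYQ[OF Q(1)] dmY cQ by simp
      have 2: "delta N (h ` Y) \<le> delta N (h ` Y \<union> h ` Q)"
        by (rule delta_small_subset_generic[OF NT hYc(1,2) hQ(2) _ _ dQ]) (use hQ hYc disj in blast)+
      have 3: "delta N ((h ` Y \<union> h ` E) \<union> (h ` Y \<union> C)) + delta N ((h ` Y \<union> h ` E) \<inter> (h ` Y \<union> C)) \<le>
          delta N (h ` Y \<union> h ` E) + delta N (h ` Y \<union> C)"
        by (rule delta_submodular[OF NT]) (use hYc C in auto)
      have int: "(h ` Y \<union> h ` E) \<inter> (h ` Y \<union> C) = h ` Y \<union> h ` Q" using Q(2) by blast
      let ?T = "(h ` Y \<union> h ` E) \<union> (h ` Y \<union> C)"
      \<comment> \<open>The loss of at least \<open>\<epsilon>\<close> caused by \<open>C\<close>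
        exceeds the slack left by the copy of \<open>E\<close>.\<close>
      have lt: "delta N ?T < delta N (f ` X)" using 1 2 3 small unfolding int by linarith
      have T: "finite ?T" "?T \<subseteq> carrier N" using hYc C by auto
      have "?T - f ` X \<subseteq> h ` W \<union> (h ` E \<union> (C - h ` Y))"
        using hX by (auto simp: Y_def)
      then have "card (?T - f ` X) \<le> card (h ` W \<union> (h ` E \<union> (C - h ` Y)))"
        using W(1) E(1) C(1) by (intro card_mono) auto
      also have "\<dots> \<le> card (h ` W) + card (h ` E \<union> (C - h ` Y))" by (rule card_Un_le)
      also have "\<dots> \<le> card (h ` W) + (card (h ` E) + card (C - h ` Y))"
        using card_Un_le[of "h ` E" "C - h ` Y"] by simp
      also have "\<dots> < r"
        using card_image_le[OF W(1), of h] card_image_le[OF E(1), of h] W(3) E(4) Km(2) C(3)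
        by (simp add: r_def)
      finally have cT: "card (?T - f ` X) < r" .
      have "delta N (f ` X) \<le> delta N (f ` X \<union> ?T)"
        using fX[unfolded rclosed_def, THEN conjunct2, THEN conjunct2, THEN spec, THEN mp,
            OF conjI[OF T(1) conjI[OF T(2) cT]]] .
      moreover have "f ` X \<union> ?T = ?T" unfolding hX[symmetric] by (auto simp: Y_def)
      ultimately show False using lt by simp
    qed
    then have "rclosed n N (h ` Y)" using hYc by (simp add: rclosed_def)
    then show "\<exists>h. cmap M N (X \<union> W) h \<and> (\<forall>x\<in>X. h x = f x) \<and> rclosed n N (h ` (X \<union> W))"
      using hY h(2) unfolding Y_def by blast
  qed
qed

text \<open>\<open>A'\<close> may be smaller than \<open>insert c A\<close>, since assigning
  \<open>c\<close> to a variable can drop its old value. The new map is obtained from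
  \<open>f\<close> on a core \<open>X\<close> containing \<open>A\<close>; elsewhere in the closure
  it may differ from \<open>f\<close>.\<close>

lemma extension_step:
  obtains k where "\<And>M N A f c A'. Tmodel M \<Longrightarrow> Tmodel N \<Longrightarrow> finite A \<Longrightarrow> card A \<le> m \<Longrightarrow>
    A \<subseteq> carrier M \<Longrightarrow> cmap M N (ncl M k A) f \<Longrightarrow> f ` ncl M k A = ncl N k (f ` A) \<Longrightarrow>
    c \<in> carrier M \<Longrightarrow> A' \<subseteq> insert c A \<Longrightarrow>
    \<exists>h. cmap M N (ncl M n A') h \<and> h ` ncl M n A' = ncl N n (h ` A') \<and> (\<forall>a\<in>A. h a = f a) \<and>
      h c \<in> carrier N"
proof -
  obtain s where s: "\<And>M A. good M \<Longrightarrow> finite A \<Longrightarrow> A \<subseteq> carrier M \<Longrightarrow> card A \<le> Suc m \<Longrightarrow>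
    \<exists>V. A \<subseteq> V \<and> rclosed n M V \<and> card V \<le> s"
    using rclosed_exists[of "Suc m" n] by metis
  obtain r where r: "\<And>M N X f W. Tmodel M \<Longrightarrow> Tmodel N \<Longrightarrow> cmap M N X f \<Longrightarrow> rclosed r M X \<Longrightarrow>
    rclosed r N (f ` X) \<Longrightarrow> finite W \<Longrightarrow> W \<subseteq> carrier M \<Longrightarrow> card W \<le> s \<Longrightarrow>
    \<exists>h. cmap M N (X \<union> W) h \<and> (\<forall>x\<in>X. h x = f x) \<and> rclosed n N (h ` (X \<union> W))"
    using extend_closed[of s n] by metis
  obtain R where R: "\<And>M A. good M \<Longrightarrow> finite A \<Longrightarrow> A \<subseteq> carrier M \<Longrightarrow> card A \<le> m \<Longrightarrow>
    \<exists>V. A \<subseteq> V \<and> rclosed r M V \<and> card V \<le> R"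
    using rclosed_exists[of m r] by metis
  show ?thesis
  proof (rule that[of "R + r + 1"])
    \<comment> \<open>\<open>R\<close> bounds the size of the core, which thereby lies in the
      closure of \<open>A\<close>; the summand \<open>r\<close> serves to transfer its closedness to
      \<open>N\<close>.\<close>
    let ?k = "R + r + 1"
    fix M N A f c A'
    assume M: "Tmodel M" and N: "Tmodel N" and A: "finite A" "card A \<le> m" "A \<subseteq> carrier M"
      and f: "cmap M N (ncl M ?k A) f" "f ` ncl M ?k A = ncl N ?k (f ` A)"
      and c: "c \<in> carrier M" and A': "A' \<subseteq> insert c A"
    have gM: "good M" using Tmodel_good M .
    have MT: "models L T (reduct M)" and NT: "models L T (reduct N)"
      using Tmodel_models M N by auto
    obtain X0 where X0: "A \<subseteq> X0" "rclosed r M X0" "card X0 \<le> R" using R[OF gM A(1,3,2)] by blast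
    obtain X where X: "A \<subseteq> X" "X \<subseteq> X0" "intr M A X" "rclosed r M X"
      using rclosed_core[OF MT X0(2,1)] by blast
    have X0': "finite X0" using X0(2) by (simp add: rclosed_def)
    have X': "finite X" "X \<subseteq> carrier M" using X(4) by (auto simp: rclosed_def)
    have cX: "card X \<le> R" using card_mono[OF X0' X(2)] X0(3) by simp
    have "card (X - A) \<le> card X" using X'(1) by (intro card_mono) auto
    then have "card (X - A) < ?k" using cX by simp
    then have Xcl: "X \<subseteq> ncl M ?k A" by (rule intr_subset_ncl[OF MT X'(2) X(3)])
    have fX: "rclosed r N (f ` X)"
      by (rule cmap_rclosed[OF MT NT f X(1) Xcl X(3,4)]) (use cX in simp)
    have "card (insert c A) \<le> Suc m" using A(1,2) card_insert_le_m1[of "Suc m" A c] by simp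
    then obtain V where V: "insert c A \<subseteq> V" "rclosed n M V" "card V \<le> s"
      using s[OF gM, of "insert c A"] A c by auto
    have V': "finite V" "V \<subseteq> carrier M" using V(2) by (auto simp: rclosed_def)
    obtain h where h: "cmap M N (X \<union> V) h" "\<forall>x\<in>X. h x = f x" "rclosed n N (h ` (X \<union> V))"
      using r[OF M N cmap_subset[OF f(1) Xcl] X(4) fX V' V(3)] by blast
    have A'V: "A' \<subseteq> V" using A' V(1) by (rule subset_trans)
    have cl1: "ncl M n A' \<subseteq> X \<union> V" using ncl_subset_rclosed[OF MT V(2) A'V] by blast
    have A'Z: "A' \<subseteq> X \<union> V" using A'V by blast
    then have cl2: "ncl N n (h ` A') \<subseteq> h ` (X \<union> V)"
      by (intro ncl_subset_rclosed[OF NT h(3)] image_mono)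
    have "h ` ncl M n A' = ncl N n (h ` A')" by (rule cmap_ncl[OF MT NT h(1) A'Z cl1 cl2])
    moreover have "cmap M N (ncl M n A') h" by (rule cmap_subset[OF h(1) cl1])
    moreover have "\<forall>a\<in>A. h a = f a" using h(2) X(1) by blast
    moreover have "h c \<in> carrier N" using cmapD(3)[OF h(1)] V(1) by blast
    ultimately show "\<exists>h. cmap M N (ncl M n A') h \<and> h ` ncl M n A' = ncl N n (h ` A') \<and>
        (\<forall>a\<in>A. h a = f a) \<and> h c \<in> carrier N" by blast
  qed
qed

end

section \<open>Preservation of formulas\<close>

context colored_base
begin

text \<open>Indexed by a set of variables rather than by a tuple, because a quantifier changes the
  assignment at a variable that may or may not already be in use.\<close>

definition similar ::
    "nat \<Rightarrow> nat set \<Rightarrow> ('f, 'r option, 'u) fo_struct \<Rightarrow> ('f, 'r option, 'u) fo_struct \<Rightarrow>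
     (nat \<Rightarrow> 'u) \<Rightarrow> (nat \<Rightarrow> 'u) \<Rightarrow> bool" where
  "similar n V M N e1 e2 \<longleftrightarrow> Tmodel M \<and> Tmodel N \<and> e1 ` V \<subseteq> carrier M \<and>
     (\<exists>f. cmap M N (ncl M n (e1 ` V)) f \<and>
        f ` ncl M n (e1 ` V) = ncl N n (e2 ` V) \<and> (\<forall>v\<in>V. f (e1 v) = e2 v))"

lemma ncl_mono:
  assumes "models L T (reduct M)" "n \<le> n'"
  shows "ncl M n A \<subseteq> ncl M n' A"
  unfolding in_ncl[OF assms(1)] by (rule Union_mono) (use assms(2) in auto)

text \<open>The same map restricts: the smaller closures are determined by \<open>delta\<close>
  inside the larger ones, so \<open>cmap_ncl\<close> matches them.\<close>

lemma similar_mono: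
  assumes "similar n' V M N e1 e2" "n \<le> n'" "0 < n" "finite V"
  shows "similar n V M N e1 e2"
proof -
  obtain f where f: "Tmodel M" "Tmodel N" "e1 ` V \<subseteq> carrier M" "cmap M N (ncl M n' (e1 ` V)) f"
    "f ` ncl M n' (e1 ` V) = ncl N n' (e2 ` V)" "\<forall>v\<in>V. f (e1 v) = e2 v"
    using assms(1) by (auto simp: similar_def)
  note MT = Tmodel_models[OF f(1)] and NT = Tmodel_models[OF f(2)]
  have im: "f ` e1 ` V = e2 ` V" unfolding image_image by (rule image_cong) (use f(6) in auto)
  have sub: "e1 ` V \<subseteq> ncl M n' (e1 ` V)"
    by (rule subset_ncl) (use assms f(3) MT in auto)
  have "f ` ncl M n (e1 ` V) = ncl N n (f ` e1 ` V)"
  proof (rule cmap_ncl[OF MT NT f(4) sub ncl_mono[OF MT assms(2)]])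
    show "ncl N n (f ` e1 ` V) \<subseteq> f ` ncl M n' (e1 ` V)"
      unfolding im f(5) by (rule ncl_mono[OF NT assms(2)])
  qed
  then show ?thesis
    using f cmap_subset[OF f(4) ncl_mono[OF MT assms(2)]] unfolding im similar_def by blast
qed

lemma similar_sym:
  assumes s: "similar n V M N e1 e2" and n: "0 < n" "finite V"
  shows "similar n V N M e2 e1"
proof -
  obtain f where f: "Tmodel M" "Tmodel N" "e1 ` V \<subseteq> carrier M" "cmap M N (ncl M n (e1 ` V)) f"
    "f ` ncl M n (e1 ` V) = ncl N n (e2 ` V)" "\<forall>v\<in>V. f (e1 v) = e2 v"
    using s by (auto simp: similar_def)
  let ?Z = "ncl M n (e1 ` V)"
  have sub: "e1 ` V \<subseteq> ?Z" by (rule subset_ncl) (use n f(3) Tmodel_models[OF f(1)] in auto)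
  have inj: "inj_on f ?Z" by (rule cmapD(4)[OF f(4)])
  have "cmap N M (ncl N n (e2 ` V)) (inv_into ?Z f)" using cmap_inv[OF f(4)] f(5) by simp
  moreover have "inv_into ?Z f ` ncl N n (e2 ` V) = ?Z"
    unfolding f(5)[symmetric] by (rule inv_into_image_cancel[OF inj order_refl])
  moreover have "\<forall>v\<in>V. inv_into ?Z f (e2 v) = e1 v"
  proof
    fix v assume v: "v \<in> V"
    then have "e1 v \<in> ?Z" using sub by blast
    then show "inv_into ?Z f (e2 v) = e1 v" using inv_into_f_f[OF inj] f(6) v by metis
  qed
  moreover have "e2 ` V \<subseteq> carrier N" using f(6) sub cmapD(3)[OF f(4)] by fastforce
  ultimately show ?thesis using f(1,2) unfolding similar_def by blast
qed

text \<open>Such a point, if not in \<open>A\<close>, lowers \<open>delta\<close> by \<alpha> and so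
  forms an intrinsic extension by a single point. This is why closures with bound 2 already decide
  colored atoms.\<close>

lemma colored_acl_in_ncl:
  assumes M: "models L T (reduct M)" and A: "finite A" "A \<subseteq> carrier M"
    and y: "y \<in> acl L (reduct M) A" "colored M y"
  shows "y \<in> ncl M 2 A"
proof (cases "y \<in> A")
  case True
  then show ?thesis using subset_ncl[OF A _ M, of 2] by auto
next
  case False
  have yc: "y \<in> carrier M" using y(1) acl_subset_carrier[of "reduct M" A] by auto
  have "intr M A (insert y A)"
    unfolding intr_def
  proof (intro conjI allI impI)
    show "finite (insert y A)" "A \<subseteq> insert y A" using A by auto
    fix A' assume "A \<subseteq> A' \<and> A' \<subset> insert y A"
    then have "A' = A" by blast
    then show "delta M (insert y A) < delta M A'"
      using delta_insert_colored[OF M A y(1) False y(2)] \<alpha>_pos by simp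
  qed
  moreover have "insert y A - A = {y}" using False by blast
  then have "card (insert y A - A) < 2" by simp
  moreover have "insert y A \<subseteq> carrier M" using A yc by blast
  ultimately have "insert y A \<subseteq> ncl M 2 A" by (intro intr_subset_ncl[OF M])
  then show ?thesis by blast
qed

text \<open>The colored values of terms at \<open>A\<close> lie in the algebraic closure of \<open>A\<close>, hence in
  \<open>ncl M 2 A\<close>.\<close>

lemma similar_color_atom:
  assumes s: "similar 2 V M N e1 e2" and V: "finite V" and t: "wf_tm L t" "tvars t \<subseteq> V"
    and c: "colored M (eval M e1 t)"
  shows "colored N (eval N e2 t)"
proof -
  obtain f where f: "Tmodel M" "Tmodel N" "e1 ` V \<subseteq> carrier M" "cmap M N (ncl M 2 (e1 ` V)) f"
    "\<forall>v\<in>V. f (e1 v) = e2 v"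
    using s by (auto simp: similar_def)
  have MT: "models L T (reduct M)" using Tmodel_models[OF f(1)] .
  let ?A = "e1 ` V" and ?x = "eval M e1 t"
  have A: "finite ?A" "?A \<subseteq> carrier M" using V f(3) by auto
  \<comment> \<open>The value of the term need not lie in \<open>A\<close>. A fresh variable
    \<open>v\<close> names it, so that elementarity can be applied to the equation between
    \<open>v\<close> and \<open>t\<close>.\<close>
  obtain v where v: "v \<notin> V" using ex_new_if_finite[OF infinite_UNIV_nat V] by blast
  have vt: "v \<notin> tvars t" using v t(2) by blast
  have ev: "eval M' (e(v := y)) t = eval M' e t" for M' :: "('f, 'r, 'u) fo_struct" and e y
    by (rule eval_cong) (use vt in auto)
  have "embedding L (reduct M) (reduct M) id" by (simp add: embedding_def)
  then have xc: "?x \<in> carrier M"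
    using embedding_eval[of L "reduct M" "reduct M" id t e1] MT t f(3)
    by (auto simp: eval_reduct tuples_def models_def is_struct_def)
  have "?x \<in> acl L (reduct M) ?A"
  proof (rule acl_var[of "Eq (Var v) t" e1 v])
    show "wf_fm L (Eq (Var v) t)" using t by simp
    show "e1 ` (FV (Eq (Var v) t) - {v}) \<subseteq> ?A" using t(2) by auto
    show "?x \<in> carrier (reduct M)" using xc by simp
    have s: "sat (reduct M) (e1(v := y)) (Eq (Var v) t) \<longleftrightarrow> y = ?x" for y
      by (simp add: ev eval_reduct)
    show "sat (reduct M) (e1(v := ?x)) (Eq (Var v) t)" unfolding s by simp
    show "finite {y \<in> carrier (reduct M). sat (reduct M) (e1(v := y)) (Eq (Var v) t)}"
      unfolding s by (rule finite_subset[of _ "{?x}"]) auto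
  qed
  then have x: "?x \<in> ncl M 2 ?A" by (rule colored_acl_in_ncl[OF MT A _ c])
  have sub: "?A \<subseteq> ncl M 2 ?A" by (rule subset_ncl[OF A _ MT]) simp
  have "sat (reduct M) (e1(v := ?x)) (Eq (Var v) t) \<longleftrightarrow>
      sat (reduct N) (f \<circ> e1(v := ?x)) (Eq (Var v) t)"
  proof (rule elementary_onD[OF cmapD(1)[OF f(4)]])
    show "wf_fm L (Eq (Var v) t)" using t by simp
    have "(e1(v := ?x)) w \<in> ncl M 2 ?A" if "w \<in> insert v (tvars t)" for w
      using that x sub t(2) by (cases "w = v") auto
    moreover have "FV (Eq (Var v) t) = insert v (tvars t)" by simp
    ultimately show "e1(v := ?x) ` FV (Eq (Var v) t) \<subseteq> ncl M 2 ?A"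
      by (simp only: image_subset_iff) blast
  qed
  then have "f ?x = eval N (f \<circ> e1) t"
    by (simp add: ev eval_reduct fun_upd_comp)
  also have "\<dots> = eval N e2 t"
    by (rule eval_cong) (use f(5) t(2) in auto)
  finally show ?thesis using cmapD(5)[OF f(4) x] c by simp
qed

lemma similar_lift:
  assumes s: "similar n V M N e1 e2" and n: "0 < n" "finite V" and \<theta>: "wf_fm L \<theta>" "FV \<theta> \<subseteq> V"
  shows "sat M e1 (lift_fm \<theta>) \<longleftrightarrow> sat N e2 (lift_fm \<theta>)"
proof -
  obtain f where f: "Tmodel M" "e1 ` V \<subseteq> carrier M" "cmap M N (ncl M n (e1 ` V)) f"
    "\<forall>v\<in>V. f (e1 v) = e2 v"
    using s by (auto simp: similar_def)
  have sub: "e1 ` V \<subseteq> ncl M n (e1 ` V)"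
    by (rule subset_ncl) (use n f(2) Tmodel_models[OF f(1)] in auto)
  have "sat (reduct M) e1 \<theta> \<longleftrightarrow> sat (reduct N) (f \<circ> e1) \<theta>"
  proof (rule elementary_onD[OF cmapD(1)[OF f(3)] \<theta>(1)])
    show "e1 ` FV \<theta> \<subseteq> ncl M n (e1 ` V)" using image_mono[OF \<theta>(2), of e1] sub by (rule subset_trans)
  qed
  also have "\<dots> \<longleftrightarrow> sat (reduct N) e2 \<theta>"
    by (rule sat_cong) (use f(4) \<theta>(2) in auto)
  finally show ?thesis by (simp add: sat_lift_fm)
qed

text \<open>The bound 2 keeps assigned points inside their closure and settles colored atoms.
  \<open>n\<close> depends on \<open>V\<close> as well as on \<open>\<phi>\<close>, because the
  extension step needs a bound on the number of assigned points; \<open>V\<close> may exceed the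
  free variables so that the induction can add the quantified one.\<close>

lemma similar_preserves:
  "wf_fm (colored_language L) \<phi> \<Longrightarrow> finite V \<Longrightarrow> FV \<phi> \<subseteq> V \<Longrightarrow>
     \<exists>n\<ge>2. \<forall>M N e1 e2. similar n V M N e1 e2 \<longrightarrow> (sat M e1 \<phi> \<longleftrightarrow> sat N e2 \<phi>)"
proof (induction \<phi> arbitrary: V)
  case Fls
  then show ?case by auto
next
  case (Eq s t)
  have eq: "lift_fm (Eq s t) = Eq s t" by (simp add: tm.map_id)
  have "wf_fm L (Eq s t)" "FV (Eq s t :: ('f, 'r) fm) \<subseteq> V"
    using Eq.prems wf_lift_fm[of L "Eq s t"] by (simp_all add: tm.map_id)
  then show ?case
    using similar_lift[of 2 V _ _ _ _ "Eq s t"] Eq.prems(2) unfolding eq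
    by (intro exI[of _ 2]) (metis order_refl zero_less_numeral)
next
  case (Rel r ts)
  show ?case
  proof (cases r)
    case None
    then obtain t where t: "ts = [t]" "wf_tm (colored_language L) t"
      using Rel.prems(1) by (auto simp: colored_language_def length_Suc_conv)
    have "wf_tm L t" using t(2) wf_lift_fm[of L "Eq t t"] by (simp add: tm.map_id)
    moreover have "tvars t \<subseteq> V" using Rel.prems(3) t(1) by simp
    ultimately have "sat M e1 (Rel r ts) \<longleftrightarrow> sat N e2 (Rel r ts)" if "similar 2 V M N e1 e2" for M N e1 e2
      using similar_color_atom[OF that Rel.prems(2)]
        similar_color_atom[OF similar_sym[OF that _ Rel.prems(2)] Rel.prems(2)]
      unfolding None t(1) by (auto simp: colored_def)
    then show ?thesis by blast
  next
    case (Some q)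
    have eq: "lift_fm (Rel q ts) = Rel r ts" using Some by (simp add: tm.map_id0)
    then have "wf_fm L (Rel q ts)" "FV (Rel q ts :: ('f, 'r) fm) \<subseteq> V"
      using Rel.prems wf_lift_fm[of L "Rel q ts"] by simp_all
    then show ?thesis
      using similar_lift[of 2 V _ _ _ _ "Rel q ts"] Rel.prems(2) unfolding eq
      by (intro exI[of _ 2]) (metis order_refl zero_less_numeral)
  qed
next
  case (Imp \<phi> \<psi>)
  obtain n1 where n1: "n1 \<ge> 2" "\<forall>M N e1 e2. similar n1 V M N e1 e2 \<longrightarrow> (sat M e1 \<phi> \<longleftrightarrow> sat N e2 \<phi>)"
    using Imp.IH(1)[of V] Imp.prems by auto
  obtain n2 where n2: "n2 \<ge> 2" "\<forall>M N e1 e2. similar n2 V M N e1 e2 \<longrightarrow> (sat M e1 \<psi> \<longleftrightarrow> sat N e2 \<psi>)"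
    using Imp.IH(2)[of V] Imp.prems by auto
  have "sat M e1 (Imp \<phi> \<psi>) \<longleftrightarrow> sat N e2 (Imp \<phi> \<psi>)" if s: "similar (max n1 n2) V M N e1 e2" for M N e1 e2
  proof -
    have "similar n1 V M N e1 e2" "similar n2 V M N e1 e2"
      using similar_mono[OF s _ _ Imp.prems(2)] n1(1) n2(1) by auto
    then show ?thesis using n1(2) n2(2) by simp
  qed
  then show ?case using n1(1) by (intro exI[of _ "max n1 n2"]) auto
next
  case (All x \<phi>)
  let ?V = "insert x V"
  have "FV \<phi> \<subseteq> ?V" using All.prems(3) by auto
  then obtain n where n: "n \<ge> 2"
    "\<And>M N e1 e2. similar n ?V M N e1 e2 \<Longrightarrow> sat M e1 \<phi> \<longleftrightarrow> sat N e2 \<phi>"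
    using All.IH[of ?V] All.prems by auto
  obtain k where k: "\<And>M N A f c A'. Tmodel M \<Longrightarrow> Tmodel N \<Longrightarrow> finite A \<Longrightarrow> card A \<le> card V \<Longrightarrow>
    A \<subseteq> carrier M \<Longrightarrow> cmap M N (ncl M k A) f \<Longrightarrow> f ` ncl M k A = ncl N k (f ` A) \<Longrightarrow>
    c \<in> carrier M \<Longrightarrow> A' \<subseteq> insert c A \<Longrightarrow>
    \<exists>h. cmap M N (ncl M n A') h \<and> h ` ncl M n A' = ncl N n (h ` A') \<and> (\<forall>a\<in>A. h a = f a) \<and>
      h c \<in> carrier N"
    using extension_step[of "card V" n] by metis
  \<comment> \<open>One direction suffices, as similarity is symmetric. The summand 2 guarantees the
    lower bound on \<open>n\<close> whatever \<open>k\<close> is.\<close>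
  have dir: "sat N e2 (All x \<phi>) \<Longrightarrow> sat M e1 (All x \<phi>)"
    if s: "similar (k + 2) V M N e1 e2" for M N e1 e2
  proof -
    assume all: "sat N e2 (All x \<phi>)"
    show "sat M e1 (All x \<phi>)"
      unfolding sat.simps
    proof
      fix c assume c: "c \<in> carrier M"
      obtain f where f: "Tmodel M" "Tmodel N" "e1 ` V \<subseteq> carrier M"
        "cmap M N (ncl M (k + 2) (e1 ` V)) f"
        "f ` ncl M (k + 2) (e1 ` V) = ncl N (k + 2) (e2 ` V)" "\<forall>v\<in>V. f (e1 v) = e2 v"
        using s by (auto simp: similar_def)
      note MT = Tmodel_models[OF f(1)] and NT = Tmodel_models[OF f(2)]
      have im: "f ` e1 ` V = e2 ` V" unfolding image_image by (rule image_cong) (use f(6) in auto)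
      have sub: "e1 ` V \<subseteq> ncl M (k + 2) (e1 ` V)"
        by (rule subset_ncl) (use All.prems(2) f(3) MT in auto)
      have le: "k \<le> k + 2" by simp
      have clk: "f ` ncl M k (e1 ` V) = ncl N k (f ` e1 ` V)"
      proof (rule cmap_ncl[OF MT NT f(4) sub ncl_mono[OF MT le]])
        show "ncl N k (f ` e1 ` V) \<subseteq> f ` ncl M (k + 2) (e1 ` V)"
          unfolding im f(5) by (rule ncl_mono[OF NT le])
      qed
      let ?e = "e1(x := c)"
      have A: "finite (e1 ` V)" "card (e1 ` V) \<le> card V"
        using All.prems(2) card_image_le by auto
      have A': "?e ` ?V \<subseteq> insert c (e1 ` V)" by auto
      obtain h where h: "cmap M N (ncl M n (?e ` ?V)) h"
        "h ` ncl M n (?e ` ?V) = ncl N n (h ` ?e ` ?V)" "\<forall>a\<in>e1 ` V. h a = f a" "h c \<in> carrier N"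
        using k[OF f(1,2) A f(3) cmap_subset[OF f(4) ncl_mono[OF MT le]] clk c A'] by blast
      have he: "h (?e v) = (e2(x := h c)) v" if "v \<in> ?V" for v
        using that h(3) f(6) by auto
      have im': "h ` ?e ` ?V = (e2(x := h c)) ` ?V" unfolding image_image by (rule image_cong[OF refl he])
      have "?e ` ?V \<subseteq> carrier M" using f(3) c by auto
      then have "similar n ?V M N ?e (e2(x := h c))"
        unfolding similar_def
        by (intro conjI exI[of _ h] ballI f(1,2) h(1) h(2)[unfolded im'] he)
      then show "sat M (e1(x := c)) \<phi>" using n(2) all h(4) by simp
    qed
  qed
  have "sat M e1 (All x \<phi>) \<longleftrightarrow> sat N e2 (All x \<phi>)" if s: "similar (k + 2) V M N e1 e2" for M N e1 e2
    using dir[OF s] dir[OF similar_sym[OF s _ All.prems(2)]] by auto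
  then show ?case by (intro exI[of _ "k + 2"]) simp
qed

end

theorem theorem3p4p5:
  fixes L :: "('f, 'r) language"
    and T :: "('f, 'r) fm set"
    and \<alpha> :: real
    and M1 M2 :: "('f, 'r option, 'u) fo_struct"
    and \<phi> :: "('f, 'r option) fm"
    and m :: nat
  assumes "countable_language L"
    and "complete_theory TYPE('u) L T"
    and "no_finite_models TYPE('u) L T"
    and "quantifier_elimination TYPE('u) L T"
    and "geometric_theory TYPE('u) L T"
    and "indecomposable TYPE('u) L T"
    and "free_amalgamation TYPE('u) L T"
    and "0 < \<alpha>" and "\<alpha> \<le> 1" and "\<alpha> \<notin> \<rat>"
    and "models_T_alpha L T \<alpha> M1" and "aleph1_saturated (colored_language L) M1"
    and "models_T_alpha L T \<alpha> M2" and "aleph1_saturated (colored_language L) M2"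
    and "wf_fm (colored_language L) \<phi>" and "FV \<phi> \<subseteq> {..<m}"
  shows "\<exists>n. \<forall>a1\<in>tuples M1 m. \<forall>a2\<in>tuples M2 m.
           (\<exists>f. weak_isomorphism L M1 M2
                  (n_closure L T \<alpha> M1 n (set a1)) (n_closure L T \<alpha> M2 n (set a2)) f \<and>
                map f a1 = a2) \<longrightarrow>
           (holds M1 \<phi> a1 \<longleftrightarrow> holds M2 \<phi> a2)"
proof -
  interpret colored_base L T "TYPE('u)" \<alpha>
    by unfold_locales fact+
  have M: "Tmodel M1" "Tmodel M2" using assms by (simp_all add: Tmodel_def)
  obtain n where n: "\<And>M N e1 e2. similar n {..<m} M N e1 e2 \<Longrightarrow> sat M e1 \<phi> \<longleftrightarrow> sat N e2 \<phi>"
    using similar_preserves[OF assms(15) finite_lessThan assms(16)] by blast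
  have "holds M1 \<phi> a1 \<longleftrightarrow> holds M2 \<phi> a2"
    if a: "a1 \<in> tuples M1 m" "a2 \<in> tuples M2 m"
      and f: "weak_isomorphism L M1 M2 (ncl M1 n (set a1)) (ncl M2 n (set a2)) f" "map f a1 = a2"
    for a1 a2 f
  proof -
    have len: "length a1 = m" "set a1 \<subseteq> carrier M1" "length a2 = m"
      using a by (auto simp: tuples_def)
    have im: "(!) a1 ` {..<m} = set a1" "(!) a2 ` {..<m} = set a2"
      using len by (auto simp: set_conv_nth)
    \<comment> \<open>Elementarity comes from the isomorphism of the generated structures, while
      colors are compared on the n-closures only.\<close>
    have "elementary_on L (reduct M1) (reduct M2) (ncl M1 n (set a1)) f"
    proof (rule elementary_on_weak_iso[OF Tmodel_models[OF M(1)] Tmodel_models[OF M(2)]])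
      show "isomorphism L (generated L (reduct M1) (ncl M1 n (set a1)))
          (generated L (reduct M2) (ncl M2 n (set a2))) f"
        using f(1) by (simp add: weak_isomorphism_def)
    qed (simp_all add: ncl_carrier)
    then have "cmap M1 M2 (ncl M1 n (set a1)) f" using f(1) by (simp add: cmap_def weak_isomorphism_def)
    moreover have "f ` ncl M1 n (set a1) = ncl M2 n (set a2)" using f(1) by (simp add: weak_isomorphism_def)
    moreover have "\<forall>v\<in>{..<m}. f (a1 ! v) = a2 ! v" using f(2) len by auto
    ultimately have "similar n {..<m} M1 M2 ((!) a1) ((!) a2)"
      unfolding similar_def im using M len(2) by blast
    then show ?thesis unfolding holds_def by (rule n)
  qed
  then show ?thesis by blast
qed

end
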